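(* Let $n\ge 2$ and $\mathtt{x}=(x_0,\dots,x_n)$. Let $K/\mathbb{Q}$ be a totally imaginary number field of degree $d\ge 4$ such that the action of $\mathrm{Gal}(\overline{\mathbb{Q}}/\mathbb{Q})$ on the set $\mathrm{Hom}(K,\overline{\mathbb{Q}})$ of embeddings is $2$-transitive. Let $l\in K[\mathtt{x}]$ be a linear form such that the $d$ Galois conjugates of the hyperplane $l=0$ are in general position, and let $f=N_{K/\mathbb{Q}}(l)\in\mathbb{Q}[\mathtt{x}]$. (a) There exists a nonzero form $h\in\mathbb{Q}[\mathtt{x}]$ of degree $d-2$, but no nonzero form $h\in\mathbb{Q}[\mathtt{x}]$ of smaller degree, for which $fh$ is a sum of squares of forms in $\mathbb{Q}[\mathtt{x}]$. (b) When $d=4$, any nonzero form $h\in\mathbb{Q}[\mathtt{x}]$ of degree $d-2=2$ for which $fh$ is a sum of squares of forms in $\mathbb{Q}[\mathtt{x}]$ is a sum of squares of linear forms in $\mathbb{Q}[\mathtt{x}]$.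
   Context: A form is a homogeneous polynomial. $\overline{\mathbb{Q}}$ is the algebraic closure of $\mathbb{Q}$ in $\mathbb{C}$; $\mathrm{Gal}(\overline{\mathbb{Q}}/\mathbb{Q})$ acts on $\mathrm{Hom}(K,\overline{\mathbb{Q}})$ (a set of $d$ elements) by composition. For $\varphi\in\mathrm{Hom}(K,\overline{\mathbb{Q}})$ let ${}^\varphi l$ be obtained by applying $\varphi$ to the coefficients of $l$. The Galois conjugates of the hyperplane $l=0$ are the $d$ hyperplanes ${}^\varphi l=0$ in $\mathbb{P}^n$, and $N_{K/\mathbb{Q}}(l)=\prod_{\varphi}{}^\varphi l$. These hyperplanes are in general position if the intersection of any $r\le n+1$ of them has codimension $r$ (the empty set being assigned codimension $n+1$). *)

theory Defs
  imports
    Complex_Main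
    "HOL-Computational_Algebra.Polynomial"
    "HOL-Library.Poly_Mapping"
    "HOL-Library.Function_Algebras"
begin

text \<open>
  A polynomial maps monomials (exponent vectors) to coefficients. The variables of the type are
  indexed by all natural numbers; \<open>x\<^sub>0, \<dots>, x\<^sub>n\<close> are those with index at most \<open>n\<close>.
\<close>

type_synonym 'a mpoly = "(nat \<Rightarrow>\<^sub>0 nat) \<Rightarrow>\<^sub>0 'a"

definition polys_in :: "nat \<Rightarrow> ('a::zero) mpoly set" where
  "polys_in n = {p. \<forall>m \<in> Poly_Mapping.keys p. Poly_Mapping.keys m \<subseteq> {..n}}"

definition homogeneous :: "nat \<Rightarrow> ('a::zero) mpoly \<Rightarrow> bool" where
  "homogeneous e p \<longleftrightarrow>
     (\<forall>m \<in> Poly_Mapping.keys p. (\<Sum>i \<in> Poly_Mapping.keys m. Poly_Mapping.lookup m i) = e)"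

text \<open>As usual, the zero polynomial is a form of every degree.\<close>

definition is_form :: "nat \<Rightarrow> nat \<Rightarrow> ('a::zero) mpoly \<Rightarrow> bool" where
  "is_form n e p \<longleftrightarrow> p \<in> polys_in n \<and> homogeneous e p"

definition sum_of_squares_of :: "('a::comm_semiring_1) mpoly set \<Rightarrow> 'a mpoly \<Rightarrow> bool" where
  "sum_of_squares_of A p \<longleftrightarrow> (\<exists>gs. set gs \<subseteq> A \<and> p = (\<Sum>g\<leftarrow>gs. g ^ 2))"

definition eval_mpoly :: "('a::comm_semiring_1) mpoly \<Rightarrow> (nat \<Rightarrow> 'a) \<Rightarrow> 'a" where
  "eval_mpoly p v =
     (\<Sum>m \<in> Poly_Mapping.keys p. Poly_Mapping.lookup p m *
        (\<Prod>i \<in> Poly_Mapping.keys m. v i ^ Poly_Mapping.lookup m i))"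

text \<open>A field of characteristic 0 as a vector space over the rationals.\<close>

definition rat_scale :: "rat \<Rightarrow> 'k \<Rightarrow> ('k::field_char_0)" where
  "rat_scale q x = of_rat q * x"

lemma vector_space_rat_scale: "vector_space rat_scale"
  by unfold_locales (simp_all add: rat_scale_def algebra_simps of_rat_add of_rat_mult)

definition number_field :: "'k::field_char_0 itself \<Rightarrow> bool" where
  "number_field _ \<longleftrightarrow> (\<exists>B::'k set. finite B \<and> module.span rat_scale B = UNIV)"

definition field_degree :: "'k::field_char_0 itself \<Rightarrow> nat" where
  "field_degree _ = vector_space.dim rat_scale (UNIV :: 'k set)"

definition field_embedding :: "('k::field \<Rightarrow> 'l::field) \<Rightarrow> bool" where
  "field_embedding \<phi> \<longleftrightarrow>
     \<phi> 1 = 1 \<and> (\<forall>x y. \<phi> (x + y) = \<phi> x + \<phi> y) \<and> (\<forall>x y. \<phi> (x * y) = \<phi> x * \<phi> y)"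

definition totally_imaginary :: "'k::field_char_0 itself \<Rightarrow> bool" where
  "totally_imaginary _ \<longleftrightarrow> \<not> (\<exists>\<phi> :: 'k \<Rightarrow> complex. field_embedding \<phi> \<and> range \<phi> \<subseteq> \<real>)"

definition Qbar :: "complex set" where
  "Qbar = {z. algebraic z}"

definition Embs :: "('k::field_char_0 \<Rightarrow> complex) set" where
  "Embs = {\<phi>. field_embedding \<phi> \<and> range \<phi> \<subseteq> Qbar}"

text \<open>
  Automorphisms of the field \<open>Qbar\<close>; they fix the rationals automatically. Only the values on
  \<open>Qbar\<close> matter, so each automorphism is represented by all of its extensions to functions on
  the complex numbers.
\<close>

definition Gal_Qbar :: "(complex \<Rightarrow> complex) set" where
  "Gal_Qbar = {\<sigma>. bij_betw \<sigma> Qbar Qbar \<and>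
     (\<forall>x \<in> Qbar. \<forall>y \<in> Qbar. \<sigma> (x + y) = \<sigma> x + \<sigma> y \<and> \<sigma> (x * y) = \<sigma> x * \<sigma> y)}"

definition galois_two_transitive :: "'k::field_char_0 itself \<Rightarrow> bool" where
  "galois_two_transitive _ \<longleftrightarrow>
     (\<forall>\<phi>\<^sub>1 \<in> Embs. \<forall>\<phi>\<^sub>2 \<in> Embs. \<forall>\<psi>\<^sub>1 \<in> Embs. \<forall>\<psi>\<^sub>2 \<in> (Embs :: ('k \<Rightarrow> complex) set).
        \<phi>\<^sub>1 \<noteq> \<phi>\<^sub>2 \<and> \<psi>\<^sub>1 \<noteq> \<psi>\<^sub>2 \<longrightarrow> (\<exists>\<sigma> \<in> Gal_Qbar. \<sigma> \<circ> \<phi>\<^sub>1 = \<psi>\<^sub>1 \<and> \<sigma> \<circ> \<phi>\<^sub>2 = \<psi>\<^sub>2))"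

text \<open>
  \<open>conjugate_poly \<phi> l\<close> applies \<open>\<phi>\<close> to the coefficients of \<open>l\<close>. The norm is a product of complex
  polynomials whose coefficients are rational (they are Galois invariant); it is taken to be
  the unique rational polynomial that maps to this product.
\<close>

definition conjugate_poly :: "('k::zero \<Rightarrow> 'l::zero) \<Rightarrow> 'k mpoly \<Rightarrow> 'l mpoly" where
  "conjugate_poly \<phi> l = Poly_Mapping.map \<phi> l"

definition norm_poly :: "('k::field_char_0) mpoly \<Rightarrow> rat mpoly" where
  "norm_poly l = (THE f. conjugate_poly of_rat f = (\<Prod>\<phi> \<in> Embs. conjugate_poly \<phi> l))"

text \<open>
  A projective linear subspace of complex projective \<open>n\<close>-space is represented by its affine
  cone, a linear subspace \<open>V\<close> of the space of \<open>(n+1)\<close>-tuples (functions vanishing beyond \<open>n\<close>).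
  Its codimension is \<open>n + 1 - dim V\<close>. The empty set has cone \<open>{0}\<close>, hence codimension \<open>n + 1\<close>.
\<close>

definition cone_of :: "nat \<Rightarrow> complex mpoly set \<Rightarrow> (nat \<Rightarrow> complex) set" where
  "cone_of n S = {v. (\<forall>i>n. v i = 0) \<and> (\<forall>p \<in> S. eval_mpoly p v = 0)}"

definition tuple_scale :: "complex \<Rightarrow> (nat \<Rightarrow> complex) \<Rightarrow> nat \<Rightarrow> complex" where
  "tuple_scale c v = (\<lambda>i. c * v i)"

lemma vector_space_tuple_scale: "vector_space tuple_scale"
  by unfold_locales (simp_all add: tuple_scale_def fun_eq_iff algebra_simps)

definition proj_codim :: "nat \<Rightarrow> (nat \<Rightarrow> complex) set \<Rightarrow> nat" where
  "proj_codim n V = n + 1 - vector_space.dim tuple_scale V"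

text \<open>
  The conjugate hyperplanes are counted as a family indexed by the embeddings. Taking
  \<open>card T = 1\<close> shows in particular that \<open>l \<noteq> 0\<close>.
\<close>

definition conjugates_in_general_position :: "nat \<Rightarrow> ('k::field_char_0) mpoly \<Rightarrow> bool" where
  "conjugates_in_general_position n l \<longleftrightarrow>
     (\<forall>T \<subseteq> Embs. finite T \<and> card T \<le> n + 1 \<longrightarrow>
        proj_codim n (cone_of n ((\<lambda>\<phi>. conjugate_poly \<phi> l) ` T)) = card T)"

end

theory Submission
  imports Defs "HOL-Computational_Algebra.Computational_Algebra"
begin

text \<open>
  Write \<open>l\<^sub>\<phi>\<close> for the conjugate of \<open>l\<close> under an embedding \<open>\<phi>\<close>, so that \<open>f\<close> is the product of the \<open>d\<close>
  forms \<open>l\<^sub>\<phi>\<close>.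

  \<^emph>\<open>Lower bound.\<close> Let \<open>f * h\<close> be the sum of the squares of rational forms \<open>g\<close>. Since \<open>K\<close> has no real
  embedding, \<open>\<phi>\<close> differs from its complex conjugate \<open>\<psi>\<close>, and the space \<open>l\<^sub>\<phi> = l\<^sub>\<psi> = 0\<close> is defined over the
  reals. At its real points the sum of squares is zero, hence so is every \<open>g\<close>. By 2-transitivity a
  Galois automorphism moves the pair \<open>\<phi>, \<psi>\<close> to any other pair of embeddings, and \<open>g\<close> is fixed by it.
  So \<open>g\<close> vanishes on all intersections of two conjugate hyperplanes
  (\<open>squares_vanish_on_pairs\<close>). A line in general position in one of the hyperplanes meets the others
  in \<open>d - 1\<close> distinct points, and a line in general position in the whole space meets the
  hyperplanes in \<open>d\<close> distinct points; so a form of degree less than \<open>d - 1\<close> with these zeros is zero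
  (\<open>low_degree_form_vanishes\<close>). Therefore \<open>f * h\<close> has degree at least \<open>2 * (d - 1)\<close>.

  \<^emph>\<open>Existence.\<close> By the theory of Artin and Schreier, there are elements \<open>a\<close> of \<open>K\<close>, not all zero, whose
  squares have sum zero, because an ordering of \<open>K\<close> would give a real embedding
  (\<open>totally_imaginary_sum_squares_eq_0\<close>). Let \<open>g\<^sub>a\<close> be the trace of \<open>a * f / l\<close>, that is, the sum of
  \<open>\<phi> a * f / l\<^sub>\<phi>\<close> over all \<open>\<phi>\<close>. In the sum of the squares of the \<open>g\<^sub>a\<close>, the coefficient of
  \<open>(f / l\<^sub>\<phi>)\<^sup>2\<close> is \<open>\<phi>\<close> of the sum of the squares of the \<open>a\<close>, which is zero. All the mixed terms are
  divisible by \<open>f\<close>, and the quotient has degree \<open>d - 2\<close> (\<open>multiplier_exists\<close>).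

  \<^emph>\<open>Quadratic multipliers.\<close> At a rational point, \<open>f\<close> is a product of pairs of complex conjugate
  numbers, so it is nonnegative. Hence a multiplier \<open>h\<close> is nonnegative where \<open>f\<close> is not zero, and then
  everywhere. A rational quadratic form that is nonnegative is a sum of squares of linear forms by
  completing squares (\<open>psd_quadratic_form_sum_of_squares\<close>).

  The arithmetic input is that \<open>K\<close> has exactly \<open>d\<close> embeddings (\<open>card_Embs\<close>) and that \<open>f\<close> and \<open>g\<^sub>a\<close> have
  rational coefficients. Newton's identities reduce the latter to the rationality of traces, and
  this in turn to the rationality of the characteristic polynomial of a primitive element.
\<close>


section \<open>Polynomials in several variables\<close>

abbreviation (input) lookup :: "('a \<Rightarrow>\<^sub>0 'b::zero) \<Rightarrow> 'a \<Rightarrow> 'b" where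
  "lookup \<equiv> Poly_Mapping.lookup"

abbreviation (input) keys :: "('a \<Rightarrow>\<^sub>0 'b::zero) \<Rightarrow> 'a set" where
  "keys \<equiv> Poly_Mapping.keys"

abbreviation (input) single :: "'a \<Rightarrow> 'b::zero \<Rightarrow> 'a \<Rightarrow>\<^sub>0 'b" where
  "single \<equiv> Poly_Mapping.single"

lemma mpoly_sum_singles:
  "p = (\<Sum>m\<in>keys p. single m (lookup p m))"
proof (rule poly_mapping_eqI)
  fix k
  have "lookup (\<Sum>m\<in>keys p. single m (lookup p m)) k
      = (\<Sum>m\<in>keys p. if m = k then lookup p m else 0)"
    unfolding lookup_sum by (intro sum.cong refl) (simp add: lookup_single when_def)
  also have "\<dots> = lookup p k"
    by (simp add: sum.delta in_keys_iff)
  finally show "lookup p k = lookup (\<Sum>m\<in>keys p. single m (lookup p m)) k"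
    by simp
qed

lemma mpoly_induct [case_names zero single add]:
  fixes p :: "'a \<Rightarrow>\<^sub>0 'b::comm_monoid_add"
  assumes "P 0" "\<And>m c. P (single m c)" "\<And>p q. P p \<Longrightarrow> P q \<Longrightarrow> P (p + q)"
  shows "P p"
proof -
  have "P (\<Sum>m\<in>A. single m (lookup p m))" if "finite A" for A
    using that by (induction A rule: finite_induct) (auto intro: assms)
  from this[of "keys p"] show ?thesis
    by (simp flip: mpoly_sum_singles)
qed

definition monom_val :: "(nat \<Rightarrow>\<^sub>0 nat) \<Rightarrow> (nat \<Rightarrow> 'a::comm_semiring_1) \<Rightarrow> 'a" where
  "monom_val m v = (\<Prod>i \<in> keys m. v i ^ lookup m i)"

definition monom_deg :: "(nat \<Rightarrow>\<^sub>0 nat) \<Rightarrow> nat" where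
  "monom_deg m = (\<Sum>i \<in> keys m. lookup m i)"

lemma monom_val_superset:
  assumes "finite A" "keys m \<subseteq> A"
  shows "monom_val m v = (\<Prod>i\<in>A. v i ^ lookup m i)"
  unfolding monom_val_def using assms
  by (intro prod.mono_neutral_left) (auto simp: in_keys_iff)

lemma monom_deg_superset:
  assumes "finite A" "keys m \<subseteq> A"
  shows "monom_deg m = (\<Sum>i\<in>A. lookup m i)"
  unfolding monom_deg_def using assms
  by (intro sum.mono_neutral_left) (auto simp: in_keys_iff)

lemma monom_val_add: "monom_val (m + m') v = monom_val m v * monom_val m' v"
proof -
  let ?A = "keys m \<union> keys m'"
  have "keys (m + m') \<subseteq> ?A" by (rule keys_add)
  thus ?thesis
    by (simp add: monom_val_superset[of ?A] lookup_add power_add prod.distrib)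
qed

lemma monom_deg_add: "monom_deg (m + m') = monom_deg m + monom_deg m'"
proof -
  let ?A = "keys m \<union> keys m'"
  have "keys (m + m') \<subseteq> ?A" by (rule keys_add)
  thus ?thesis
    by (simp add: monom_deg_superset[of ?A] lookup_add sum.distrib)
qed

lemma monom_val_0 [simp]: "monom_val 0 v = 1"
  by (simp add: monom_val_def)

lemma eval_mpoly_superset:
  assumes "finite A" "keys p \<subseteq> A"
  shows "eval_mpoly p v = (\<Sum>m\<in>A. lookup p m * monom_val m v)"
  unfolding eval_mpoly_def monom_val_def using assms
  by (intro sum.mono_neutral_left) (auto simp: in_keys_iff)

lemma eval_mpoly_eq: "eval_mpoly p v = (\<Sum>m\<in>keys p. lookup p m * monom_val m v)"
  by (rule eval_mpoly_superset) auto

lemma eval_mpoly_add: "eval_mpoly (p + q) v = eval_mpoly p v + eval_mpoly q v"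
proof -
  let ?A = "keys p \<union> keys q"
  have "keys (p + q) \<subseteq> ?A" by (rule keys_add)
  thus ?thesis
    by (simp add: eval_mpoly_superset[of ?A] lookup_add algebra_simps sum.distrib)
qed

lemma eval_mpoly_0 [simp]: "eval_mpoly 0 v = 0"
  by (simp add: eval_mpoly_def)

lemma eval_mpoly_single [simp]: "eval_mpoly (single m c) v = c * monom_val m v"
  by (cases "c = 0") (simp_all add: eval_mpoly_eq)

lemma eval_mpoly_1 [simp]: "eval_mpoly 1 v = 1"
  by (simp flip: single_one)

lemma eval_mpoly_mult: "eval_mpoly (p * q) v = eval_mpoly p v * eval_mpoly q v"
proof (induction p rule: mpoly_induct)
  case (single m c)
  show ?case
    by (induction q rule: mpoly_induct)
       (simp_all add: mult_single monom_val_add eval_mpoly_add algebra_simps)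
qed (simp_all add: eval_mpoly_add algebra_simps)

lemma eval_mpoly_sum: "eval_mpoly (sum f A) v = (\<Sum>a\<in>A. eval_mpoly (f a) v)"
  by (induction A rule: infinite_finite_induct) (simp_all add: eval_mpoly_add)

lemma eval_mpoly_prod: "eval_mpoly (prod f A) v = (\<Prod>a\<in>A. eval_mpoly (f a) v)"
  by (induction A rule: infinite_finite_induct) (simp_all add: eval_mpoly_mult)

lemma eval_mpoly_power: "eval_mpoly (p ^ k) v = eval_mpoly p v ^ k"
  by (induction k) (simp_all add: eval_mpoly_mult)

lemma eval_mpoly_sum_list: "eval_mpoly (sum_list ps) v = (\<Sum>p\<leftarrow>ps. eval_mpoly p v)"
  by (induction ps) (simp_all add: eval_mpoly_add)


subsection \<open>Applying a function to the coefficients\<close>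

lemma lookup_conjugate_poly:
  "\<phi> 0 = 0 \<Longrightarrow> lookup (conjugate_poly \<phi> p) m = \<phi> (lookup p m)"
  by (simp add: conjugate_poly_def map.rep_eq when_def)

lemma keys_conjugate_poly: "keys (conjugate_poly \<phi> p) \<subseteq> keys p"
  by (auto simp: conjugate_poly_def in_keys_iff map.rep_eq when_def)

lemma conjugate_poly_0 [simp]: "conjugate_poly \<phi> 0 = 0"
  using keys_conjugate_poly[of \<phi> 0] by (metis keys_eq_empty keys_zero subset_empty)

abbreviation (input) complexify :: "rat mpoly \<Rightarrow> complex mpoly" where
  "complexify \<equiv> conjugate_poly of_rat"

lemma conjugate_poly_add:
  assumes "\<phi> 0 = 0" "\<And>x y. \<phi> (x + y) = \<phi> x + \<phi> y"
  shows "conjugate_poly \<phi> (p + q) = conjugate_poly \<phi> p + conjugate_poly \<phi> q"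
  using assms by (intro poly_mapping_eqI) (simp add: lookup_add lookup_conjugate_poly)

lemma conjugate_poly_single:
  "\<phi> 0 = 0 \<Longrightarrow> conjugate_poly \<phi> (single m c) = single m (\<phi> c)"
  by (intro poly_mapping_eqI) (simp add: lookup_single lookup_conjugate_poly when_def)

lemma conjugate_poly_mult:
  assumes "\<phi> 0 = 0" "\<And>x y. \<phi> (x + y) = \<phi> x + \<phi> y" "\<And>x y. \<phi> (x * y) = \<phi> x * \<phi> y"
  shows "conjugate_poly \<phi> (p * q) = conjugate_poly \<phi> p * conjugate_poly \<phi> q"
proof (induction p rule: mpoly_induct)
  case (single m c)
  show ?case
    by (induction q rule: mpoly_induct)
       (simp_all add: mult_single conjugate_poly_add[OF assms(1,2)] conjugate_poly_single[of \<phi>, OF assms(1)]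
          assms algebra_simps)
qed (simp_all add: conjugate_poly_add[OF assms(1,2)] algebra_simps)

text \<open>
  For a linear retraction \<open>\<rho>\<close> of an inclusion \<open>\<iota>\<close>, this is how an identity between polynomials with
  large coefficients descends to an identity between polynomials with small coefficients.
\<close>

lemma conjugate_poly_retract_mult:
  assumes "\<rho> 0 = 0" "\<And>x y. \<rho> (x + y) = \<rho> x + \<rho> y" "\<iota> 0 = 0" "\<And>x y. \<iota> (x + y) = \<iota> x + \<iota> y"
    and "\<And>x y. \<rho> (\<iota> x * y) = x * \<rho> y"
  shows "conjugate_poly \<rho> (conjugate_poly \<iota> p * q) = p * conjugate_poly \<rho> q"
proof (induction p rule: mpoly_induct)
  case (single m c)
  show ?case
    by (induction q rule: mpoly_induct)
       (simp_all add: mult_single conjugate_poly_add[OF assms(1,2)] conjugate_poly_single[of \<rho>, OF assms(1)]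
          conjugate_poly_single[of \<iota>, OF assms(3)] assms algebra_simps)
qed (simp_all add: conjugate_poly_add[OF assms(1,2)] conjugate_poly_add[OF assms(3,4)] algebra_simps)

lemma conjugate_poly_compose:
  "\<phi> 0 = 0 \<Longrightarrow> \<psi> 0 = 0 \<Longrightarrow> conjugate_poly \<phi> (conjugate_poly \<psi> p) = conjugate_poly (\<phi> \<circ> \<psi>) p"
  by (intro poly_mapping_eqI) (simp add: lookup_conjugate_poly)

lemma conjugate_poly_inj:
  assumes "\<phi> 0 = 0" "inj \<phi>" "conjugate_poly \<phi> p = conjugate_poly \<phi> q"
  shows "p = q"
proof (rule poly_mapping_eqI)
  fix m
  have "\<phi> (lookup p m) = \<phi> (lookup q m)"
    using assms(3) by (simp flip: lookup_conjugate_poly[of \<phi>, OF assms(1)])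
  thus "lookup p m = lookup q m"
    using assms(2) by (simp add: inj_eq)
qed


subsection \<open>Ring homomorphisms on subrings\<close>

text \<open>
  Galois automorphisms are given as functions on the complex numbers that respect the ring
  operations on the algebraic numbers only, and embeddings are built up on an increasing sequence
  of subfields. This is why homomorphisms are relative to a subring.
\<close>

definition ring_hom_on :: "'a::comm_ring_1 set \<Rightarrow> ('a \<Rightarrow> 'b::idom) \<Rightarrow> bool" where
  "ring_hom_on F \<sigma> \<longleftrightarrow> \<sigma> 1 = 1 \<and> (\<forall>x\<in>F. \<forall>y\<in>F. \<sigma> (x + y) = \<sigma> x + \<sigma> y \<and> \<sigma> (x * y) = \<sigma> x * \<sigma> y)"

definition subring_of :: "'a::comm_ring_1 set \<Rightarrow> bool" where
  "subring_of F \<longleftrightarrow> 1 \<in> F \<and> (\<forall>x\<in>F. - x \<in> F) \<and> (\<forall>x\<in>F. \<forall>y\<in>F. x + y \<in> F \<and> x * y \<in> F)"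

lemma subring_of_UNIV [simp]: "subring_of UNIV"
  by (simp add: subring_of_def)

lemma
  assumes "subring_of F"
  shows subring_of_0: "0 \<in> F"
    and subring_of_1: "1 \<in> F"
    and subring_of_add: "x \<in> F \<Longrightarrow> y \<in> F \<Longrightarrow> x + y \<in> F"
    and subring_of_mult: "x \<in> F \<Longrightarrow> y \<in> F \<Longrightarrow> x * y \<in> F"
    and subring_of_uminus: "x \<in> F \<Longrightarrow> - x \<in> F"
    and subring_of_diff: "x \<in> F \<Longrightarrow> y \<in> F \<Longrightarrow> x - y \<in> F"
proof -
  show "0 \<in> F" using assms unfolding subring_of_def by (metis add.right_inverse)
  show "x \<in> F \<Longrightarrow> y \<in> F \<Longrightarrow> x - y \<in> F"
    using assms unfolding subring_of_def by (metis diff_conv_add_uminus)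
qed (use assms in \<open>auto simp: subring_of_def\<close>)

lemma subring_of_sum: "subring_of F \<Longrightarrow> (\<And>a. a \<in> A \<Longrightarrow> f a \<in> F) \<Longrightarrow> sum f A \<in> F"
  by (induction A rule: infinite_finite_induct) (auto intro: subring_of_0 subring_of_add)

lemma subring_of_prod: "subring_of F \<Longrightarrow> (\<And>a. a \<in> A \<Longrightarrow> f a \<in> F) \<Longrightarrow> prod f A \<in> F"
  by (induction A rule: infinite_finite_induct) (auto intro: subring_of_1 subring_of_mult)

lemma subring_of_power: "subring_of F \<Longrightarrow> x \<in> F \<Longrightarrow> x ^ k \<in> F"
  by (induction k) (auto intro: subring_of_1 subring_of_mult)

lemma subring_of_of_nat: "subring_of F \<Longrightarrow> of_nat k \<in> F"
  by (induction k) (auto intro: subring_of_0 subring_of_1 subring_of_add)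

context
  fixes F :: "'a::comm_ring_1 set" and \<sigma> :: "'a \<Rightarrow> 'b::idom"
  assumes F: "subring_of F" and \<sigma>: "ring_hom_on F \<sigma>"
begin

lemma ring_hom_on_1: "\<sigma> 1 = 1"
  using \<sigma> by (simp add: ring_hom_on_def)

lemma ring_hom_on_add: "x \<in> F \<Longrightarrow> y \<in> F \<Longrightarrow> \<sigma> (x + y) = \<sigma> x + \<sigma> y"
  using \<sigma> by (simp add: ring_hom_on_def)

lemma ring_hom_on_mult: "x \<in> F \<Longrightarrow> y \<in> F \<Longrightarrow> \<sigma> (x * y) = \<sigma> x * \<sigma> y"
  using \<sigma> by (simp add: ring_hom_on_def)

lemma ring_hom_on_0: "\<sigma> 0 = 0"
proof -
  have "\<sigma> (0 + 0) = \<sigma> 0 + \<sigma> 0" using F by (intro ring_hom_on_add subring_of_0)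
  thus ?thesis by (simp only: add_0_right add_cancel_right_right)
qed

lemma ring_hom_on_uminus: "x \<in> F \<Longrightarrow> \<sigma> (- x) = - \<sigma> x"
  using ring_hom_on_add[of x "- x"] F
  by (simp add: subring_of_uminus ring_hom_on_0 eq_neg_iff_add_eq_0 add.commute)

lemma ring_hom_on_diff: "x \<in> F \<Longrightarrow> y \<in> F \<Longrightarrow> \<sigma> (x - y) = \<sigma> x - \<sigma> y"
  using ring_hom_on_add[of x "- y"] ring_hom_on_uminus F by (simp add: subring_of_uminus)

lemma ring_hom_on_sum: "(\<And>a. a \<in> A \<Longrightarrow> f a \<in> F) \<Longrightarrow> \<sigma> (sum f A) = (\<Sum>a\<in>A. \<sigma> (f a))"
  by (induction A rule: infinite_finite_induct)
     (auto simp: ring_hom_on_0 ring_hom_on_add subring_of_sum F)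

lemma ring_hom_on_prod: "(\<And>a. a \<in> A \<Longrightarrow> f a \<in> F) \<Longrightarrow> \<sigma> (prod f A) = (\<Prod>a\<in>A. \<sigma> (f a))"
  by (induction A rule: infinite_finite_induct)
     (auto simp: ring_hom_on_1 ring_hom_on_mult subring_of_prod F)

lemma ring_hom_on_power: "x \<in> F \<Longrightarrow> \<sigma> (x ^ k) = \<sigma> x ^ k"
  by (induction k) (auto simp: ring_hom_on_1 ring_hom_on_mult subring_of_power F)

lemma ring_hom_on_of_nat: "\<sigma> (of_nat k) = of_nat k"
  by (induction k) (auto simp: ring_hom_on_1 ring_hom_on_0 ring_hom_on_add subring_of_1 subring_of_of_nat F)

lemma eval_conjugate_poly_on:
  assumes "\<And>m. lookup p m \<in> F" "\<And>i. v i \<in> F"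
  shows "eval_mpoly (conjugate_poly \<sigma> p) (\<lambda>i. \<sigma> (v i)) = \<sigma> (eval_mpoly p v)"
proof -
  have monom: "monom_val m v \<in> F" "\<sigma> (monom_val m v) = monom_val m (\<lambda>i. \<sigma> (v i))" for m
    using assms F by (simp_all add: monom_val_def ring_hom_on_prod ring_hom_on_power
      subring_of_prod subring_of_power)
  have "eval_mpoly (conjugate_poly \<sigma> p) (\<lambda>i. \<sigma> (v i)) =
     (\<Sum>m\<in>keys p. \<sigma> (lookup p m) * monom_val m (\<lambda>i. \<sigma> (v i)))"
    by (subst eval_mpoly_superset[OF _ keys_conjugate_poly])
       (simp_all add: lookup_conjugate_poly ring_hom_on_0)
  also have "\<dots> = \<sigma> (eval_mpoly p v)"
    unfolding eval_mpoly_eq using assms F monom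
    by (simp add: ring_hom_on_sum ring_hom_on_mult subring_of_mult)
  finally show ?thesis .
qed

end

lemma field_embedding_iff_ring_hom_on: "field_embedding \<phi> \<longleftrightarrow> ring_hom_on UNIV \<phi>"
  by (auto simp: field_embedding_def ring_hom_on_def)

lemma
  assumes "field_embedding \<phi>"
  shows field_embedding_0: "\<phi> 0 = 0"
    and field_embedding_1: "\<phi> 1 = 1"
    and field_embedding_add: "\<phi> (x + y) = \<phi> x + \<phi> y"
    and field_embedding_mult: "\<phi> (x * y) = \<phi> x * \<phi> y"
    and field_embedding_uminus: "\<phi> (- x) = - \<phi> x"
    and field_embedding_diff: "\<phi> (x - y) = \<phi> x - \<phi> y"
    and field_embedding_sum: "\<phi> (sum f A) = (\<Sum>a\<in>A. \<phi> (f a))"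
    and field_embedding_power: "\<phi> (x ^ k) = \<phi> x ^ k"
    and eval_conjugate_poly: "eval_mpoly (conjugate_poly \<phi> p) (\<lambda>i. \<phi> (v i)) = \<phi> (eval_mpoly p v)"
  using assms unfolding field_embedding_iff_ring_hom_on
  by (simp_all add: ring_hom_on_0[of UNIV] ring_hom_on_1[of UNIV] ring_hom_on_add[of UNIV]
      ring_hom_on_mult[of UNIV] ring_hom_on_sum[of UNIV] ring_hom_on_power[of UNIV]
      ring_hom_on_uminus[of UNIV] ring_hom_on_diff[of UNIV] eval_conjugate_poly_on[of UNIV])

lemma field_embedding_eq_0_iff: "field_embedding \<phi> \<Longrightarrow> \<phi> x = 0 \<longleftrightarrow> x = 0"
  by (metis field_embedding_0 field_embedding_1 field_embedding_mult mult_zero_left right_inverse zero_neq_one)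

lemma field_embedding_inj: "field_embedding \<phi> \<Longrightarrow> inj \<phi>"
  by (rule injI) (metis field_embedding_diff field_embedding_eq_0_iff right_minus_eq)

lemma field_embedding_of_rat [simp]: "field_embedding (of_rat :: rat \<Rightarrow> 'a::field_char_0)"
  by (simp add: field_embedding_def of_rat_add of_rat_mult)

lemma field_embedding_cnj [simp]: "field_embedding cnj"
  by (simp add: field_embedding_def)

lemma field_embedding_comp: "field_embedding \<phi> \<Longrightarrow> field_embedding \<psi> \<Longrightarrow> field_embedding (\<phi> \<circ> \<psi>)"
  by (simp add: field_embedding_def)

lemma field_embedding_of_rat_apply:
  fixes \<phi> :: "'a::field_char_0 \<Rightarrow> 'b::field_char_0"
  assumes "field_embedding \<phi>"
  shows "\<phi> (of_rat q) = of_rat q"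
proof (cases q)
  case (Fract a b)
  have nat: "\<phi> (of_nat k) = of_nat k" for k
    using assms by (simp add: field_embedding_iff_ring_hom_on ring_hom_on_of_nat[of UNIV])
  have int: "\<phi> (of_int k) = of_int k" for k
  proof (cases k rule: int_cases2)
    case (nonneg m)
    thus ?thesis using nat[of m] by simp
  next
    case (nonpos m)
    thus ?thesis using nat[of m] field_embedding_uminus[OF assms, of "of_nat m"] by simp
  qed
  have "\<phi> (of_rat q) * of_int b = \<phi> (of_rat q * of_int b)"
    by (simp add: field_embedding_mult[OF assms] int)
  also have "of_rat q * of_int b = (of_int a :: 'a)"
    using Fract by (simp add: of_rat_rat)
  finally show ?thesis
    using Fract by (simp add: int of_rat_rat field_simps)
qed

lemma
  assumes "field_embedding \<phi>"
  shows conjugate_poly_add': "conjugate_poly \<phi> (p + q) = conjugate_poly \<phi> p + conjugate_poly \<phi> q"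
    and conjugate_poly_mult': "conjugate_poly \<phi> (p * q) = conjugate_poly \<phi> p * conjugate_poly \<phi> q"
    and conjugate_poly_1': "conjugate_poly \<phi> 1 = 1"
    and conjugate_poly_eq_iff: "conjugate_poly \<phi> p = conjugate_poly \<phi> q \<longleftrightarrow> p = q"
proof -
  note [simp] = field_embedding_0[OF assms] field_embedding_1[OF assms]
    field_embedding_add[OF assms] field_embedding_mult[OF assms]
  show "conjugate_poly \<phi> (p + q) = conjugate_poly \<phi> p + conjugate_poly \<phi> q"
    by (rule conjugate_poly_add) simp_all
  show "conjugate_poly \<phi> (p * q) = conjugate_poly \<phi> p * conjugate_poly \<phi> q"
    by (rule conjugate_poly_mult) simp_all
  show "conjugate_poly \<phi> 1 = 1"
    by (simp add: conjugate_poly_single flip: single_one)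
  show "conjugate_poly \<phi> p = conjugate_poly \<phi> q \<longleftrightarrow> p = q"
    using conjugate_poly_inj[of \<phi> p q] field_embedding_inj[OF assms] by auto
qed

lemma conjugate_poly_eq_0_iff: "field_embedding \<phi> \<Longrightarrow> conjugate_poly \<phi> p = 0 \<longleftrightarrow> p = 0"
  by (metis conjugate_poly_0 conjugate_poly_eq_iff)

lemma conjugate_poly_sum_list:
  "field_embedding \<phi> \<Longrightarrow> conjugate_poly \<phi> (sum_list ps) = (\<Sum>p\<leftarrow>ps. conjugate_poly \<phi> p)"
  by (induction ps) (simp_all add: conjugate_poly_add')

lemma conjugate_poly_power:
  "field_embedding \<phi> \<Longrightarrow> conjugate_poly \<phi> (p ^ k) = conjugate_poly \<phi> p ^ k"
  by (induction k) (simp_all add: conjugate_poly_1' conjugate_poly_mult')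


subsection \<open>Forms\<close>

lemma is_form_iff:
  "is_form n e p \<longleftrightarrow> (\<forall>m\<in>keys p. keys m \<subseteq> {..n} \<and> monom_deg m = e)"
  by (auto simp: is_form_def polys_in_def homogeneous_def monom_deg_def)

lemma is_form_0 [simp]: "is_form n e 0"
  by (simp add: is_form_iff)

lemma is_form_add: "is_form n e p \<Longrightarrow> is_form n e q \<Longrightarrow> is_form n e (p + q)"
  unfolding is_form_iff using keys_add[of p q] by (metis UnE subsetD)

lemma is_form_sum: "(\<And>a. a \<in> A \<Longrightarrow> is_form n e (f a)) \<Longrightarrow> is_form n e (sum f A)"
  by (induction A rule: infinite_finite_induct) (auto intro: is_form_add)

lemma is_form_mult:
  assumes "is_form n e p" "is_form n e' q"
  shows "is_form n (e + e') (p * q)"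
  unfolding is_form_iff
proof
  fix m assume "m \<in> keys (p * q)"
  then obtain a b where m: "m = a + b" "a \<in> keys p" "b \<in> keys q"
    using keys_mult[of p q] by auto
  have a: "keys a \<subseteq> {..n}" "monom_deg a = e"
    using assms(1) m(2) by (auto simp: is_form_iff)
  have b: "keys b \<subseteq> {..n}" "monom_deg b = e'"
    using assms(2) m(3) by (auto simp: is_form_iff)
  have "keys m \<subseteq> keys a \<union> keys b"
    unfolding m(1) by (rule keys_add)
  thus "keys m \<subseteq> {..n} \<and> monom_deg m = e + e'"
    using a b m(1) by (auto simp: monom_deg_add)
qed

lemma is_form_1 [simp]: "is_form n 0 1"
  by (simp add: is_form_iff monom_deg_def)

lemma is_form_single_0: "is_form n 0 (single 0 c)"
  by (simp add: is_form_iff monom_deg_def)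

lemma is_form_const_mult: "is_form n e p \<Longrightarrow> is_form n e (single 0 c * p)"
  using is_form_mult[OF is_form_single_0] by fastforce

lemma is_form_prod: "(\<And>a. a \<in> A \<Longrightarrow> is_form n 1 (f a)) \<Longrightarrow> is_form n (card A) (prod f A)"
proof (induction A rule: infinite_finite_induct)
  case (insert a A)
  thus ?case using is_form_mult[of n 1 "f a" "card A" "prod f A"] by simp
qed auto

lemma is_form_conjugate: "is_form n e p \<Longrightarrow> is_form n e (conjugate_poly \<phi> p)"
  unfolding is_form_iff using keys_conjugate_poly by blast

lemma is_form_conjugate_iff:
  assumes "field_embedding \<phi>"
  shows "is_form n e (conjugate_poly \<phi> p) \<longleftrightarrow> is_form n e p"
proof -
  have "keys (conjugate_poly \<phi> p) = keys p"
    using assms by (auto simp: in_keys_iff lookup_conjugate_poly field_embedding_0 field_embedding_eq_0_iff)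
  thus ?thesis by (simp add: is_form_iff)
qed

lemma eval_form_scale:
  assumes "is_form n e p"
  shows "eval_mpoly p (\<lambda>i. c * v i) = c ^ e * eval_mpoly p v"
proof -
  have "monom_val m (\<lambda>i. c * v i) = c ^ monom_deg m * monom_val m v" for m
    by (simp add: monom_val_def monom_deg_def power_mult_distrib prod.distrib power_sum)
  hence "eval_mpoly p (\<lambda>i. c * v i)
      = (\<Sum>m\<in>keys p. c ^ e * (lookup p m * monom_val m v))"
    unfolding eval_mpoly_eq using assms by (intro sum.cong) (auto simp: is_form_iff algebra_simps)
  thus ?thesis by (simp add: eval_mpoly_eq sum_distrib_left)
qed

lemma eval_mpoly_cong:
  assumes "p \<in> polys_in n" "\<And>i. i \<le> n \<Longrightarrow> v i = w i"
  shows "eval_mpoly p v = eval_mpoly p w"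
proof -
  have "monom_val m v = monom_val m w" if "m \<in> keys p" for m
    unfolding monom_val_def
  proof (intro prod.cong refl)
    fix i assume "i \<in> keys m"
    hence "i \<le> n" using assms(1) that by (auto simp: polys_in_def)
    thus "v i ^ lookup m i = w i ^ lookup m i" by (simp add: assms(2))
  qed
  thus ?thesis by (simp add: eval_mpoly_eq)
qed

text \<open>
  Through this lemma the zeros of forms are studied by counting zeros of polynomials in one
  variable.
\<close>

lemma eval_form_on_line:
  fixes p :: "'a::idom mpoly"
  assumes "is_form n e p"
  obtains u :: "'a poly" where "degree u \<le> e" "\<And>t. poly u t = eval_mpoly p (\<lambda>i. a i + t * b i)"
proof
  define u where "u = (\<Sum>m\<in>keys p. smult (lookup p m)
     (\<Prod>i\<in>keys m. [:a i, b i:] ^ lookup m i))"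
  show "poly u t = eval_mpoly p (\<lambda>i. a i + t * b i)" for t
    unfolding u_def eval_mpoly_def by (simp add: poly_sum poly_prod poly_power mult.commute)
  show "degree u \<le> e"
    unfolding u_def
  proof (rule degree_sum_le)
    fix m assume m: "m \<in> keys p"
    have "degree (smult (lookup p m)
       (\<Prod>i\<in>keys m. [:a i, b i:] ^ lookup m i))
      \<le> degree (\<Prod>i\<in>keys m. [:a i, b i:] ^ lookup m i)"
      by (rule degree_smult_le)
    also have "\<dots> \<le> (\<Sum>i\<in>keys m. degree ([:a i, b i:] ^ lookup m i))"
      using degree_prod_sum_le[of "keys m"] by (simp add: comp_def)
    also have "\<dots> \<le> (\<Sum>i\<in>keys m. lookup m i)"
    proof (rule sum_mono)
      fix i
      have "degree ([:a i, b i:] ^ lookup m i) \<le> degree [:a i, b i:] * lookup m i"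
        by (rule degree_power_le)
      also have "\<dots> \<le> lookup m i" by simp
      finally show "degree ([:a i, b i:] ^ lookup m i) \<le> lookup m i" .
    qed
    also have "\<dots> = e" using assms m by (simp add: is_form_iff monom_deg_def)
    finally show "degree (smult (lookup p m)
       (\<Prod>i\<in>keys m. [:a i, b i:] ^ lookup m i)) \<le> e" .
  qed simp
qed

lemma eval_linear_form:
  assumes "is_form n 1 p"
  shows "eval_mpoly p v = (\<Sum>i\<le>n. lookup p (single i 1) * v i)"
proof -
  let ?X = "\<lambda>i::nat. single i (1::nat)"
  have keys: "keys p \<subseteq> ?X ` {..n}"
  proof
    fix m assume "m \<in> keys p"
    hence m: "keys m \<subseteq> {..n}" "(\<Sum>i\<in>keys m. lookup m i) = 1"
      using assms by (auto simp: is_form_iff monom_deg_def)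
    then obtain i where i: "i \<in> keys m" "lookup m i = 1"
        "\<And>j. j \<in> keys m \<Longrightarrow> j \<noteq> i \<Longrightarrow> lookup m j = 0"
      by (subst (asm) sum_eq_1_iff) auto
    hence "lookup m j = (if j = i then 1 else 0)" for j
      by (metis in_keys_iff)
    hence "m = ?X i"
      by (intro poly_mapping_eqI) (simp add: lookup_single when_def)
    thus "m \<in> ?X ` {..n}" using i m by blast
  qed
  have inj: "inj_on ?X {..n}"
    by (rule inj_onI) (metis One_nat_def lookup_single_eq lookup_single_not_eq zero_neq_one)
  have "eval_mpoly p v = (\<Sum>m\<in>?X ` {..n}. lookup p m * monom_val m v)"
    by (rule eval_mpoly_superset[OF _ keys]) simp
  also have "\<dots> = (\<Sum>i\<le>n. lookup p (?X i) * monom_val (?X i) v)"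
    unfolding sum.reindex[OF inj] by simp
  also have "\<dots> = (\<Sum>i\<le>n. lookup p (?X i) * v i)"
    by (simp add: monom_val_def)
  finally show ?thesis .
qed

lemma sum_digits_inj:
  fixes a b :: "nat \<Rightarrow> nat"
  assumes "\<And>i. i < k \<Longrightarrow> a i < N" "\<And>i. i < k \<Longrightarrow> b i < N"
    and "(\<Sum>i<k. a i * N ^ i) = (\<Sum>i<k. b i * N ^ i)" "i < k"
  shows "a i = b i"
  using assms
proof (induction k arbitrary: a b i)
  case (Suc k)
  have split: "(\<Sum>i<Suc k. c i * N ^ i) = c 0 + N * (\<Sum>i<k. c (Suc i) * N ^ i)" for c :: "nat \<Rightarrow> nat"
    by (subst sum.lessThan_Suc_shift) (simp add: sum_distrib_left algebra_simps)
  have eq: "a 0 + N * (\<Sum>i<k. a (Suc i) * N ^ i) = b 0 + N * (\<Sum>i<k. b (Suc i) * N ^ i)"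
    using Suc.prems(3) unfolding split .
  have lt: "a 0 < N" "b 0 < N" using Suc.prems(1,2)[of 0] by auto
  have 0: "a 0 = b 0"
    using arg_cong[OF eq, of "\<lambda>x. x mod N"] lt by simp
  with eq lt have "(\<Sum>i<k. a (Suc i) * N ^ i) = (\<Sum>i<k. b (Suc i) * N ^ i)" by simp
  hence "a (Suc j) = b (Suc j)" if "j < k" for j
    using Suc.IH[of "\<lambda>i. a (Suc i)" "\<lambda>i. b (Suc i)" j] Suc.prems(1,2) that by auto
  with 0 Suc.prems(4) show ?case by (cases i) auto
qed simp

text \<open>
  Kronecker substitution: replacing \<open>x\<^sub>i\<close> by \<open>t ^ (N ^ i)\<close>, where \<open>N\<close> exceeds all exponents, keeps
  distinct monomials distinct.
\<close>

lemma nonzero_mpoly_has_nonzero_value: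
  fixes p :: "'a::field_char_0 mpoly"
  assumes "p \<noteq> 0" "p \<in> polys_in n"
  obtains v :: "nat \<Rightarrow> nat" where "eval_mpoly p (\<lambda>i. of_nat (v i)) \<noteq> 0"
proof -
  let ?K = "keys p"
  define N where "N = Suc (\<Sum>m\<in>?K. monom_deg m)"
  have small: "lookup m i < N" if "m \<in> ?K" for m i
  proof -
    have "lookup m i \<le> monom_deg m"
      unfolding monom_deg_def
      by (cases "i \<in> keys m") (auto intro: member_le_sum simp: in_keys_iff)
    also have "\<dots> \<le> (\<Sum>m\<in>?K. monom_deg m)"
      using that by (intro member_le_sum) auto
    finally show ?thesis by (simp add: N_def)
  qed
  define w where "w m = (\<Sum>i<Suc n. lookup m i * N ^ i)" for m :: "nat \<Rightarrow>\<^sub>0 nat"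
  have w_inj: "inj_on w ?K"
  proof (rule inj_onI)
    fix m m' assume m: "m \<in> ?K" "m' \<in> ?K" and eq: "w m = w m'"
    show "m = m'"
    proof (rule poly_mapping_eqI)
      fix i
      show "lookup m i = lookup m' i"
      proof (cases "i < Suc n")
        case True
        thus ?thesis
          using sum_digits_inj[of "Suc n" "lookup m" N "lookup m'" i]
            m small eq by (simp add: w_def)
      next
        case False
        moreover have "keys m \<subseteq> {..n}" "keys m' \<subseteq> {..n}"
          using m assms(2) by (simp_all add: polys_in_def)
        ultimately have "i \<notin> keys m" "i \<notin> keys m'" by force+
        thus ?thesis by (simp add: in_keys_iff)
      qed
    qed
  qed
  define u where "u = (\<Sum>m\<in>?K. monom (lookup p m) (w m))"
  obtain m where m: "m \<in> ?K" using assms(1) by (meson all_not_in_conv keys_eq_empty)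
  have "coeff u (w m) = (\<Sum>m'\<in>?K. if m' = m then lookup p m' else 0)"
    unfolding u_def coeff_sum using m w_inj
    by (intro sum.cong) (auto dest: inj_onD)
  also have "\<dots> = lookup p m" using m by (simp add: sum.delta)
  finally have "coeff u (w m) \<noteq> 0" using m by (simp add: in_keys_iff)
  hence "finite {t. poly u t = 0}" by (intro poly_roots_finite) auto
  moreover have "infinite (range (of_nat :: nat \<Rightarrow> 'a))"
    by (simp add: finite_image_iff inj_on_def)
  ultimately have "\<not> range (of_nat :: nat \<Rightarrow> 'a) \<subseteq> {t. poly u t = 0}"
    by (meson finite_subset)
  then obtain t :: nat where t: "poly u (of_nat t) \<noteq> 0" by blast
  have "poly u (of_nat t) = eval_mpoly p (\<lambda>i. of_nat (t ^ (N ^ i)))"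
    unfolding u_def poly_sum eval_mpoly_eq
  proof (rule sum.cong)
    fix m assume "m \<in> ?K"
    hence "keys m \<subseteq> {..<Suc n}"
      using assms(2) by (simp add: polys_in_def lessThan_Suc_atMost)
    hence "monom_val m (\<lambda>i. of_nat (t ^ (N ^ i)) :: 'a) = of_nat t ^ w m"
      by (subst monom_val_superset[of "{..<Suc n}"])
         (simp_all add: w_def power_sum mult.commute del: sum.lessThan_Suc prod.lessThan_Suc flip: power_mult)
    thus "poly (monom (lookup p m) (w m)) (of_nat t) = lookup p m *
       monom_val m (\<lambda>i. of_nat (t ^ (N ^ i)))" by (simp add: poly_monom)
  qed simp
  with t show ?thesis by (intro that[of "\<lambda>i. t ^ (N ^ i)"]) simp
qed


section \<open>Embeddings of a number field\<close>

subsection \<open>Algebraic elements\<close>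

interpretation rat_vs: vector_space "rat_scale :: rat \<Rightarrow> 'a \<Rightarrow> 'a::field_char_0"
  by (rule vector_space_rat_scale)

lemma algebraic_iff_rat_poly:
  "algebraic (x :: 'a::field_char_0) \<longleftrightarrow> (\<exists>p :: rat poly. p \<noteq> 0 \<and> poly (map_poly of_rat p) x = 0)"
proof
  assume "algebraic x"
  then obtain p where p: "\<And>i. coeff p i \<in> \<rat>" "p \<noteq> 0" "poly p x = 0"
    by (auto simp: algebraic_altdef)
  define r :: "rat poly" where "r = map_poly (inv of_rat) p"
  have inv: "inv of_rat 0 = (0 :: rat)"
    by (rule inv_f_eq) (auto simp: inj_def)
  have "map_poly of_rat r = p"
    using p(1) by (intro poly_eqI) (simp add: r_def coeff_map_poly inv Rats_def f_inv_into_f)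
  with p show "\<exists>p :: rat poly. p \<noteq> 0 \<and> poly (map_poly of_rat p) x = 0"
    by (intro exI[of _ r]) auto
next
  assume "\<exists>p :: rat poly. p \<noteq> 0 \<and> poly (map_poly of_rat p) x = 0"
  then obtain p :: "rat poly" where p: "p \<noteq> 0" "poly (map_poly of_rat p) x = 0" by blast
  show "algebraic x"
    using p by (intro algebraicI'[of "map_poly of_rat p"]) (auto simp: coeff_map_poly map_poly_eq_0_iff)
qed

lemma powers_dependent_imp_rat_poly:
  fixes z :: "'a::field_char_0"
  assumes "\<not> (inj_on (\<lambda>i. z ^ i) {..<k} \<and> \<not> rat_vs.dependent ((\<lambda>i. z ^ i) ` {..<k}))"
  obtains p :: "rat poly" where "p \<noteq> 0" "degree p < k" "poly (map_poly of_rat p) z = 0"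
proof (cases "inj_on (\<lambda>i. z ^ i) {..<k}")
  case False
  then obtain i j where ij: "i < k" "j < k" "i \<noteq> j" "z ^ i = z ^ j" by (auto simp: inj_on_def)
  define p :: "rat poly" where "p = monom 1 i - monom 1 j"
  have "coeff p i = 1" using ij by (simp add: p_def)
  hence "p \<noteq> 0" by auto
  moreover have "degree p < k" unfolding p_def
    using ij by (intro degree_diff_less) (auto intro: le_less_trans[OF degree_monom_le])
  moreover have "map_poly of_rat p = (monom 1 i - monom 1 j :: 'a poly)"
    by (intro poly_eqI) (auto simp: coeff_map_poly p_def of_rat_diff)
  hence "poly (map_poly of_rat p) z = 0" using ij by (simp add: poly_monom)
  ultimately show ?thesis by (rule that)
next
  case True
  with assms obtain u where u: "\<exists>v\<in>(\<lambda>i. z ^ i) ` {..<k}. u v \<noteq> 0"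
      "(\<Sum>v\<in>(\<lambda>i. z ^ i) ` {..<k}. rat_scale (u v) v) = 0"
    using rat_vs.dependent_finite[of "(\<lambda>i. z ^ i) ` {..<k}"] by auto
  define p :: "rat poly" where "p = (\<Sum>i<k. monom (u (z ^ i)) i)"
  have coeff: "coeff p i = (if i < k then u (z ^ i) else 0)" for i
    by (simp add: p_def coeff_sum)
  have "k > 0" using u(1) by (cases k) auto
  hence "degree p < k"
    by (intro degree_lessI) (auto simp: coeff)
  moreover have "p \<noteq> 0" using u(1) coeff by (metis coeff_0 image_iff lessThan_iff)
  moreover have "poly (map_poly of_rat p) z = 0"
  proof -
    have "map_poly of_rat p = (\<Sum>i<k. monom (of_rat (u (z ^ i)) :: 'a) i)"
      by (intro poly_eqI) (simp add: coeff_map_poly coeff coeff_sum)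
    hence "poly (map_poly of_rat p) z = (\<Sum>i<k. rat_scale (u (z ^ i)) (z ^ i))"
      by (simp add: poly_sum poly_monom rat_scale_def)
    also have "\<dots> = 0" using u(2) by (simp add: sum.reindex[OF True])
    finally show ?thesis .
  qed
  ultimately show ?thesis using that by blast
qed

text \<open>
  The powers of \<open>z\<close> stay in the space, and there are more of them than its dimension. The spaces in
  question are a number field, and the ring generated by two algebraic numbers.
\<close>

lemma rat_poly_of_finite_stable_span:
  fixes z :: "'a::field_char_0"
  assumes "finite S" "1 \<in> rat_vs.span S" "\<And>x. x \<in> rat_vs.span S \<Longrightarrow> z * x \<in> rat_vs.span S"
  obtains p :: "rat poly" where "p \<noteq> 0" "degree p \<le> card S" "poly (map_poly of_rat p) z = 0"
proof -
  have "z ^ i \<in> rat_vs.span S" for i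
    by (induction i) (auto intro: assms)
  hence sub: "(\<lambda>i. z ^ i) ` {..<Suc (card S)} \<subseteq> rat_vs.span S" by auto
  have "\<not> (inj_on (\<lambda>i. z ^ i) {..<Suc (card S)} \<and> \<not> rat_vs.dependent ((\<lambda>i. z ^ i) ` {..<Suc (card S)}))"
  proof
    assume *: "inj_on (\<lambda>i. z ^ i) {..<Suc (card S)} \<and> \<not> rat_vs.dependent ((\<lambda>i. z ^ i) ` {..<Suc (card S)})"
    hence "card ((\<lambda>i. z ^ i) ` {..<Suc (card S)}) \<le> card S"
      using rat_vs.independent_span_bound[OF assms(1) _ sub] by blast
    with * show False by (simp add: card_image)
  qed
  thus ?thesis
    by (rule powers_dependent_imp_rat_poly) (use that in auto)
qed

lemma rat_span_mult:
  assumes "w \<in> rat_vs.span S" "\<And>s. s \<in> S \<Longrightarrow> z * s \<in> rat_vs.span T"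
  shows "z * w \<in> rat_vs.span T"
  using assms(1)
proof (induction rule: rat_vs.span_induct)
  case base
  let ?V = "{a. z * a \<in> rat_vs.span T}"
  show ?case
  proof (rule rat_vs.subspaceI)
    show "0 \<in> ?V" by (simp add: rat_vs.span_zero)
  next
    fix x y assume "x \<in> ?V" "y \<in> ?V"
    thus "x + y \<in> ?V" by (simp add: distrib_left rat_vs.span_add)
  next
    fix c x assume "x \<in> ?V"
    hence "rat_scale c (z * x) \<in> rat_vs.span T" by (simp add: rat_vs.span_scale)
    thus "rat_scale c x \<in> ?V"
      by (simp add: rat_scale_def mult.left_commute)
  qed
next
  case (step x)
  thus ?case using assms(2) by auto
qed

lemma rat_span_scale: "w \<in> rat_vs.span S \<Longrightarrow> of_rat q * w \<in> rat_vs.span S"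
  using rat_vs.span_scale[of w S q] by (simp add: rat_scale_def)

lemma algebraic_top_power:
  assumes "algebraic (x :: 'a::field_char_0)"
  obtains m and c :: "nat \<Rightarrow> rat" where "m > 0" "x ^ m = (\<Sum>i<m. of_rat (c i) * x ^ i)"
proof -
  from assms obtain p :: "rat poly" where p: "p \<noteq> 0" "poly (map_poly of_rat p) x = 0"
    by (auto simp: algebraic_iff_rat_poly)
  define m where "m = degree p"
  have deg: "degree (map_poly of_rat p :: 'a poly) = m" by (simp add: m_def degree_map_poly)
  have "m > 0"
  proof (rule ccontr)
    assume "\<not> m > 0"
    then obtain a where "p = [:a:]" by (auto simp: m_def elim: degree_eq_zeroE)
    with p show False by (simp add: map_poly_pCons)
  qed
  have l: "coeff p m \<noteq> 0" using p by (simp add: m_def)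
  have "0 = (\<Sum>i\<le>m. of_rat (coeff p i) * x ^ i)"
    using p(2) by (simp add: poly_altdef deg coeff_map_poly)
  also have "\<dots> = (\<Sum>i<m. of_rat (coeff p i) * x ^ i) + of_rat (coeff p m) * x ^ m"
    by (simp add: lessThan_Suc_atMost[symmetric])
  finally have "x ^ m = - (\<Sum>i<m. of_rat (coeff p i) * x ^ i) / of_rat (coeff p m)"
    using l by (simp add: field_simps eq_neg_iff_add_eq_0)
  also have "\<dots> = (\<Sum>i<m. of_rat (- coeff p i / coeff p m) * x ^ i)"
    by (simp add: sum_divide_distrib of_rat_divide of_rat_minus flip: sum_negf)
  finally show ?thesis using \<open>m > 0\<close> by (rule that[rotated])
qed

text \<open>
  The products \<open>x ^ i * y ^ j\<close> with exponents below the two degrees span a space that is stable under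
  multiplication by \<open>x\<close> and by \<open>y\<close>.
\<close>

lemma
  fixes x y :: "'a::field_char_0"
  assumes x: "algebraic x" and y: "algebraic y"
  shows algebraic_add: "algebraic (x + y)" and algebraic_mult: "algebraic (x * y)"
proof -
  obtain m and c :: "nat \<Rightarrow> rat" where m: "m > 0" "x ^ m = (\<Sum>i<m. of_rat (c i) * x ^ i)"
    using x by (rule algebraic_top_power)
  obtain n and c' :: "nat \<Rightarrow> rat" where n: "n > 0" "y ^ n = (\<Sum>i<n. of_rat (c' i) * y ^ i)"
    using y by (rule algebraic_top_power)
  define S where "S = (\<lambda>(i,j). x ^ i * y ^ j) ` ({..<m} \<times> {..<n})"
  have S: "x ^ i * y ^ j \<in> rat_vs.span S" if "i < m" "j < n" for i j
    using that by (intro rat_vs.span_base) (force simp: S_def)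
  have "finite S" by (simp add: S_def)
  have one: "1 \<in> rat_vs.span S" using S[of 0 0] m n by simp
  have X: "x * w \<in> rat_vs.span S" if "w \<in> rat_vs.span S" for w
  proof (rule rat_span_mult[OF that])
    fix s assume "s \<in> S"
    then obtain i j where s: "s = x ^ i * y ^ j" "i < m" "j < n" by (auto simp: S_def)
    show "x * s \<in> rat_vs.span S"
    proof (cases "Suc i < m")
      case True
      thus ?thesis using s S[of "Suc i" j] by (simp add: mult_ac)
    next
      case False
      hence "x * s = x ^ m * y ^ j" using s by (metis Suc_lessI mult.assoc power_Suc)
      also have "\<dots> = (\<Sum>k<m. of_rat (c k) * (x ^ k * y ^ j))"
        by (simp add: m(2) sum_distrib_right sum_distrib_left mult_ac)
      finally show ?thesis using s S by (auto intro!: rat_vs.span_sum rat_span_scale)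
    qed
  qed
  have Y: "y * w \<in> rat_vs.span S" if "w \<in> rat_vs.span S" for w
  proof (rule rat_span_mult[OF that])
    fix s assume "s \<in> S"
    then obtain i j where s: "s = x ^ i * y ^ j" "i < m" "j < n" by (auto simp: S_def)
    show "y * s \<in> rat_vs.span S"
    proof (cases "Suc j < n")
      case True
      thus ?thesis using s S[of i "Suc j"] by (simp add: mult_ac)
    next
      case False
      hence "y * s = x ^ i * y ^ n" using s by (metis Suc_lessI mult.left_commute power_Suc)
      also have "\<dots> = (\<Sum>k<n. of_rat (c' k) * (x ^ i * y ^ k))"
        by (simp add: n(2) sum_distrib_right sum_distrib_left mult_ac)
      finally show ?thesis using s S by (auto intro!: rat_vs.span_sum rat_span_scale)
    qed
  qed
  show "algebraic (x + y)"
    by (rule rat_poly_of_finite_stable_span[of S "x + y"])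
       (use \<open>finite S\<close> one X Y in \<open>auto simp: algebraic_iff_rat_poly distrib_right intro: rat_vs.span_add\<close>)
  show "algebraic (x * y)"
    by (rule rat_poly_of_finite_stable_span[of S "x * y"])
       (use \<open>finite S\<close> one X Y in \<open>auto simp: algebraic_iff_rat_poly mult.assoc\<close>)
qed

lemma subring_of_Qbar: "subring_of Qbar"
  by (auto simp: subring_of_def Qbar_def intro: algebraic_add algebraic_mult)

lemma number_field_rat_poly:
  fixes x :: "'k::field_char_0"
  assumes "finite B" "rat_vs.span B = (UNIV :: 'k set)"
  obtains p :: "rat poly" where "p \<noteq> 0" "degree p \<le> card B" "poly (map_poly of_rat p) x = 0"
  using rat_poly_of_finite_stable_span[of B x] assms by auto

lemma number_field_algebraic:
  assumes "number_field TYPE('k::field_char_0)"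
  shows "algebraic (x :: 'k)"
  using assms number_field_rat_poly[of _ x] unfolding number_field_def algebraic_iff_rat_poly by metis


subsection \<open>Extending an embedding by one element\<close>

definition polys_over :: "'a::comm_ring_1 set \<Rightarrow> 'a poly set" where
  "polys_over F = {p. \<forall>i. coeff p i \<in> F}"

definition adjoin :: "'a::comm_ring_1 set \<Rightarrow> 'a \<Rightarrow> 'a set" where
  "adjoin F b = (\<lambda>p. poly p b) ` polys_over F"

text \<open>
  In a field all of whose elements are algebraic over the rationals, the subrings that contain the
  rationals are exactly the subfields.
\<close>

definition rat_subalgebra :: "'a::field_char_0 set \<Rightarrow> bool" where
  "rat_subalgebra F \<longleftrightarrow> subring_of F \<and> (\<forall>q. of_rat q \<in> F)"

lemma poly_in_subring:
  assumes "subring_of F" "p \<in> polys_over F" "b \<in> F"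
  shows "poly p b \<in> F"
  unfolding poly_altdef using assms
  by (intro subring_of_sum subring_of_mult subring_of_power) (auto simp: polys_over_def)

text \<open>
  If \<open>c + x * q(x) = 0\<close> with \<open>c\<close> a nonzero rational number, then the inverse is \<open>- q(x) / c\<close>.
\<close>

lemma rat_subalgebra_inverse:
  assumes "rat_subalgebra F" "x \<in> F" "algebraic x"
  shows "inverse x \<in> F"
proof (cases "x = 0")
  case False
  from algebraicE'_nonzero[OF assms(3) False] obtain p0 :: "int poly"
    where p0: "coeff p0 0 \<noteq> 0" "poly (map_poly of_int p0) x = 0" by metis
  define p where "p = (map_poly of_int p0 :: 'a poly)"
  have p: "\<And>i. coeff p i \<in> \<int>" "coeff p 0 \<noteq> 0" "poly p x = 0"
    using p0 by (auto simp: p_def coeff_map_poly)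
  obtain c q where cq: "p = pCons c q" by (cases p)
  have rat: "a \<in> F" if "a \<in> \<rat>" for a
    using that assms(1) by (auto simp: rat_subalgebra_def Rats_def)
  have "coeff q i \<in> F" for i
    using p(1)[of "Suc i"] Ints_subset_Rats by (auto simp: cq intro: rat)
  hence q: "poly q x \<in> F"
    using assms by (intro poly_in_subring) (auto simp: rat_subalgebra_def polys_over_def)
  have c: "c \<noteq> 0" "c \<in> \<rat>" using p(1)[of 0] p(2) Ints_subset_Rats by (auto simp: cq)
  hence "- inverse c \<in> F" by (intro rat) auto
  moreover have "c + x * poly q x = 0" using p(3) by (simp add: cq)
  hence "inverse x = - inverse c * poly q x"
    using False c by (simp add: field_simps eq_neg_iff_add_eq_0)
  ultimately show ?thesis
    using q assms(1) by (simp only: rat_subalgebra_def) (blast intro: subring_of_mult)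
qed (use assms in simp)

lemma
  fixes F :: "'a::idom set"
  assumes "subring_of F"
  shows polys_over_add: "p \<in> polys_over F \<Longrightarrow> q \<in> polys_over F \<Longrightarrow> p + q \<in> polys_over F"
    and polys_over_diff: "p \<in> polys_over F \<Longrightarrow> q \<in> polys_over F \<Longrightarrow> p - q \<in> polys_over F"
    and polys_over_uminus: "p \<in> polys_over F \<Longrightarrow> - p \<in> polys_over F"
    and polys_over_mult: "p \<in> polys_over F \<Longrightarrow> q \<in> polys_over F \<Longrightarrow> p * q \<in> polys_over F"
    and polys_over_monom: "c \<in> F \<Longrightarrow> monom c k \<in> polys_over F"
    and polys_over_const: "c \<in> F \<Longrightarrow> [:c:] \<in> polys_over F"
    and polys_over_smult: "c \<in> F \<Longrightarrow> p \<in> polys_over F \<Longrightarrow> smult c p \<in> polys_over F"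
    and polys_over_0: "0 \<in> polys_over F"
    and polys_over_pderiv: "p \<in> polys_over F \<Longrightarrow> pderiv p \<in> polys_over F"
  using assms
  by (auto simp: polys_over_def coeff_mult coeff_pderiv coeff_pCons subring_of_0 split: nat.splits
      intro!: subring_of_add subring_of_diff subring_of_uminus subring_of_mult subring_of_sum
              subring_of_of_nat[of F "Suc _", simplified])

lemma subring_of_adjoin:
  fixes F :: "'a::idom set"
  assumes "subring_of F"
  shows "subring_of (adjoin F b)" "F \<subseteq> adjoin F b" "b \<in> adjoin F b"
proof -
  show "subring_of (adjoin F b)"
    unfolding subring_of_def adjoin_def
  proof (intro conjI ballI)
    show "1 \<in> (\<lambda>p. poly p b) ` polys_over F"
      by (rule image_eqI[of _ _ "[:1:]", OF _ polys_over_const[OF assms subring_of_1[OF assms]]]) simp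
  next
    fix x assume "x \<in> (\<lambda>p. poly p b) ` polys_over F"
    thus "- x \<in> (\<lambda>p. poly p b) ` polys_over F"
      by (auto simp flip: poly_minus intro!: imageI polys_over_uminus assms)
  next
    fix x y assume "x \<in> (\<lambda>p. poly p b) ` polys_over F" "y \<in> (\<lambda>p. poly p b) ` polys_over F"
    thus "x + y \<in> (\<lambda>p. poly p b) ` polys_over F"
         "x * y \<in> (\<lambda>p. poly p b) ` polys_over F"
      by (auto simp flip: poly_add poly_mult intro!: imageI polys_over_add polys_over_mult assms)
  qed
  show "F \<subseteq> adjoin F b"
  proof
    fix x assume "x \<in> F"
    thus "x \<in> adjoin F b" unfolding adjoin_def
      by (intro image_eqI[of _ _ "[:x:]"]) (auto intro: polys_over_const assms)
  qed
  show "b \<in> adjoin F b" unfolding adjoin_def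
    by (intro image_eqI[of _ _ "monom 1 1"])
       (auto simp: poly_monom intro!: polys_over_monom assms subring_of_1)
qed

context
  fixes F :: "'k::field_char_0 set" and \<beta> :: 'k and q :: "'k poly" and m :: nat
  assumes F: "rat_subalgebra F" and alg: "\<And>x::'k. algebraic x"
    and q: "q \<in> polys_over F" "coeff q m = 1" "degree q = m" "poly q \<beta> = 0" "m > 0"
    and minimal: "\<And>p. p \<in> polys_over F \<Longrightarrow> degree p < m \<Longrightarrow> poly p \<beta> = 0 \<Longrightarrow> p = 0"
begin

lemma ground_subring: "subring_of F"
  using F by (simp add: rat_subalgebra_def)

lemma minpoly_division:
  assumes "p \<in> polys_over F"
  shows "\<exists>s\<in>polys_over F. \<exists>r\<in>polys_over F. p = q * s + r \<and> degree r < m"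
  using assms
proof (induction "degree p" arbitrary: p rule: less_induct)
  case less
  show ?case
  proof (cases "degree p < m")
    case True
    thus ?thesis using less.prems polys_over_0[OF ground_subring] by (intro bexI[of _ 0] bexI[of _ p]) auto
  next
    case False
    define s where "s = monom (lead_coeff p) (degree p - m)"
    have s: "s \<in> polys_over F"
      using less.prems unfolding s_def by (intro polys_over_monom ground_subring) (auto simp: polys_over_def)
    have p': "p - q * s \<in> polys_over F"
      by (intro polys_over_diff polys_over_mult ground_subring less.prems q s)
    have "degree (q * s) \<le> m + (degree p - m)"
      using degree_mult_le[of q s] degree_monom_le[of "lead_coeff p" "degree p - m"] q
      by (simp add: s_def)
    hence "degree (p - q * s) \<le> degree p" using False by (intro degree_diff_le) auto
    moreover have "coeff (p - q * s) (degree p) = 0"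
    proof -
      have "coeff (s * q) (degree p) = lead_coeff p * coeff q m"
        using False unfolding s_def by (subst coeff_monom_mult) auto
      thus ?thesis using q by (simp add: mult.commute)
    qed
    ultimately have "degree (p - q * s) < degree p"
      using False q(5) eq_zero_or_degree_less[of "p - q * s" "degree p"] by auto
    from less.hyps[OF this p'] obtain s' r where
      "s' \<in> polys_over F" "r \<in> polys_over F" "p - q * s = q * s' + r" "degree r < m" by blast
    thus ?thesis using s
      by (intro bexI[of _ "s + s'"] bexI[of _ r]) (auto simp: algebra_simps intro: polys_over_add ground_subring)
  qed
qed

lemma adjoin_span:
  assumes "F \<subseteq> rat_vs.span X"
  shows "adjoin F \<beta> \<subseteq> rat_vs.span ((\<lambda>(x, j). x * \<beta> ^ j) ` (X \<times> {..<m}))"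
proof
  fix y assume "y \<in> adjoin F \<beta>"
  then obtain p where p: "p \<in> polys_over F" "y = poly p \<beta>" by (auto simp: adjoin_def)
  from minpoly_division[OF p(1)] obtain s r
    where sr: "r \<in> polys_over F" "p = q * s + r" "degree r < m" by blast
  have "y = poly r \<beta>" using p sr q by simp
  also have "\<dots> = (\<Sum>j\<le>degree r. \<beta> ^ j * coeff r j)" by (simp add: poly_altdef mult.commute)
  also have "\<dots> \<in> rat_vs.span ((\<lambda>(x, j). x * \<beta> ^ j) ` (X \<times> {..<m}))"
  proof (intro rat_vs.span_sum)
    fix j assume j: "j \<in> {..degree r}"
    have "coeff r j \<in> rat_vs.span X" using sr assms by (auto simp: polys_over_def)
    thus "\<beta> ^ j * coeff r j \<in> rat_vs.span ((\<lambda>(x, j). x * \<beta> ^ j) ` (X \<times> {..<m}))"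
      by (rule rat_span_mult) (use j sr in \<open>force intro!: rat_vs.span_base simp: mult.commute\<close>)
  qed
  finally show "y \<in> rat_vs.span ((\<lambda>(x, j). x * \<beta> ^ j) ` (X \<times> {..<m}))" .
qed

context
  fixes \<sigma> :: "'k \<Rightarrow> complex"
  assumes \<sigma>: "ring_hom_on F \<sigma>"
begin

lemma map_poly_hom:
  assumes "p \<in> polys_over F" "s \<in> polys_over F"
  shows "map_poly \<sigma> (p + s) = map_poly \<sigma> p + map_poly \<sigma> s"
    and "map_poly \<sigma> (p * s) = map_poly \<sigma> p * map_poly \<sigma> s"
    and "map_poly \<sigma> (pderiv p) = pderiv (map_poly \<sigma> p)"
proof -
  note [simp] = ring_hom_on_0[OF ground_subring \<sigma>]
  have coeffs: "coeff p i \<in> F" "coeff s i \<in> F" for i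
    using assms by (auto simp: polys_over_def)
  show "map_poly \<sigma> (p + s) = map_poly \<sigma> p + map_poly \<sigma> s"
    using coeffs by (intro poly_eqI) (simp add: coeff_map_poly ring_hom_on_add[OF ground_subring \<sigma>])
  show "map_poly \<sigma> (p * s) = map_poly \<sigma> p * map_poly \<sigma> s"
    using coeffs ground_subring
    by (intro poly_eqI) (simp add: coeff_map_poly coeff_mult ring_hom_on_sum[OF ground_subring \<sigma>]
        ring_hom_on_mult[OF ground_subring \<sigma>] subring_of_mult)
  have "\<sigma> (of_nat (Suc i) * coeff p (Suc i)) = of_nat (Suc i) * \<sigma> (coeff p (Suc i))" for i
    using coeffs by (subst ring_hom_on_mult[OF ground_subring \<sigma>])
      (simp_all only: subring_of_of_nat[OF ground_subring] ring_hom_on_of_nat[OF ground_subring \<sigma>])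
  thus "map_poly \<sigma> (pderiv p) = pderiv (map_poly \<sigma> p)"
    by (intro poly_eqI) (simp add: coeff_map_poly coeff_pderiv del: of_nat_Suc)
qed

text \<open>
  Two polynomials with the same value at \<open>\<beta>\<close> differ by a multiple of the minimal polynomial, the
  conjugate of which has the root \<open>r\<close>. So \<open>\<beta>\<close> may be sent to \<open>r\<close>.
\<close>

lemma root_extension_well_defined:
  assumes "p \<in> polys_over F" "s \<in> polys_over F" "poly p \<beta> = poly s \<beta>" "poly (map_poly \<sigma> q) r = 0"
  shows "poly (map_poly \<sigma> p) r = poly (map_poly \<sigma> s) r"
proof -
  have ps: "p - s \<in> polys_over F" using assms ground_subring by (intro polys_over_diff)
  from minpoly_division[OF this] obtain a b
    where ab: "a \<in> polys_over F" "b \<in> polys_over F" "p - s = q * a + b" "degree b < m" by blast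
  have "poly b \<beta> = poly (p - s - q * a) \<beta>" using ab(3) by (simp add: algebra_simps)
  also have "\<dots> = 0" using assms q by simp
  finally have "b = 0" using minimal ab by blast
  hence "p = q * a + s" using ab(3) by (simp add: algebra_simps)
  thus ?thesis using assms ab q ground_subring
    by (simp add: map_poly_hom polys_over_mult)
qed

definition root_extension :: "complex \<Rightarrow> 'k \<Rightarrow> complex" where
  "root_extension r y = (if y \<in> adjoin F \<beta>
     then poly (map_poly \<sigma> (SOME p. p \<in> polys_over F \<and> poly p \<beta> = y)) r else 0)"

lemma root_extension_outside: "y \<notin> adjoin F \<beta> \<Longrightarrow> root_extension r y = 0"
  by (simp add: root_extension_def)

lemma root_extension_poly:
  assumes "p \<in> polys_over F" "poly (map_poly \<sigma> q) r = 0"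
  shows "root_extension r (poly p \<beta>) = poly (map_poly \<sigma> p) r"
proof -
  let ?s = "SOME s. s \<in> polys_over F \<and> poly s \<beta> = poly p \<beta>"
  have "?s \<in> polys_over F \<and> poly ?s \<beta> = poly p \<beta>"
    by (rule someI[of _ p]) (use assms in auto)
  moreover have "poly p \<beta> \<in> adjoin F \<beta>" using assms by (auto simp: adjoin_def)
  ultimately show ?thesis
    using root_extension_well_defined[of ?s p r] assms by (simp add: root_extension_def)
qed

lemma root_extension_hom:
  assumes "poly (map_poly \<sigma> q) r = 0"
  shows "ring_hom_on (adjoin F \<beta>) (root_extension r)"
  unfolding ring_hom_on_def
proof (intro conjI ballI)
  have "root_extension r (poly [:1:] \<beta>) = poly (map_poly \<sigma> [:1:]) r"
    by (intro root_extension_poly assms polys_over_const ground_subring subring_of_1)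
  thus "root_extension r 1 = 1"
    by (simp add: map_poly_pCons ring_hom_on_1[OF ground_subring \<sigma>] ring_hom_on_0[OF ground_subring \<sigma>])
next
  fix x y assume "x \<in> adjoin F \<beta>" "y \<in> adjoin F \<beta>"
  then obtain p s where ps: "p \<in> polys_over F" "s \<in> polys_over F" "x = poly p \<beta>" "y = poly s \<beta>"
    by (auto simp: adjoin_def)
  show "root_extension r (x + y) = root_extension r x + root_extension r y"
    using ps assms ground_subring root_extension_poly[of "p + s" r]
    by (simp add: root_extension_poly polys_over_add map_poly_hom)
  show "root_extension r (x * y) = root_extension r x * root_extension r y"
    using ps assms ground_subring root_extension_poly[of "p * s" r]
    by (simp add: root_extension_poly polys_over_mult map_poly_hom)
qed

lemma card_conjugate_roots: "card {r. poly (map_poly \<sigma> q) r = 0} = m"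
proof -
  let ?q = "map_poly \<sigma> q"
  have "coeff ?q m = 1"
    using q by (simp add: coeff_map_poly ring_hom_on_1[OF ground_subring \<sigma>] ring_hom_on_0[OF ground_subring \<sigma>])
  hence "m \<le> degree ?q" by (intro le_degree) simp
  moreover have "degree ?q \<le> m" using map_poly_degree_leq[of \<sigma> q] q by simp
  ultimately have deg: "degree ?q = m" by simp
  have lead: "lead_coeff ?q = 1"
    using q deg by (simp add: coeff_map_poly ring_hom_on_1[OF ground_subring \<sigma>] ring_hom_on_0[OF ground_subring \<sigma>])
  \<comment> \<open>A double root would give an embedding that kills the derivative of the minimal polynomial
     at \<open>\<beta>\<close>, which is a nonzero element of the field.\<close>
  have "rsquarefree ?q"
    unfolding rsquarefree_roots
  proof (intro allI notI, elim conjE)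
    fix r assume r: "poly ?q r = 0" "poly (pderiv ?q) r = 0"
    define y where "y = poly (pderiv q) \<beta>"
    have "pderiv q \<noteq> 0" "degree (pderiv q) < m"
      using q by (auto simp: pderiv_eq_0_iff degree_pderiv)
    hence "y \<noteq> 0"
      using minimal[of "pderiv q"] polys_over_pderiv[OF ground_subring q(1)] by (auto simp: y_def)
    have y: "y \<in> adjoin F \<beta>"
      unfolding y_def adjoin_def by (intro imageI polys_over_pderiv ground_subring q)
    have "rat_subalgebra (adjoin F \<beta>)"
      using F subring_of_adjoin[OF ground_subring, of \<beta>] by (auto simp: rat_subalgebra_def)
    from rat_subalgebra_inverse[OF this y alg] have inv: "inverse y \<in> adjoin F \<beta>" .
    note hom = root_extension_hom[OF r(1)]
    note sub = subring_of_adjoin(1)[OF ground_subring, of \<beta>]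
    have "root_extension r y = poly (map_poly \<sigma> (pderiv q)) r"
      unfolding y_def by (intro root_extension_poly polys_over_pderiv ground_subring q r)
    also have "\<dots> = 0" using r q by (simp add: map_poly_hom)
    finally have "root_extension r (y * inverse y) = 0"
      using ring_hom_on_mult[OF sub hom y inv] by simp
    thus False using \<open>y \<noteq> 0\<close> ring_hom_on_1[OF sub hom] by simp
  qed
  from complex_poly_decompose_rsquarefree[OF this]
  have "?q = (\<Prod>z | poly ?q z = 0. [:-z, 1:])" using lead by simp
  hence "degree ?q = degree (\<Prod>z | poly ?q z = 0. [:-z, 1:])" by simp
  also have "\<dots> = card {z. poly ?q z = 0}"
    by (subst degree_prod_eq_sum_degree) auto
  finally show ?thesis using deg by simp
qed

end

end


lemma exists_minimal_polynomial:
  assumes F: "rat_subalgebra F" and alg: "\<And>x::'k::field_char_0. algebraic x"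
  obtains q m where "q \<in> polys_over F" "coeff q m = 1" "degree q = m" "poly q (\<beta> :: 'k) = 0" "m > 0"
    "\<And>p. p \<in> polys_over F \<Longrightarrow> degree p < m \<Longrightarrow> poly p \<beta> = 0 \<Longrightarrow> p = 0"
proof -
  have subring: "subring_of F" using F by (simp add: rat_subalgebra_def)
  define P where "P m \<longleftrightarrow> (\<exists>q\<in>polys_over F. q \<noteq> 0 \<and> degree q = m \<and> poly q \<beta> = 0)" for m
  from alg[of \<beta>] obtain p :: "rat poly" where p: "p \<noteq> 0" "poly (map_poly of_rat p) \<beta> = 0"
    by (auto simp: algebraic_iff_rat_poly)
  have "P (degree (map_poly of_rat p :: 'k poly))"
    unfolding P_def using p F
    by (intro bexI[of _ "map_poly of_rat p"])
       (auto simp: map_poly_eq_0_iff polys_over_def coeff_map_poly rat_subalgebra_def)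
  hence "P (LEAST m. P m)" by (rule LeastI)
  then obtain q where q: "q \<in> polys_over F" "q \<noteq> 0" "degree q = (LEAST m. P m)" "poly q \<beta> = 0"
    by (auto simp: P_def)
  have min: "p = 0" if "p \<in> polys_over F" "degree p < degree q" "poly p \<beta> = 0" for p
    using that q(3) not_less_Least[of "degree p" P] by (auto simp: P_def)
  have pos: "degree q > 0"
  proof (rule ccontr)
    assume "\<not> degree q > 0"
    then obtain c where "q = [:c:]" by (auto elim: degree_eq_zeroE)
    with q show False by simp
  qed
  define c where "c = inverse (lead_coeff q)"
  have c: "c \<in> F" "c \<noteq> 0"
    using q(1,2) F alg unfolding c_def by (auto simp: polys_over_def intro!: rat_subalgebra_inverse)
  show ?thesis
  proof (rule that[of "smult c q" "degree q"])
    show "smult c q \<in> polys_over F" using c q subring by (intro polys_over_smult)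
  qed (use q c pos min in \<open>auto simp: c_def\<close>)
qed

text \<open>
  Adjoining one element multiplies both the number of embeddings and the size of a spanning set by
  the degree of its minimal polynomial. Embeddings of the subfield \<open>F\<close> are extended by zero, so that
  they are counted as functions on the whole field.
\<close>

lemma enough_embeddings:
  assumes "finite B" and alg: "\<And>x::'k::field_char_0. algebraic x"
  shows "\<exists>F X S. rat_subalgebra F \<and> B \<subseteq> (F :: 'k set) \<and> finite X \<and> F \<subseteq> rat_vs.span X \<and>
    finite S \<and> S \<subseteq> {\<sigma> :: 'k \<Rightarrow> complex. ring_hom_on F \<sigma> \<and> (\<forall>x. x \<notin> F \<longrightarrow> \<sigma> x = 0)} \<and> card X \<le> card S"
  using assms(1)
proof (induction B rule: finite_induct)
  case empty
  define \<sigma> :: "'k \<Rightarrow> complex" where "\<sigma> x = (if x \<in> \<rat> then of_rat (inv of_rat x) else 0)" for x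
  have inv: "inv of_rat (of_rat r :: 'k) = r" for r
    by (rule inv_f_f) (auto simp: inj_def)
  have \<sigma>: "\<sigma> (of_rat r) = of_rat r" for r by (simp add: \<sigma>_def inv)
  have "rat_subalgebra (\<rat> :: 'k set)"
    by (auto simp: rat_subalgebra_def subring_of_def)
  moreover have "\<rat> \<subseteq> rat_vs.span {1 :: 'k}"
  proof
    fix x :: 'k assume "x \<in> \<rat>"
    then obtain r where "x = of_rat r" by (auto simp: Rats_def)
    thus "x \<in> rat_vs.span {1}" using rat_span_scale[of 1 "{1}" r] by (simp add: rat_vs.span_base)
  qed
  moreover have "ring_hom_on \<rat> \<sigma>"
    using \<sigma> \<sigma>[of 1] by (auto simp: ring_hom_on_def Rats_def of_rat_add of_rat_mult simp flip: of_rat_add of_rat_mult)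
  moreover have "\<forall>x. x \<notin> \<rat> \<longrightarrow> \<sigma> x = 0" by (simp add: \<sigma>_def)
  ultimately show ?case
    by (intro exI[of _ "\<rat>"] exI[of _ "{1}"] exI[of _ "{\<sigma>}"]) auto
next
  case (insert \<beta> B)
  then obtain F X S where F: "rat_subalgebra F" "B \<subseteq> F" and X: "finite X" "F \<subseteq> rat_vs.span X"
    and S: "finite S" "S \<subseteq> {\<sigma> :: 'k \<Rightarrow> complex. ring_hom_on F \<sigma> \<and> (\<forall>x. x \<notin> F \<longrightarrow> \<sigma> x = 0)}"
    and XS: "card X \<le> card S" by blast
  have subring: "subring_of F" using F by (simp add: rat_subalgebra_def)
  obtain q m where q: "q \<in> polys_over F" "coeff q m = 1" "degree q = m" "poly q \<beta> = 0" "m > 0"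
    and min: "\<And>p. p \<in> polys_over F \<Longrightarrow> degree p < m \<Longrightarrow> poly p \<beta> = 0 \<Longrightarrow> p = 0"
    using exists_minimal_polynomial[OF F(1) alg, of \<beta>] by blast
  note ctx = F(1) alg q min
  define F' where "F' = adjoin F \<beta>"
  define X' where "X' = (\<lambda>(x, j). x * \<beta> ^ j) ` (X \<times> {..<m})"
  define R where "R \<sigma> = {r. poly (map_poly \<sigma> q) r = 0}" for \<sigma> :: "'k \<Rightarrow> complex"
  define ext where "ext = (\<lambda>(\<sigma>, r). root_extension F \<beta> \<sigma> r)"
  have hom: "ring_hom_on F \<sigma>" "\<And>x. x \<notin> F \<Longrightarrow> \<sigma> x = 0" if "\<sigma> \<in> S" for \<sigma> using S that by auto
  have R: "card (R \<sigma>) = m" if "\<sigma> \<in> S" for \<sigma>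
    unfolding R_def by (rule card_conjugate_roots[OF ctx hom(1)[OF that]])
  have finR: "finite (R \<sigma>)" if "\<sigma> \<in> S" for \<sigma>
    using R[OF that] q(5) by (simp add: card_ge_0_finite)
  have ext_const: "ext (\<sigma>, r) x = \<sigma> x" if "\<sigma> \<in> S" "r \<in> R \<sigma>" "x \<in> F" for \<sigma> r x
  proof -
    have root: "poly (map_poly \<sigma> q) r = 0" using that(2) by (simp add: R_def)
    have "root_extension F \<beta> \<sigma> r (poly [:x:] \<beta>) = poly (map_poly \<sigma> [:x:]) r"
      by (rule root_extension_poly[OF ctx hom(1)[OF that(1)] polys_over_const[OF subring that(3)] root])
    thus ?thesis
      by (simp add: ext_def map_poly_pCons ring_hom_on_0[OF subring hom(1)[OF that(1)]])
  qed
  have ext_gen: "ext (\<sigma>, r) \<beta> = r" if "\<sigma> \<in> S" "r \<in> R \<sigma>" for \<sigma> r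
  proof -
    have root: "poly (map_poly \<sigma> q) r = 0" using that(2) by (simp add: R_def)
    have "root_extension F \<beta> \<sigma> r (poly (monom 1 1) \<beta>) = poly (map_poly \<sigma> (monom 1 1)) r"
      by (rule root_extension_poly[OF ctx hom(1)[OF that(1)]
            polys_over_monom[OF subring subring_of_1[OF subring]] root])
    thus ?thesis
      by (simp add: ext_def map_poly_monom poly_monom ring_hom_on_0[OF subring hom(1)[OF that(1)]]
          ring_hom_on_1[OF subring hom(1)[OF that(1)]])
  qed
  have inj: "inj_on ext (Sigma S R)"
  proof (rule inj_onI, clarify)
    fix \<sigma> r \<tau> s assume *: "\<sigma> \<in> S" "r \<in> R \<sigma>" "\<tau> \<in> S" "s \<in> R \<tau>" "ext (\<sigma>, r) = ext (\<tau>, s)"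
    have "\<sigma> x = \<tau> x" for x
      using * ext_const[of \<sigma> r x] ext_const[of \<tau> s x] hom(2)[of \<sigma> x] hom(2)[of \<tau> x] by (cases "x \<in> F") auto
    moreover have "r = s" using * ext_gen by metis
    ultimately show "\<sigma> = \<tau> \<and> r = s" by auto
  qed
  have "rat_subalgebra F'"
    using F(1) subring_of_adjoin[OF subring, of \<beta>] by (auto simp: rat_subalgebra_def F'_def)
  moreover have "insert \<beta> B \<subseteq> F'"
    using F(2) subring_of_adjoin[OF subring, of \<beta>] by (auto simp: F'_def)
  moreover have "finite X'" using X by (simp add: X'_def)
  moreover have "F' \<subseteq> rat_vs.span X'"
    unfolding F'_def X'_def by (rule adjoin_span[OF ctx X(2)])
  moreover have "finite (ext ` Sigma S R)" using S(1) finR by auto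
  moreover have "ext ` Sigma S R \<subseteq> {\<sigma>. ring_hom_on F' \<sigma> \<and> (\<forall>x. x \<notin> F' \<longrightarrow> \<sigma> x = 0)}"
  proof safe
    fix \<sigma> r assume *: "\<sigma> \<in> S" "r \<in> R \<sigma>"
    have root: "poly (map_poly \<sigma> q) r = 0" using *(2) by (simp add: R_def)
    show "ring_hom_on F' (ext (\<sigma>, r))"
      unfolding F'_def ext_def prod.case
      by (rule root_extension_hom[OF ctx hom(1)[OF *(1)] root])
  next
    fix \<sigma> r x assume *: "\<sigma> \<in> S" "x \<notin> F'"
    show "ext (\<sigma>, r) x = 0"
      unfolding ext_def prod.case
      by (rule root_extension_outside[OF ctx hom(1)[OF *(1)] *(2)[unfolded F'_def]])
  qed
  moreover have "card X' \<le> card (ext ` Sigma S R)"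
  proof -
    have "card X' \<le> card X * m"
      unfolding X'_def using card_image_le[of "X \<times> {..<m}"] X(1) by (simp add: card_cartesian_product)
    also have "\<dots> \<le> card S * m" using XS by simp
    also have "\<dots> = (\<Sum>\<sigma>\<in>S. card (R \<sigma>))" by (simp add: R)
    also have "\<dots> = card (Sigma S R)" using S(1) finR by (simp add: card_SigmaI)
    also have "\<dots> = card (ext ` Sigma S R)" by (simp add: card_image[OF inj])
    finally show ?thesis .
  qed
  ultimately show ?case by blast
qed


subsection \<open>Separating the embeddings\<close>

text \<open>
  Over an infinite field finitely many proper subspaces do not cover the space: on a line through a
  point avoiding the first ones each condition excludes at most one parameter.
\<close>

lemma avoid_kernels:
  fixes W :: "'v::comm_monoid_add set" and K :: "'i \<Rightarrow> 'v \<Rightarrow> 'a::field_char_0"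
  assumes "finite A" and W: "0 \<in> W" "\<And>x y. x \<in> W \<Longrightarrow> y \<in> W \<Longrightarrow> x + y \<in> W"
    and add: "\<And>a x y. a \<in> A \<Longrightarrow> x \<in> W \<Longrightarrow> y \<in> W \<Longrightarrow> K a (x + y) = K a x + K a y"
    and nz: "\<And>a. a \<in> A \<Longrightarrow> \<exists>w\<in>W. K a w \<noteq> 0"
  shows "\<exists>w\<in>W. \<forall>a\<in>A. K a w \<noteq> 0"
  using assms(1) add nz
proof (induction A rule: finite_induct)
  case empty
  thus ?case using W by auto
next
  case (insert a A)
  obtain w where w: "w \<in> W" "\<forall>b\<in>A. K b w \<noteq> 0" using insert by auto
  obtain w' where w': "w' \<in> W" "K a w' \<noteq> 0" using insert.prems(2)[of a] by auto
  define pt where "pt t = ((\<lambda>x. x + w') ^^ t) w" for t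
  have pt_W: "pt t \<in> W" for t by (induction t) (auto simp: pt_def w w' W)
  have val: "K b (pt t) = K b w + of_nat t * K b w'" if "b \<in> insert a A" for b t
  proof (induction t)
    case (Suc t)
    have "pt (Suc t) = pt t + w'" by (simp add: pt_def)
    thus ?case using Suc insert.prems(1)[OF that pt_W w'(1)] by (simp add: algebra_simps)
  qed (simp add: pt_def)
  have "finite {t. K b (pt t) = 0}" if "b \<in> insert a A" for b
  proof -
    have "[:K b w, K b w':] \<noteq> 0" using that w w' by auto
    hence "finite {x. poly [:K b w, K b w':] x = 0}" by (rule poly_roots_finite)
    hence "finite ((of_nat :: nat \<Rightarrow> 'a) -` {x. poly [:K b w, K b w':] x = 0})"
      by (rule finite_vimageI) (simp add: inj_on_def)
    thus ?thesis using that by (simp add: val vimage_def)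
  qed
  hence "finite (\<Union>b\<in>insert a A. {t. K b (pt t) = 0})" using insert.hyps by auto
  then obtain t where "t \<notin> (\<Union>b\<in>insert a A. {t. K b (pt t) = 0})"
    using ex_new_if_finite infinite_UNIV_nat by blast
  thus ?case using pt_W by auto
qed

text \<open>
  When \<open>S\<close> consists of all embeddings, such an element is primitive: its conjugates are distinct.
\<close>

lemma separating_element:
  assumes "finite S" "S \<subseteq> (Embs :: ('k::field_char_0 \<Rightarrow> complex) set)"
  obtains \<theta> where "inj_on (\<lambda>\<phi>. \<phi> \<theta>) S"
proof -
  let ?A = "{(\<phi>, \<psi>) \<in> S \<times> S. \<phi> \<noteq> \<psi>}"
  have "\<exists>\<theta>\<in>UNIV. \<forall>a\<in>?A. (\<lambda>(\<phi>, \<psi>) x. \<phi> x - \<psi> x) a \<theta> \<noteq> 0"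
  proof (rule avoid_kernels)
    show "finite ?A" using assms(1) by (auto intro: finite_subset[of _ "S \<times> S"])
  next
    fix a x y assume "a \<in> ?A"
    then obtain \<phi> \<psi> where "a = (\<phi>, \<psi>)" "field_embedding \<phi>" "field_embedding \<psi>"
      using assms(2) by (auto simp: Embs_def)
    thus "(\<lambda>(\<phi>, \<psi>) x. \<phi> x - \<psi> x) a (x + y) =
      (\<lambda>(\<phi>, \<psi>) x. \<phi> x - \<psi> x) a x + (\<lambda>(\<phi>, \<psi>) x. \<phi> x - \<psi> x) a y"
      by (simp add: field_embedding_add)
  qed (auto simp: fun_eq_iff)
  then obtain \<theta> where "\<forall>a\<in>?A. (\<lambda>(\<phi>, \<psi>) x. \<phi> x - \<psi> x) a \<theta> \<noteq> 0" by blast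
  hence "inj_on (\<lambda>\<phi>. \<phi> \<theta>) S" by (intro inj_onI) auto
  thus ?thesis by (rule that)
qed

lemma embedding_root:
  fixes \<phi> :: "'k::field_char_0 \<Rightarrow> 'l::field_char_0"
  assumes "field_embedding \<phi>" "poly (map_poly of_rat p) x = 0"
  shows "poly (map_poly of_rat p) (\<phi> x) = 0"
proof -
  have "poly (map_poly of_rat p) (\<phi> x) = \<phi> (poly (map_poly of_rat p) x)"
    by (simp add: poly_altdef degree_map_poly coeff_map_poly field_embedding_sum[OF assms(1)]
      field_embedding_mult[OF assms(1)] field_embedding_power[OF assms(1)]
      field_embedding_of_rat_apply[OF assms(1)])
  thus ?thesis using assms by (simp add: field_embedding_0)
qed

lemma embedding_algebraic:
  fixes \<phi> :: "'k::field_char_0 \<Rightarrow> 'l::field_char_0"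
  assumes "field_embedding \<phi>" "algebraic x"
  shows "algebraic (\<phi> x)"
  using assms embedding_root unfolding algebraic_iff_rat_poly by blast

lemma Embs_eq:
  assumes "number_field TYPE('k::field_char_0)"
  shows "(Embs :: ('k \<Rightarrow> complex) set) = {\<phi>. field_embedding \<phi>}"
  using number_field_algebraic[OF assms] embedding_algebraic by (auto simp: Embs_def Qbar_def)

lemma number_field_basis:
  assumes "number_field TYPE('k::field_char_0)"
  obtains B :: "'k::field_char_0 set" where "finite B" "rat_vs.span B = UNIV" "card B = field_degree TYPE('k)"
proof -
  obtain B0 :: "'k set" where B0: "finite B0" "rat_vs.span B0 = UNIV"
    using assms by (auto simp: number_field_def)
  obtain B :: "'k set" where B: "rat_vs.independent B" "UNIV \<subseteq> rat_vs.span B" "card B = rat_vs.dim (UNIV :: 'k set)"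
    using rat_vs.basis_exists[of UNIV] by metis
  have "finite B" using rat_vs.independent_span_bound[OF B0(1) B(1)] B0 by auto
  thus ?thesis using B by (intro that[of B]) (auto simp: field_degree_def)
qed

lemma card_roots_le_degree:
  assumes "p \<noteq> 0" "\<And>x. x \<in> A \<Longrightarrow> poly p (x :: 'a::idom) = 0"
  shows "card A \<le> degree p"
proof -
  have "card A \<le> card {x. poly p x = 0}"
    using assms by (intro card_mono poly_roots_finite) auto
  also have "\<dots> \<le> degree p" by (rule card_poly_roots_bound[OF assms(1)])
  finally show ?thesis .
qed

lemma card_separated_embeddings_le_degree:
  fixes p :: "rat poly" and \<theta> :: "'k::field_char_0"
  assumes "p \<noteq> 0" "poly (map_poly of_rat p) \<theta> = 0"
    and "inj_on (\<lambda>\<phi>. \<phi> \<theta>) S" "S \<subseteq> (Embs :: ('k \<Rightarrow> complex) set)"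
  shows "card S \<le> degree p"
proof -
  have "card ((\<lambda>\<phi>. \<phi> \<theta>) ` S) \<le> degree (map_poly of_rat p :: complex poly)"
    using assms by (intro card_roots_le_degree) (auto simp: map_poly_eq_0_iff Embs_def embedding_root)
  thus ?thesis using assms(3) by (simp add: card_image degree_map_poly)
qed

text \<open>
  Finitely many embeddings are separated by one element. Their values there are roots of one
  rational polynomial whose degree is at most that of the field; this bounds their number from
  above.
\<close>

theorem
  assumes nf: "number_field TYPE('k::field_char_0)"
  shows finite_Embs: "finite (Embs :: ('k \<Rightarrow> complex) set)"
    and card_Embs: "card (Embs :: ('k \<Rightarrow> complex) set) = field_degree TYPE('k)"
proof -
  let ?E = "Embs :: ('k \<Rightarrow> complex) set"
  obtain B :: "'k set" where B: "finite B" "rat_vs.span B = UNIV" "card B = field_degree TYPE('k)"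
    using nf by (rule number_field_basis)
  have le: "card S \<le> field_degree TYPE('k)" if S: "finite S" "S \<subseteq> ?E" for S
  proof -
    obtain \<theta> where "inj_on (\<lambda>\<phi>. \<phi> \<theta>) S" using separating_element[OF S] by blast
    moreover obtain p :: "rat poly" where "p \<noteq> 0" "degree p \<le> card B" "poly (map_poly of_rat p) \<theta> = 0"
      using number_field_rat_poly[OF B(1,2)] by blast
    ultimately show ?thesis
      using card_separated_embeddings_le_degree[of p \<theta> S] S B(3) by simp
  qed
  show fin: "finite ?E"
  proof (rule ccontr)
    assume "infinite ?E"
    then obtain S where "S \<subseteq> ?E" "finite S" "card S = Suc (field_degree TYPE('k))"
      using infinite_arbitrarily_large by blast
    thus False using le[of S] by simp
  qed
  obtain F X S where F: "rat_subalgebra F" "B \<subseteq> (F :: 'k set)" and X: "finite X" "F \<subseteq> rat_vs.span X"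
    and S: "finite S" "S \<subseteq> {\<sigma> :: 'k \<Rightarrow> complex. ring_hom_on F \<sigma> \<and> (\<forall>x. x \<notin> F \<longrightarrow> \<sigma> x = 0)}" "card X \<le> card S"
    using enough_embeddings[OF B(1)] number_field_algebraic[OF nf] by blast
  have "rat_vs.subspace F"
    using F(1) by (auto simp: rat_subalgebra_def rat_scale_def
      intro!: rat_vs.subspaceI subring_of_0 subring_of_add subring_of_mult)
  hence "F = UNIV" using rat_vs.span_minimal[OF F(2)] B(2) by auto
  hence "S \<subseteq> ?E" using S(2) by (auto simp: Embs_eq[OF nf] field_embedding_iff_ring_hom_on)
  hence "card S \<le> card ?E" using fin by (intro card_mono)
  moreover have "field_degree TYPE('k) \<le> card X"
    unfolding field_degree_def using X \<open>F = UNIV\<close> by (intro rat_vs.dim_le_card) auto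
  ultimately show "card ?E = field_degree TYPE('k)"
    using le[OF fin] S(3) by simp
qed


section \<open>Rationality of symmetric expressions in the embeddings\<close>

subsection \<open>Newton's identities\<close>

text \<open>
  The coefficient of degree \<open>k\<close> is the elementary symmetric function \<open>e\<^sub>k\<close> of the \<open>w a\<close>.
\<close>

definition elem_sym_poly :: "'i set \<Rightarrow> ('i \<Rightarrow> 'r::idom) \<Rightarrow> 'r poly" where
  "elem_sym_poly A w = (\<Prod>a\<in>A. [:1, w a:])"

text \<open>
  The coefficient of degree \<open>k\<close> is the sum of \<open>c a\<close> times \<open>e\<^sub>k\<close> of the values of \<open>w\<close> at all places but
  \<open>a\<close>. For \<open>c = w\<close> this is the derivative of the generating polynomial; for the highest
  degree it is the trace of \<open>c\<close> times a cofactor.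
\<close>

definition punctured_sum :: "'i set \<Rightarrow> ('i \<Rightarrow> 'r::idom) \<Rightarrow> ('i \<Rightarrow> 'r) \<Rightarrow> 'r poly" where
  "punctured_sum A w c = (\<Sum>a\<in>A. smult (c a) (\<Prod>b\<in>A - {a}. [:1, w b:]))"

text \<open>
  Multiply out one factor: with \<open>P\<^sub>a\<close> for the product over the places other than \<open>a\<close>, the whole product is
  \<open>(1 + w a T) P\<^sub>a\<close>.
\<close>

lemma punctured_sum_rec:
  assumes "finite A"
  shows "punctured_sum A w c =
    smult (sum c A) (elem_sym_poly A w) - pCons 0 (punctured_sum A w (\<lambda>a. c a * w a))"
proof -
  have *: "pCons 0 (\<Sum>a\<in>A. f a) = (\<Sum>a\<in>A. pCons 0 (f a))" for f :: "'a \<Rightarrow> 'b poly"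
    by (rule poly_eqI) (simp add: coeff_pCons coeff_sum split: nat.split)
  have "smult (c a) (\<Prod>b\<in>A - {a}. [:1, w b:]) = smult (c a) (elem_sym_poly A w)
      - pCons 0 (smult (c a * w a) (\<Prod>b\<in>A - {a}. [:1, w b:]))" if "a \<in> A" for a
  proof -
    have "elem_sym_poly A w = [:1, w a:] * (\<Prod>b\<in>A - {a}. [:1, w b:])"
      unfolding elem_sym_poly_def using assms that by (rule prod.remove)
    thus ?thesis by (simp add: smult_add_right)
  qed
  hence "punctured_sum A w c = (\<Sum>a\<in>A. smult (c a) (elem_sym_poly A w)
      - pCons 0 (smult (c a * w a) (\<Prod>b\<in>A - {a}. [:1, w b:])))"
    unfolding punctured_sum_def by (intro sum.cong refl)
  thus ?thesis
    by (simp add: sum_subtractf punctured_sum_def * smult_sum)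
qed

lemma
  assumes "finite A"
  shows coeff_elem_sym_poly_0: "coeff (elem_sym_poly A w) 0 = 1"
    and coeff_punctured_sum_0: "coeff (punctured_sum A w c) 0 = sum c A"
    and coeff_punctured_sum_Suc: "coeff (punctured_sum A w c) (Suc k) =
      sum c A * coeff (elem_sym_poly A w) (Suc k) - coeff (punctured_sum A w (\<lambda>a. c a * w a)) k"
proof -
  show 1: "coeff (elem_sym_poly A w) 0 = 1"
    by (simp add: elem_sym_poly_def poly_prod flip: poly_0_coeff_0)
  show "coeff (punctured_sum A w c) 0 = sum c A"
    by (subst punctured_sum_rec[OF assms]) (simp add: 1)
  show "coeff (punctured_sum A w c) (Suc k) =
      sum c A * coeff (elem_sym_poly A w) (Suc k) - coeff (punctured_sum A w (\<lambda>a. c a * w a)) k"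
    by (subst punctured_sum_rec[OF assms]) simp
qed

lemma coeff_elem_sym_poly_Suc:
  "of_nat (Suc k) * coeff (elem_sym_poly A w) (Suc k) = coeff (punctured_sum A w w) k"
proof -
  have "pderiv (elem_sym_poly A w) = punctured_sum A w w"
    unfolding elem_sym_poly_def punctured_sum_def pderiv_prod
    by (intro sum.cong refl) (simp add: pderiv_pCons)
  from arg_cong[OF this, of "\<lambda>p. coeff p k"] show ?thesis by (simp add: coeff_pderiv)
qed

lemma coeff_elem_sym_poly_card:
  assumes "finite A"
  shows "degree (elem_sym_poly A w) \<le> card A \<and> coeff (elem_sym_poly A w) (card A) = prod w A"
  using assms
proof (induction A rule: finite_induct)
  case (insert a A)
  have eq: "elem_sym_poly (insert a A) w = elem_sym_poly A w + pCons 0 (smult (w a) (elem_sym_poly A w))"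
    using insert.hyps by (simp add: elem_sym_poly_def)
  have "coeff (elem_sym_poly A w) (Suc (card A)) = 0"
    using insert.IH by (intro coeff_eq_0) auto
  moreover have "degree (pCons 0 (smult (w a) (elem_sym_poly A w))) \<le> Suc (card A)"
    using insert.IH by (intro order.trans[OF degree_pCons_le]) (auto intro: order.trans[OF degree_smult_le])
  hence "degree (elem_sym_poly (insert a A) w) \<le> Suc (card A)"
    unfolding eq using insert.IH by (intro degree_add_le) auto
  ultimately show ?case using insert by (simp add: eq)
qed (simp add: elem_sym_poly_def)

text \<open>
  Both kinds of coefficients are treated by one induction on the degree, since the recursion for the
  weighted sums changes the weight. The set \<open>C\<close> collects the weights that occur.
\<close>

lemma newton_power_sums_to_coeffs:
  assumes "finite A" and R: "subring_of R" "\<And>k x. of_nat (Suc k) * x \<in> R \<Longrightarrow> x \<in> R"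
    and C: "w \<in> C" "\<And>c. c \<in> C \<Longrightarrow> (\<lambda>a. c a * w a) \<in> C" "\<And>c. c \<in> C \<Longrightarrow> sum c A \<in> R"
  shows "coeff (elem_sym_poly A w) k \<in> R \<and> (\<forall>c\<in>C. coeff (punctured_sum A w c) k \<in> R)"
proof (induction k)
  case 0
  show ?case using C R
    by (simp add: coeff_elem_sym_poly_0[OF assms(1)] coeff_punctured_sum_0[OF assms(1)] subring_of_1)
next
  case (Suc k)
  have "coeff (elem_sym_poly A w) (Suc k) \<in> R"
    by (rule R(2)[of k], subst coeff_elem_sym_poly_Suc) (use Suc C in auto)
  thus ?case
    using Suc C R by (auto simp: coeff_punctured_sum_Suc[OF assms(1)] intro!: subring_of_diff subring_of_mult)
qed

lemma newton_coeffs_to_power_sums: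
  assumes "finite A" "subring_of R" "\<And>k. coeff (elem_sym_poly A w) k \<in> R"
  shows "(\<Sum>a\<in>A. w a ^ Suc j) \<in> R"
proof -
  have "\<forall>k. coeff (punctured_sum A w (\<lambda>a. w a ^ Suc j)) k \<in> R"
  proof (induction j)
    case 0
    have "coeff (punctured_sum A w w) k \<in> R" for k
      using assms by (subst coeff_elem_sym_poly_Suc[symmetric]) (intro subring_of_mult subring_of_of_nat)
    thus ?case by simp
  next
    case (Suc j)
    have "(\<Sum>a\<in>A. w a ^ Suc j) \<in> R"
      using Suc spec[OF Suc, of 0] by (simp only: coeff_punctured_sum_0[OF assms(1)])
    moreover have "coeff (punctured_sum A w (\<lambda>a. w a ^ Suc (Suc j))) k =
      (\<Sum>a\<in>A. w a ^ Suc j) * coeff (elem_sym_poly A w) (Suc k)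
      - coeff (punctured_sum A w (\<lambda>a. w a ^ Suc j)) (Suc k)" for k
      unfolding coeff_punctured_sum_Suc[OF assms(1)] by (simp add: mult.commute)
    ultimately show ?case
      using Suc assms by (auto intro!: subring_of_diff subring_of_mult)
  qed
  from spec[OF this, of 0] show ?thesis by (simp only: coeff_punctured_sum_0[OF assms(1)])
qed


subsection \<open>Traces\<close>

lemma poly_eq_prod_of_roots:
  fixes p :: "'a::idom poly"
  assumes "finite R" "degree p \<le> card R" "\<And>r. r \<in> R \<Longrightarrow> poly p r = 0"
  shows "p = smult (coeff p (card R)) (\<Prod>r\<in>R. [:-r, 1:])"
proof -
  let ?P = "\<Prod>r\<in>R. [:-r, 1:]"
  define D where "D = p - smult (coeff p (card R)) ?P"
  have degP: "degree ?P = card R" by (subst degree_prod_eq_sum_degree) auto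
  have "lead_coeff ?P = 1" by (simp add: lead_coeff_prod)
  hence "coeff D (card R) = 0" by (simp add: D_def degP)
  moreover have "degree D \<le> card R"
    unfolding D_def using assms(2) degP by (intro degree_diff_le) (auto intro: order.trans[OF degree_smult_le])
  ultimately have "D = 0 \<or> degree D < card R" using eq_zero_or_degree_less by blast
  moreover have "poly D r = 0" if "r \<in> R" for r
    using that assms by (simp add: D_def poly_prod prod_zero)
  ultimately have "D = 0" using card_roots_le_degree[of D R] by fastforce
  thus ?thesis by (simp add: D_def)
qed

lemma subring_of_Rats: "subring_of (\<rat> :: 'a::field_char_0 set)"
  by (auto simp: subring_of_def)

text \<open>
  A separating element \<open>\<theta>\<close> generates the field, and the product of the \<open>X - \<phi> \<theta>\<close> is, up to a factor,
  a rational polynomial that annihilates \<open>\<theta>\<close>. Newton's identities give the traces of the powers of \<open>\<theta>\<close>, which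
  span the field.
\<close>

theorem trace_rational:
  assumes nf: "number_field TYPE('k::field_char_0)"
  shows "(\<Sum>\<phi>\<in>Embs. \<phi> (y :: 'k)) \<in> \<rat>"
proof -
  let ?E = "Embs :: ('k \<Rightarrow> complex) set"
  note fin = finite_Embs[OF nf] and card = card_Embs[OF nf]
  let ?d = "field_degree TYPE('k)"
  let ?V = "{y. (\<Sum>\<phi>\<in>?E. \<phi> y) \<in> \<rat>}"
  obtain B :: "'k set" where B: "finite B" "rat_vs.span B = UNIV" "card B = ?d"
    using nf by (rule number_field_basis)
  obtain \<theta> where \<theta>: "inj_on (\<lambda>\<phi>. \<phi> \<theta>) ?E"
    using separating_element[OF fin order.refl] by blast
  have emb: "field_embedding \<phi>" if "\<phi> \<in> ?E" for \<phi> using that by (simp add: Embs_def)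
  obtain p :: "rat poly" where p: "p \<noteq> 0" "degree p \<le> ?d" "poly (map_poly of_rat p) \<theta> = 0"
    using number_field_rat_poly[OF B(1,2)] B(3) by metis
  let ?pows = "(\<lambda>i. \<theta> ^ i) ` {..<?d}"
  \<comment> \<open>\<open>\<theta>\<close> is a primitive element: its powers below \<open>d\<close> form a basis.\<close>
  have no_small: "r = 0" if "degree r < ?d" "poly (map_poly of_rat r) \<theta> = 0" for r :: "rat poly"
    using card_separated_embeddings_le_degree[of r \<theta> ?E] \<theta> that card by fastforce
  hence indep: "inj_on (\<lambda>i. \<theta> ^ i) {..<?d}" "\<not> rat_vs.dependent ?pows"
    using powers_dependent_imp_rat_poly[of \<theta> ?d] by metis+
  have span: "y \<in> rat_vs.span ?pows"
  proof (rule ccontr)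
    assume y: "y \<notin> rat_vs.span ?pows"
    hence "\<not> rat_vs.dependent (insert y ?pows)"
      using indep(2) by (rule rat_vs.independent_insertI)
    from rat_vs.independent_span_bound[OF B(1) this]
    have "card (insert y ?pows) \<le> card B"
      unfolding B(2) by simp
    moreover have "y \<notin> ?pows" using y by (metis rat_vs.span_base)
    ultimately show False using B(3) by (simp add: card_image[OF indep(1)])
  qed
  have root: "poly (map_poly of_rat p) (\<phi> \<theta>) = 0" if "\<phi> \<in> ?E" for \<phi>
    by (rule embedding_root[OF emb[OF that] p(3)])
  let ?R = "(\<lambda>\<phi>. \<phi> \<theta>) ` ?E"
  have cardR: "card ?R = ?d" using \<theta> card by (simp add: card_image)
  define P where "P = (\<Prod>\<phi>\<in>?E. [:- \<phi> \<theta>, 1:])"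
  have "map_poly of_rat p = smult (coeff (map_poly of_rat p) (card ?R)) (\<Prod>r\<in>?R. [:-r, 1:])"
    using fin p root by (intro poly_eq_prod_of_roots) (auto simp: cardR degree_map_poly)
  also have "\<dots> = smult (of_rat (coeff p ?d)) P"
    using \<theta> by (simp add: cardR coeff_map_poly P_def prod.reindex)
  finally have pP: "map_poly of_rat p = smult (of_rat (coeff p ?d)) P" .
  have nz: "coeff p ?d \<noteq> 0"
  proof
    assume "coeff p ?d = 0"
    with pP have "map_poly of_rat p = (0 :: complex poly)" by simp
    with p(1) show False by (simp add: map_poly_eq_0_iff)
  qed
  have P_rat: "coeff P i \<in> \<rat>" for i
  proof -
    have "of_rat (coeff p i) = of_rat (coeff p ?d) * coeff P i"
      using arg_cong[OF pP, of "\<lambda>p. coeff p i"] by (simp add: coeff_map_poly)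
    hence "coeff P i = of_rat (coeff p i / coeff p ?d)"
      using nz by (simp add: of_rat_divide field_simps)
    thus ?thesis by simp
  qed
  have "elem_sym_poly ?E (\<lambda>\<phi>. - \<phi> \<theta>) = reflect_poly P"
    unfolding elem_sym_poly_def P_def reflect_poly_prod
    by (intro prod.cong refl) (simp add: reflect_poly_def)
  hence "coeff (elem_sym_poly ?E (\<lambda>\<phi>. - \<phi> \<theta>)) k \<in> \<rat>" for k
    using P_rat by (simp add: coeff_reflect_poly)
  from newton_coeffs_to_power_sums[OF fin subring_of_Rats this]
  have neg: "(\<Sum>\<phi>\<in>?E. (- \<phi> \<theta>) ^ Suc j) \<in> \<rat>" for j .
  have powers: "(\<Sum>\<phi>\<in>?E. \<phi> (\<theta> ^ j)) \<in> \<rat>" for j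
  proof (cases j)
    case 0
    thus ?thesis by (simp add: emb field_embedding_1)
  next
    case (Suc i)
    have "\<phi> (\<theta> ^ j) = (-1) ^ j * (- \<phi> \<theta>) ^ j" if "\<phi> \<in> ?E" for \<phi>
      using emb[OF that] by (subst power_mult_distrib[symmetric]) (simp add: field_embedding_power)
    hence "(\<Sum>\<phi>\<in>?E. \<phi> (\<theta> ^ j)) = (-1) ^ j * (\<Sum>\<phi>\<in>?E. (- \<phi> \<theta>) ^ j)"
      by (simp add: sum_distrib_left)
    moreover have "(-1) ^ j \<in> (\<rat> :: complex set)" by (intro Rats_power) simp
    ultimately show ?thesis using neg[of i] Suc by (metis Rats_mult)
  qed
  show ?thesis using span
  proof (induction rule: rat_vs.span_induct)
    case base
    show ?case
    proof (rule rat_vs.subspaceI)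
      show "0 \<in> ?V" by (simp add: emb field_embedding_0)
    next
      fix x y assume "x \<in> ?V" "y \<in> ?V"
      thus "x + y \<in> ?V"
        by (simp add: emb field_embedding_add sum.distrib)
    next
      fix c x assume "x \<in> ?V"
      thus "rat_scale c x \<in> ?V"
        by (simp add: rat_scale_def emb field_embedding_mult field_embedding_of_rat_apply
          flip: sum_distrib_left)
    qed
  qed (use powers in auto)
qed


subsection \<open>Norm polynomials\<close>

abbreviation rat_polys :: "complex mpoly set" where
  "rat_polys \<equiv> range complexify"

lemma subring_of_rat_polys: "subring_of rat_polys"
  unfolding subring_of_def
proof (intro conjI ballI)
  show "1 \<in> rat_polys" by (metis conjugate_poly_1' field_embedding_of_rat rangeI)
  show "x + y \<in> rat_polys" "x * y \<in> rat_polys" if "x \<in> rat_polys" "y \<in> rat_polys" for x y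
    using that by (auto simp flip: conjugate_poly_add'[OF field_embedding_of_rat]
      conjugate_poly_mult'[OF field_embedding_of_rat])
  show "- x \<in> rat_polys" if x: "x \<in> rat_polys" for x
  proof -
    obtain g :: "rat mpoly" where g: "x = complexify g" using x by auto
    have "complexify (- g) + x = 0"
      unfolding g by (simp flip: conjugate_poly_add'[OF field_embedding_of_rat])
    hence "- x = complexify (- g)" by (simp add: add_eq_0_iff)
    thus ?thesis by simp
  qed
qed

lemma rat_polys_divide:
  assumes "of_nat (Suc k) * x \<in> rat_polys"
  shows "x \<in> rat_polys"
proof -
  obtain g :: "rat mpoly" where g: "of_nat (Suc k) * x = complexify g" using assms by auto
  let ?c = "1 / of_nat (Suc k) :: rat"
  have "complexify (single 0 ?c * g)
      = single 0 (of_rat ?c) * (of_nat (Suc k) * x)"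
    by (simp add: conjugate_poly_mult' conjugate_poly_single g del: of_nat_Suc)
  also have "of_nat (Suc k) = (single 0 (of_nat (Suc k)) :: complex mpoly)"
    by (simp only: single_of_nat)
  also have "single 0 (of_rat ?c) * (single 0 (of_nat (Suc k)) * x)
      = single 0 (of_rat ?c * of_nat (Suc k)) * x"
    by (simp only: mult_single mult.assoc[symmetric] add_0_left)
  also have "\<dots> = x"
    by (simp add: of_rat_divide del: of_nat_Suc)
  finally show ?thesis by (metis rangeI)
qed

text \<open>
  This is the trace applied to the coefficients.
\<close>

lemma trace_poly_rational:
  assumes nf: "number_field TYPE('k::field_char_0)"
  shows "(\<Sum>\<phi>\<in>Embs. conjugate_poly \<phi> (c :: 'k mpoly)) \<in> rat_polys"
proof -
  define \<tau> :: "'k \<Rightarrow> rat" where "\<tau> y = inv of_rat (\<Sum>\<phi>\<in>Embs. \<phi> y)" for y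
  have \<tau>: "of_rat (\<tau> y) = (\<Sum>\<phi>\<in>Embs. \<phi> y)" for y
    unfolding \<tau>_def using trace_rational[OF nf] by (intro f_inv_into_f) (auto simp: Rats_def)
  have emb: "\<phi> 0 = 0" if "\<phi> \<in> Embs" for \<phi> :: "'k \<Rightarrow> complex"
    using that by (simp add: Embs_def field_embedding_0)
  have "of_rat (\<tau> 0) = (0 :: complex)" unfolding \<tau> using emb by (intro sum.neutral) auto
  hence \<tau>0: "\<tau> 0 = 0" by simp
  have "(\<Sum>\<phi>\<in>Embs. conjugate_poly \<phi> c) = complexify (conjugate_poly \<tau> c)"
    by (intro poly_mapping_eqI) (simp add: lookup_sum lookup_conjugate_poly emb \<tau>0 \<tau>)
  thus ?thesis by blast
qed

text \<open>
  Newton's identities hold in the ring of polynomials in several variables; here the weights are the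
  families of conjugates of a fixed polynomial, and their sums are traces.
\<close>

theorem
  fixes l :: "'k::field_char_0 mpoly"
  assumes nf: "number_field TYPE('k)"
  shows norm_poly_rational: "(\<Prod>\<phi>\<in>Embs. conjugate_poly \<phi> l) \<in> rat_polys"
    and cofactor_trace_rational:
      "(\<Sum>\<phi>\<in>Embs. conjugate_poly \<phi> c * (\<Prod>\<psi>\<in>Embs - {\<phi>}. conjugate_poly \<psi> l)) \<in> rat_polys"
proof -
  let ?E = "Embs :: ('k \<Rightarrow> complex) set"
  let ?w = "\<lambda>\<phi>. conjugate_poly \<phi> l"
  let ?C = "range (\<lambda>c \<phi>. if \<phi> \<in> ?E then conjugate_poly \<phi> c else 0)"
  \<comment> \<open>The weights are set to zero outside the embeddings, where conjugation need not be multiplicative.\<close>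
  define w where "w = (\<lambda>\<phi>. if \<phi> \<in> ?E then conjugate_poly \<phi> l else 0)"
  note fin = finite_Embs[OF nf]
  have emb: "field_embedding \<phi>" if "\<phi> \<in> ?E" for \<phi> using that by (simp add: Embs_def)
  have key: "coeff (elem_sym_poly ?E w) k \<in> rat_polys \<and>
      (\<forall>c\<in>?C. coeff (punctured_sum ?E w c) k \<in> rat_polys)" for k
  proof (rule newton_power_sums_to_coeffs[OF fin subring_of_rat_polys rat_polys_divide])
    show "w \<in> ?C" by (auto simp: w_def)
    show "(\<lambda>\<phi>. c \<phi> * w \<phi>) \<in> ?C" if c: "c \<in> ?C" for c
    proof -
      obtain c' where "c = (\<lambda>\<phi>. if \<phi> \<in> ?E then conjugate_poly \<phi> c' else 0)" using c by auto
      hence "(\<lambda>\<phi>. c \<phi> * w \<phi>) = (\<lambda>\<phi>. if \<phi> \<in> ?E then conjugate_poly \<phi> (c' * l) else 0)"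
        by (auto simp: w_def fun_eq_iff conjugate_poly_mult' emb)
      thus ?thesis by blast
    qed
    show "sum c ?E \<in> rat_polys" if "c \<in> ?C" for c
      using that trace_poly_rational[OF nf] by auto
  qed
  have "prod w ?E \<in> rat_polys"
    using key[of "card ?E"] coeff_elem_sym_poly_card[OF fin, of w] by simp
  thus "(\<Prod>\<phi>\<in>?E. conjugate_poly \<phi> l) \<in> rat_polys"
    by (simp add: w_def cong: prod.cong)
  define c' where "c' = (\<lambda>\<phi>. if \<phi> \<in> ?E then conjugate_poly \<phi> c else 0)"
  have "coeff (punctured_sum ?E w c') (card ?E - 1) \<in> rat_polys"
    using key by (auto simp: c'_def)
  also have "coeff (punctured_sum ?E w c') (card ?E - 1)
      = (\<Sum>\<phi>\<in>?E. c' \<phi> * prod w (?E - {\<phi>}))"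
    unfolding punctured_sum_def coeff_sum
  proof (intro sum.cong refl)
    fix \<phi> assume "\<phi> \<in> ?E"
    hence card: "card ?E - 1 = card (?E - {\<phi>})" using fin by simp
    show "coeff (smult (c' \<phi>) (\<Prod>\<psi>\<in>?E - {\<phi>}. [:1, w \<psi>:])) (card ?E - 1) = c' \<phi> * prod w (?E - {\<phi>})"
      unfolding card using coeff_elem_sym_poly_card[of "?E - {\<phi>}" w] fin
      by (simp add: elem_sym_poly_def)
  qed
  also have "\<dots> = (\<Sum>\<phi>\<in>?E. conjugate_poly \<phi> c * (\<Prod>\<psi>\<in>?E - {\<phi>}. conjugate_poly \<psi> l))"
    by (intro sum.cong refl arg_cong2[of _ _ _ _ "(*)"] prod.cong) (auto simp: c'_def w_def)
  finally show "\<dots> \<in> rat_polys" .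
qed

lemma norm_poly_conjugate:
  fixes l :: "'k::field_char_0 mpoly"
  assumes nf: "number_field TYPE('k)"
  shows "complexify (norm_poly l) = (\<Prod>\<phi>\<in>Embs. conjugate_poly \<phi> l)"
  unfolding norm_poly_def
proof (rule theI')
  show "\<exists>!f. complexify f = (\<Prod>\<phi>\<in>Embs. conjugate_poly \<phi> l)"
    using norm_poly_rational[OF nf, of l]
    by (auto simp: conjugate_poly_eq_iff)
qed


section \<open>Sums of squares in a totally imaginary field\<close>

text \<open>
  Sums and products of elements that are to become nonnegative in an ordering, and all squares.
\<close>

definition preordering :: "'a::field set \<Rightarrow> bool" where
  "preordering T \<longleftrightarrow> (\<forall>x. x * x \<in> T) \<and> (\<forall>x\<in>T. \<forall>y\<in>T. x + y \<in> T \<and> x * y \<in> T) \<and> - 1 \<notin> T"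

lemma preordering_maximal:
  assumes "preordering T0"
  obtains T where "T0 \<subseteq> T" "preordering T" "\<And>T'. preordering T' \<Longrightarrow> T \<subseteq> T' \<Longrightarrow> T' = T"
proof -
  let ?P = "{T. T0 \<subseteq> T \<and> preordering T}"
  have "\<exists>M\<in>?P. \<forall>X\<in>?P. M \<subseteq> X \<longrightarrow> X = M"
  proof (rule subset_Zorn_nonempty)
    show "?P \<noteq> {}" using assms by auto
  next
    fix C assume C: "C \<noteq> {}" "subset.chain ?P C"
    have pre: "preordering T" "T0 \<subseteq> T" if "T \<in> C" for T using C that by (auto simp: subset_chain_def)
    have "x + y \<in> \<Union>C \<and> x * y \<in> \<Union>C" if xy: "x \<in> \<Union>C" "y \<in> \<Union>C" for x y
    proof -
      obtain A B where AB: "A \<in> C" "B \<in> C" "x \<in> A" "y \<in> B" using xy by blast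
      hence "A \<subseteq> B \<or> B \<subseteq> A" using C(2) by (auto simp: subset_chain_def)
      then obtain D where "D \<in> C" "x \<in> D" "y \<in> D" using AB by blast
      thus ?thesis using pre(1)[of D] by (auto simp: preordering_def)
    qed
    moreover have "x * x \<in> \<Union>C" for x using C(1) pre(1) by (auto simp: preordering_def)
    moreover have "- 1 \<notin> \<Union>C" using pre(1) by (auto simp: preordering_def)
    ultimately have "preordering (\<Union>C)" by (simp add: preordering_def)
    moreover have "T0 \<subseteq> \<Union>C" using C(1) pre(2) by blast
    ultimately show "\<Union>C \<in> ?P" by simp
  qed
  then obtain T where T: "T0 \<subseteq> T" "preordering T"
      "\<forall>X\<in>?P. T \<subseteq> X \<longrightarrow> X = T" by auto
  show ?thesis
  proof (rule that[OF T(1,2)])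
    fix T' assume "preordering T'" "T \<subseteq> T'"
    thus "T' = T" using T(1,3) by auto
  qed
qed

text \<open>
  So a maximal preordering is the set of nonnegative elements of a field ordering. If neither \<open>x\<close> nor
  \<open>- x\<close> were in \<open>T\<close>, then \<open>T\<close> could be enlarged by adjoining \<open>- x\<close>: a representation \<open>- 1 = a - x * b\<close> would
  express \<open>x\<close> by elements of \<open>T\<close>, as \<open>x = b * (1 + a) / b\<^sup>2\<close>.
\<close>

lemma preordering_maximal_total:
  fixes T :: "'a::field set"
  assumes T: "preordering T" and max: "\<And>T'. preordering T' \<Longrightarrow> T \<subseteq> T' \<Longrightarrow> T' = T"
  shows "x \<in> T \<or> - x \<in> T"
proof (rule ccontr)
  assume neg: "\<not> (x \<in> T \<or> - x \<in> T)"
  have sq: "y * y \<in> T" and add: "y \<in> T \<Longrightarrow> z \<in> T \<Longrightarrow> y + z \<in> T"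
    and mult: "y \<in> T \<Longrightarrow> z \<in> T \<Longrightarrow> y * z \<in> T" for y z
    using T by (auto simp: preordering_def)
  have 01: "0 \<in> T" "1 \<in> T" using sq[of 0] sq[of 1] by auto
  let ?T' = "{a - x * b | a b. a \<in> T \<and> b \<in> T}"
  have sub: "T \<subseteq> ?T'"
  proof
    fix a assume "a \<in> T"
    thus "a \<in> ?T'" using 01 by (intro CollectI exI[of _ a] exI[of _ 0]) simp
  qed
  have "preordering ?T'"
    unfolding preordering_def
  proof (intro conjI allI ballI)
    fix y show "y * y \<in> ?T'" using sub sq by blast
  next
    fix y z assume "y \<in> ?T'" "z \<in> ?T'"
    then obtain a b c d where yz: "y = a - x * b" "z = c - x * d" "a \<in> T" "b \<in> T" "c \<in> T" "d \<in> T"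
      by blast
    have "y + z = (a + c) - x * (b + d)" by (simp add: yz algebra_simps)
    thus "y + z \<in> ?T'"
      using add[OF yz(3,5)] add[OF yz(4,6)] by (intro CollectI exI conjI)
    have "y * z = (a * c + (x * x) * (b * d)) - x * (a * d + b * c)" by (simp add: yz algebra_simps)
    moreover have "a * c + (x * x) * (b * d) \<in> T" "a * d + b * c \<in> T"
      by (intro add mult sq yz)+
    ultimately show "y * z \<in> ?T'" by (intro CollectI exI conjI)
  next
    show "- 1 \<notin> ?T'"
    proof
      assume "- 1 \<in> ?T'"
      then obtain a b where ab: "- 1 = a - x * b" "a \<in> T" "b \<in> T" by blast
      hence eq: "x * b = 1 + a" by (simp add: algebra_simps)
      have "b \<noteq> 0"
      proof
        assume "b = 0"
        with ab have "- 1 \<in> T" by simp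
        thus False using T by (simp add: preordering_def)
      qed
      hence "x = b * (1 + a) * (inverse b * inverse b)" by (simp add: field_simps flip: eq)
      moreover have "b * (1 + a) * (inverse b * inverse b) \<in> T" by (intro mult add sq ab 01)
      ultimately show False using neg by simp
    qed
  qed
  from max[OF this sub] have "?T' = T" .
  moreover have "- x \<in> ?T'" using 01 by (intro CollectI exI[of _ 0] exI[of _ 1]) simp
  ultimately show False using neg by simp
qed

text \<open>
  An ordering of an algebraic extension of the rationals is archimedean: a monic polynomial takes a
  value of at least 1 at an element that exceeds all rational numbers, by Horner's scheme.
\<close>

lemma preordering_archimedean:
  fixes T :: "'a::field_char_0 set"
  assumes T: "preordering T" and total: "\<And>x. x \<in> T \<or> - x \<in> T" and "algebraic x"
  shows "\<exists>N::nat. of_nat N - x \<in> T"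
proof (rule ccontr)
  assume neg: "\<not> ?thesis"
  have sq: "y * y \<in> T" and add: "y \<in> T \<Longrightarrow> z \<in> T \<Longrightarrow> y + z \<in> T"
    and mult: "y \<in> T \<Longrightarrow> z \<in> T \<Longrightarrow> y * z \<in> T" for y z
    using T by (auto simp: preordering_def)
  have 01: "0 \<in> T" "1 \<in> T" using sq[of 0] sq[of 1] by auto
  have nat: "of_nat k \<in> T" for k by (induction k) (auto intro: add 01)
  have inv: "inverse (of_nat k) \<in> T" for k
  proof (cases "k = 0")
    case False
    have "inverse (of_nat k) = of_nat k * (inverse (of_nat k) * inverse (of_nat k) :: 'a)"
      using False by simp
    thus ?thesis using mult[OF nat sq] by metis
  qed (use 01 in simp)
  have big: "x - of_nat N \<in> T" for N using total[of "x - of_nat N"] neg by auto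
  have rat: "x + of_rat c \<in> T" for c
  proof -
    obtain a b where c: "c = Rat.Fract a b" "b > 0" by (cases c) auto
    define N where "N = nat \<bar>a\<bar>"
    have "of_rat c + of_nat N = (of_int (a + int N * b) * inverse (of_nat (nat b)) :: 'a)"
      using c by (simp add: of_rat_rat field_simps)
    moreover have "a + int N * b \<ge> 0"
    proof -
      have "int N * 1 \<le> int N * b" using c by (intro mult_left_mono) auto
      thus ?thesis by (simp add: N_def)
    qed
    then obtain M where "a + int N * b = int M" using nonneg_int_cases by blast
    ultimately have "of_rat c + of_nat N \<in> T" using mult[OF nat inv] by simp
    from add[OF big[of N] this] show ?thesis by simp
  qed
  have horner: "poly (map_poly of_rat p) x - 1 \<in> T" if "lead_coeff p = 1" for p :: "rat poly"
    using that
  proof (induction p)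
    case (pCons c p)
    show ?case
    proof (cases "p = 0")
      case True
      thus ?thesis using pCons.prems 01 by (simp add: map_poly_pCons)
    next
      case False
      have x: "x \<in> T" using big[of 0] by simp
      have "poly (map_poly of_rat (pCons c p)) x - 1
         = (x + of_rat (c - 1)) + x * (poly (map_poly of_rat p) x - 1)"
        by (simp add: map_poly_pCons of_rat_diff algebra_simps)
      thus ?thesis using add[OF rat mult[OF x pCons.IH]] pCons.prems False by simp
    qed
  qed simp
  from \<open>algebraic x\<close> obtain p :: "rat poly" where p: "p \<noteq> 0" "poly (map_poly of_rat p) x = 0"
    by (auto simp: algebraic_iff_rat_poly)
  define q where "q = smult (inverse (lead_coeff p)) p"
  have "map_poly of_rat q = smult (of_rat (inverse (lead_coeff p))) (map_poly of_rat p :: 'a poly)"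
    by (rule poly_eqI) (simp add: q_def coeff_map_poly of_rat_mult)
  hence "poly (map_poly of_rat q) x = 0" using p by simp
  moreover have "lead_coeff q = 1" using p by (simp add: q_def)
  ultimately have "- 1 \<in> T" using horner[of q] by simp
  thus False using T by (simp add: preordering_def)
qed

text \<open>The embedding sends an element to the supremum of the rational numbers below it.\<close>

lemma real_embedding_of_ordering:
  fixes T :: "'a::field_char_0 set"
  assumes T: "preordering T" and total: "\<And>x. x \<in> T \<or> - x \<in> T"
    and arch: "\<And>x. \<exists>N::nat. of_nat N - x \<in> T"
  obtains \<phi> :: "'a \<Rightarrow> real" where "field_embedding \<phi>"
proof -
  have sq: "y * y \<in> T" and add: "y \<in> T \<Longrightarrow> z \<in> T \<Longrightarrow> y + z \<in> T"
    and mult: "y \<in> T \<Longrightarrow> z \<in> T \<Longrightarrow> y * z \<in> T" for y z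
    using T by (auto simp: preordering_def)
  have 01: "0 \<in> T" "1 \<in> T" using sq[of 0] sq[of 1] by auto
  have m1: "- 1 \<notin> T" using T by (simp add: preordering_def)
  have nat: "of_nat k \<in> T" for k by (induction k) (auto intro: add 01)
  have rat_pos: "of_rat q \<in> T" if "q \<ge> 0" for q
  proof -
    obtain a b where q: "q = Rat.Fract a b" "b > 0" by (cases q) auto
    with that have "a \<ge> 0" by (simp add: Rat.zero_le_Fract_iff)
    then obtain n where n: "a = int n" using nonneg_int_cases by blast
    obtain k where k: "b = int k" using q(2) by (metis less_imp_le nonneg_int_cases)
    have eq: "of_rat q = of_nat (n * k) * (inverse (of_nat k) * inverse (of_nat k) :: 'a)"
      using q n k by (simp add: of_rat_rat field_simps)
    show ?thesis unfolding eq by (intro mult nat sq)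
  qed
  have antisym: "x = 0" if "x \<in> T" "- x \<in> T" for x
  proof (rule ccontr)
    assume "x \<noteq> 0"
    hence "- 1 = (x * - x) * (inverse x * inverse x)" by (simp add: field_simps)
    thus False using mult[OF mult[OF that] sq[of "inverse x"]] m1 by simp
  qed
  have rat_iff: "of_rat q \<in> T \<longleftrightarrow> q \<ge> 0" for q
    using rat_pos[of q] rat_pos[of "- q"] antisym[of "of_rat q"] by (fastforce simp: of_rat_minus)
  define L where "L x = {real_of_rat q | q. x - of_rat q \<in> T}" for x
  define \<phi> where "\<phi> x = Sup (L x)" for x
  have bdd: "bdd_above (L x)" for x
  proof -
    obtain N :: nat where N: "of_nat N - x \<in> T" using arch by blast
    have "q \<le> of_nat N" if "x - of_rat q \<in> T" for q
    proof -
      have "of_rat (of_nat N - q) \<in> T" using add[OF N that] by (simp add: of_rat_diff)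
      thus ?thesis using rat_iff by simp
    qed
    thus ?thesis unfolding L_def
      by (intro bdd_aboveI[of _ "real N"]) (auto, metis of_rat_less_eq of_rat_of_nat_eq)
  qed
  have nonempty: "L x \<noteq> {}" for x
  proof -
    obtain N :: nat where "of_nat N - (- x) \<in> T" using arch by blast
    hence "x - of_rat (- of_nat N) \<in> T" by (simp add: of_rat_minus add.commute)
    thus ?thesis unfolding L_def by blast
  qed
  have low: "of_rat q \<le> \<phi> x" if "x - of_rat q \<in> T" for q x
    unfolding \<phi>_def using that bdd by (intro cSup_upper) (auto simp: L_def)
  have low': "x - of_rat q \<in> T" if "of_rat q < \<phi> x" for q x
  proof -
    have "\<exists>z\<in>L x. of_rat q < z"
      using that less_cSup_iff[OF nonempty bdd] by (simp add: \<phi>_def)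
    then obtain r where r: "x - of_rat r \<in> T" "real_of_rat q < of_rat r"
      by (auto simp: L_def)
    have "of_rat (r - q) \<in> T" using r(2) by (intro rat_pos) (simp add: of_rat_less)
    from add[OF r(1) this] show ?thesis by (simp add: of_rat_diff)
  qed
  have up: "\<phi> x \<le> of_rat q" if "of_rat q - x \<in> T" for q x
  proof (rule ccontr)
    assume "\<not> ?thesis"
    then obtain r where r: "real_of_rat q < of_rat r" "of_rat r < \<phi> x"
      using of_rat_dense[of "of_rat q" "\<phi> x"] by auto
    have "of_rat (q - r) \<in> T" using add[OF that low'[OF r(2)]] by (simp add: of_rat_diff)
    thus False using r(1) rat_iff by (simp add: of_rat_less)
  qed
  have up': "of_rat q - x \<in> T" if "\<phi> x < of_rat q" for q x
    using total[of "of_rat q - x"] low[of x q] that by auto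
  have plus: "\<phi> (x + y) = \<phi> x + \<phi> y" for x y
  proof (rule antisym_conv3[THEN iffD1])
    show "\<not> \<phi> (x + y) < \<phi> x + \<phi> y"
    proof
      assume "\<phi> (x + y) < \<phi> x + \<phi> y"
      hence "\<phi> (x + y) - \<phi> y < \<phi> x" by simp
      then obtain q where q: "\<phi> (x + y) - \<phi> y < of_rat q" "of_rat q < \<phi> x" using of_rat_dense by blast
      hence "\<phi> (x + y) - of_rat q < \<phi> y" by simp
      then obtain r where r: "\<phi> (x + y) - of_rat q < of_rat r" "of_rat r < \<phi> y" using of_rat_dense by blast
      have "(x + y) - of_rat (q + r) \<in> T"
        using add[OF low'[OF q(2)] low'[OF r(2)]] by (simp add: of_rat_add algebra_simps)
      from low[OF this] show False using r(1) by (simp add: of_rat_add)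
    qed
    show "\<not> \<phi> x + \<phi> y < \<phi> (x + y)"
    proof
      assume "\<phi> x + \<phi> y < \<phi> (x + y)"
      hence "\<phi> x < \<phi> (x + y) - \<phi> y" by simp
      then obtain q where q: "\<phi> x < of_rat q" "of_rat q < \<phi> (x + y) - \<phi> y" using of_rat_dense by blast
      hence "\<phi> y < \<phi> (x + y) - of_rat q" by simp
      then obtain r where r: "\<phi> y < of_rat r" "of_rat r < \<phi> (x + y) - of_rat q" using of_rat_dense by blast
      have "of_rat (q + r) - (x + y) \<in> T"
        using add[OF up'[OF q(1)] up'[OF r(1)]] by (simp add: of_rat_add algebra_simps)
      from up[OF this] show False using r(2) by (simp add: of_rat_add)
    qed
  qed
  have zero: "\<phi> 0 = 0" using plus[of 0 0] by simp
  have minus: "\<phi> (- x) = - \<phi> x" for x using plus[of x "- x"] zero by simp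
  have one: "\<phi> 1 = 1"
    using low[of 1 1] up[of 1 1] 01 by simp
  \<comment> \<open>Multiplicativity follows by polarisation from squares, where signs cause no trouble.\<close>
  have square_pos: "\<phi> (x * x) = \<phi> x * \<phi> x" if "x \<in> T" for x
  proof -
    have nonneg: "\<phi> x \<ge> 0" "\<phi> (x * x) \<ge> 0" using low[of x 0] low[of "x * x" 0] that sq[of x] by auto
    have "\<not> sqrt (\<phi> (x * x)) < \<phi> x"
    proof
      assume "sqrt (\<phi> (x * x)) < \<phi> x"
      then obtain q where q: "sqrt (\<phi> (x * x)) < of_rat q" "of_rat q < \<phi> x" using of_rat_dense by blast
      have "0 < real_of_rat q" using q(1) nonneg by (meson le_less_trans real_sqrt_ge_zero)
      hence "of_rat q \<in> T" by (intro rat_pos) simp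
      hence "(x - of_rat q) * (x + of_rat q) \<in> T" by (intro mult add low'[OF q(2)] that)
      hence "x * x - of_rat (q * q) \<in> T" by (simp add: algebra_simps of_rat_mult)
      from low[OF this] have "real_of_rat q \<le> sqrt (\<phi> (x * x))"
        by (intro real_le_rsqrt) (simp add: of_rat_mult power2_eq_square)
      thus False using q(1) by simp
    qed
    moreover have "\<not> \<phi> x < sqrt (\<phi> (x * x))"
    proof
      assume "\<phi> x < sqrt (\<phi> (x * x))"
      then obtain q where q: "\<phi> x < of_rat q" "of_rat q < sqrt (\<phi> (x * x))" using of_rat_dense by blast
      have "0 < real_of_rat q" using q(1) nonneg by linarith
      hence pos: "q > 0" by simp
      hence "of_rat q \<in> T" by (intro rat_pos) simp
      hence "(of_rat q - x) * (of_rat q + x) \<in> T" by (intro mult add up'[OF q(1)] that)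
      hence "of_rat (q * q) - x * x \<in> T" by (simp add: algebra_simps of_rat_mult)
      from up[OF this] have "sqrt (\<phi> (x * x)) \<le> real_of_rat q"
        using pos by (intro real_le_lsqrt nonneg) (simp_all add: of_rat_mult power2_eq_square)
      thus False using q(2) by simp
    qed
    ultimately have "\<phi> x = sqrt (\<phi> (x * x))" by simp
    thus ?thesis using nonneg(2) by (metis real_sqrt_mult_self abs_of_nonneg)
  qed
  have square: "\<phi> (x * x) = \<phi> x * \<phi> x" for x
    using total[of x] square_pos[of x] square_pos[of "- x"] minus by auto
  have times: "\<phi> (x * y) = \<phi> x * \<phi> y" for x y
  proof -
    have "(\<phi> x + \<phi> y) * (\<phi> x + \<phi> y) = \<phi> (x * x + y * y + (x * y + x * y))"
      unfolding plus[symmetric] square[symmetric] by (simp add: algebra_simps)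
    also have "\<dots> = \<phi> x * \<phi> x + \<phi> y * \<phi> y + 2 * \<phi> (x * y)"
      by (simp only: plus square mult_2)
    finally show ?thesis by (simp add: algebra_simps)
  qed
  show ?thesis by (rule that[of \<phi>]) (auto simp: field_embedding_def one plus times)
qed

text \<open>
  Otherwise \<open>- 1\<close> would not be a sum of squares, the sums of squares would be a preordering, and a
  maximal preordering above it would give a real embedding.
\<close>

theorem totally_imaginary_sum_squares_eq_0:
  assumes "number_field TYPE('k::field_char_0)" "totally_imaginary TYPE('k)"
  obtains as :: "'k::field_char_0 list" where "1 \<in> set as" "(\<Sum>a\<leftarrow>as. a\<^sup>2) = 0"
proof -
  define T0 where "T0 = {\<Sum>x\<leftarrow>xs. x\<^sup>2 | xs :: 'k list. True}"
  have "- 1 \<in> T0"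
  proof (rule ccontr)
    assume m1: "- 1 \<notin> T0"
    have sq: "x\<^sup>2 \<in> T0" for x :: 'k
      unfolding T0_def by (intro CollectI exI[of _ "[x]"]) simp
    have add: "x + y \<in> T0" if xy: "x \<in> T0" "y \<in> T0" for x y
    proof -
      obtain xs ys where "x = (\<Sum>x\<leftarrow>xs. x\<^sup>2)" "y = (\<Sum>x\<leftarrow>ys. x\<^sup>2)" using xy by (auto simp: T0_def)
      thus ?thesis unfolding T0_def by (intro CollectI exI[of _ "xs @ ys"]) simp
    qed
    have zero: "0 \<in> T0" using sq[of 0] by simp
    have scale: "a\<^sup>2 * y \<in> T0" if y: "y \<in> T0" for a y
    proof -
      obtain ys where "y = (\<Sum>x\<leftarrow>ys. x\<^sup>2)" using y by (auto simp: T0_def)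
      thus ?thesis unfolding T0_def
        by (intro CollectI exI[of _ "map ((*) a) ys"])
           (simp add: comp_def power_mult_distrib sum_list_const_mult)
    qed
    have mult: "x * y \<in> T0" if xy: "x \<in> T0" "y \<in> T0" for x y
    proof -
      obtain xs where x: "x = (\<Sum>x\<leftarrow>xs. x\<^sup>2)" using xy by (auto simp: T0_def)
      have "(\<Sum>x\<leftarrow>xs. x\<^sup>2) * y \<in> T0"
        by (induction xs) (auto simp: zero distrib_right intro: add scale xy)
      thus ?thesis using x by simp
    qed
    have "preordering T0"
      using m1 sq add mult by (auto simp: preordering_def power2_eq_square)
    from preordering_maximal[OF this] obtain T
      where "T0 \<subseteq> T" and T: "preordering T" "\<And>T'. preordering T' \<Longrightarrow> T \<subseteq> T' \<Longrightarrow> T' = T" by blast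
    have total: "x \<in> T \<or> - x \<in> T" for x by (rule preordering_maximal_total[OF T])
    have arch: "\<exists>N::nat. of_nat N - x \<in> T" for x
      by (rule preordering_archimedean[OF T(1) total number_field_algebraic[OF assms(1)]])
    obtain \<phi> :: "'k \<Rightarrow> real" where "field_embedding \<phi>"
      by (rule real_embedding_of_ordering[OF T(1) total arch])
    hence "field_embedding (complex_of_real \<circ> \<phi>)" by (simp add: field_embedding_def)
    moreover have "range (complex_of_real \<circ> \<phi>) \<subseteq> \<real>" by auto
    ultimately show False using assms(2) unfolding totally_imaginary_def by blast
  qed
  then obtain xs :: "'k list" where "(\<Sum>x\<leftarrow>xs. x\<^sup>2) = - 1" by (auto simp: T0_def)
  thus ?thesis by (intro that[of "1 # xs"]) auto
qed


section \<open>Forms that vanish on the intersections of two conjugate hyperplanes\<close>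

text \<open>
  A line through \<open>p\<close> in a general direction meets the kernels in as many distinct points as there are
  kernels. The form vanishes at these points, hence on the line, because their number exceeds its
  degree.
\<close>

lemma form_zero_off_kernels:
  fixes g :: "complex mpoly" and W :: "(nat \<Rightarrow> complex) set" and L :: "'i \<Rightarrow> (nat \<Rightarrow> complex) \<Rightarrow> complex"
  assumes g: "is_form n e g" and A: "finite A" "e < card A"
    and W: "\<And>x y c. x \<in> W \<Longrightarrow> y \<in> W \<Longrightarrow> (\<lambda>i. x i + c * y i) \<in> W"
    and lin: "\<And>a x y c. L a (\<lambda>i. x i + c * y i) = L a x + c * L a y"
    and nz: "\<And>a. a \<in> A \<Longrightarrow> \<exists>w\<in>W. L a w \<noteq> 0"
    and nonprop: "\<And>a b p. a \<in> A \<Longrightarrow> b \<in> A \<Longrightarrow> a \<noteq> b \<Longrightarrow> p \<in> W \<Longrightarrow> L a p \<noteq> 0 \<Longrightarrow>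
      \<exists>w\<in>W. L a p * L b w \<noteq> L b p * L a w"
    and vanish: "\<And>a x. a \<in> A \<Longrightarrow> x \<in> W \<Longrightarrow> L a x = 0 \<Longrightarrow> (\<forall>b\<in>A - {a}. L b x \<noteq> 0) \<Longrightarrow> eval_mpoly g x = 0"
    and p: "p \<in> W" "\<And>a. a \<in> A \<Longrightarrow> L a p \<noteq> 0"
  shows "eval_mpoly g p = 0"
proof -
  \<comment> \<open>The diagonal pairs ensure that the line meets every kernel, the other pairs that it meets them in
     distinct points.\<close>
  define K where "K = (\<lambda>(a, b) w. if a = b then L a w else L a p * L b w - L b p * L a w)"
  have add: "L a (x + y) = L a x + L a y" for a x y
    using lin[of a x 1 y] by (simp add: plus_fun_def)
  have "\<exists>q\<in>W. \<forall>ab\<in>A \<times> A. K ab q \<noteq> 0"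
  proof (rule avoid_kernels)
    show "finite (A \<times> A)" using A by simp
    show "0 \<in> W" using W[OF p(1) p(1), of "-1"] by (simp add: zero_fun_def)
    show "x + y \<in> W" if "x \<in> W" "y \<in> W" for x y
      using W[OF that, of 1] by (simp add: plus_fun_def)
    show "K ab (x + y) = K ab x + K ab y" if "ab \<in> A \<times> A" for ab x y
      by (cases ab) (simp add: K_def add algebra_simps)
    show "\<exists>w\<in>W. K ab w \<noteq> 0" if ab: "ab \<in> A \<times> A" for ab
    proof -
      obtain a b where [simp]: "ab = (a, b)" by (cases ab)
      show ?thesis
        using ab nz[of a] nonprop[of a b p] p by (cases "a = b") (auto simp: K_def)
    qed
  qed
  then obtain q where q: "q \<in> W" "\<And>a b. a \<in> A \<Longrightarrow> b \<in> A \<Longrightarrow> K (a, b) q \<noteq> 0" by auto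
  have La: "L a q \<noteq> 0" if "a \<in> A" for a using q(2)[of a a] that by (simp add: K_def)
  have Lab: "L a p * L b q \<noteq> L b p * L a q" if "a \<in> A" "b \<in> A" "a \<noteq> b" for a b
    using q(2)[of a b] that by (simp add: K_def)
  define t where "t a = - L a p / L a q" for a
  obtain u where u: "degree u \<le> e" "\<And>s. poly u s = eval_mpoly g (\<lambda>i. p i + s * q i)"
    using eval_form_on_line[OF g] by metis
  have "poly u (t a) = 0" if a: "a \<in> A" for a
    unfolding u(2)
  proof (rule vanish[OF a])
    show "(\<lambda>i. p i + t a * q i) \<in> W" by (rule W[OF p(1) q(1)])
    show "L a (\<lambda>i. p i + t a * q i) = 0" unfolding lin using La[OF a] by (simp add: t_def)
    show "\<forall>b\<in>A - {a}. L b (\<lambda>i. p i + t a * q i) \<noteq> 0"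
    proof
      fix b assume b: "b \<in> A - {a}"
      have "L b p + t a * L b q = (L a q * L b p - L a p * L b q) / L a q"
        using La[OF a] by (simp add: t_def field_simps)
      thus "L b (\<lambda>i. p i + t a * q i) \<noteq> 0"
        unfolding lin using La[OF a] Lab[OF a, of b] b by (auto simp: mult.commute)
    qed
  qed
  moreover have "inj_on t A"
  proof (rule inj_onI, rule ccontr)
    fix a b assume *: "a \<in> A" "b \<in> A" "t a = t b" "a \<noteq> b"
    thus False using La[of a] La[of b] Lab[of a b] by (simp add: t_def field_simps)
  qed
  ultimately have "u = 0"
    using card_roots_le_degree[of u "t ` A"] A(2) u(1) by (fastforce simp: card_image)
  thus ?thesis using u(2)[of 0] by simp
qed

text \<open>
  The coordinates are freed from being rational one at a time.
\<close>

lemma zero_on_rationals_imp_zero: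
  fixes G :: "(nat \<Rightarrow> complex) \<Rightarrow> complex"
  assumes poly: "\<And>v k. \<exists>u. \<forall>t. G (v(k := t)) = poly u t"
    and rat: "\<And>v. (\<forall>k. v k \<in> \<rat>) \<Longrightarrow> (\<forall>k>n. v k = 0) \<Longrightarrow> G v = 0"
    and v: "\<forall>k>n. v k = 0"
  shows "G v = 0"
proof -
  have "(\<forall>k\<ge>m. v k \<in> \<rat>) \<Longrightarrow> (\<forall>k>n. v k = 0) \<Longrightarrow> G v = 0" for m v
  proof (induction m arbitrary: v)
    case 0
    thus ?case using rat by auto
  next
    case (Suc m)
    show ?case
    proof (cases "m > n")
      case True
      thus ?thesis using Suc.prems by (intro Suc.IH) auto
    next
      case False
      obtain u where u: "\<And>t. G (v(m := t)) = poly u t" using poly by blast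
      have "poly u q = 0" if "q \<in> \<rat>" for q
      proof -
        have "G (v(m := q)) = 0"
        proof (rule Suc.IH)
          show "\<forall>k\<ge>m. (v(m := q)) k \<in> \<rat>" using that Suc.prems(1)
            by (metis Suc_leI fun_upd_apply le_neq_implies_less)
          show "\<forall>k>n. (v(m := q)) k = 0" using False Suc.prems(2) by simp
        qed
        thus ?thesis by (simp add: u)
      qed
      moreover have "infinite (\<rat> :: complex set)"
      proof
        assume "finite (\<rat> :: complex set)"
        hence "finite (range (of_nat :: nat \<Rightarrow> complex))" by (rule rev_finite_subset) auto
        thus False by (simp add: finite_image_iff inj_on_def)
      qed
      ultimately have "u = 0"
        by (metis (mono_tags, lifting) mem_Collect_eq poly_roots_finite rev_finite_subset subsetI)
      thus ?thesis using u[of "v m"] by simp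
    qed
  qed
  from this[of "Suc n"] v show ?thesis by auto
qed

lemma cnj_eval_rational:
  "cnj (eval_mpoly (complexify g) v) = eval_mpoly (complexify g) (\<lambda>i. cnj (v i))"
proof -
  have "cnj \<circ> of_rat = of_rat"
    using field_embedding_of_rat_apply[OF field_embedding_cnj] by auto
  thus ?thesis
    by (simp add: conjugate_poly_compose flip: eval_conjugate_poly[OF field_embedding_cnj])
qed

lemma real_squares_sum_0:
  assumes "(\<Sum>x\<leftarrow>xs. x\<^sup>2) = (0 :: complex)" "\<And>x. x \<in> set xs \<Longrightarrow> x \<in> \<real>" "x \<in> set xs"
  shows "x = 0"
proof -
  have sq: "x\<^sup>2 = of_real ((Re x)\<^sup>2)" if "x \<in> \<real>" for x :: complex
    using that by (metis of_real_Re of_real_power)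
  have "(\<Sum>x\<leftarrow>xs. x\<^sup>2) = of_real (\<Sum>x\<leftarrow>xs. (Re x)\<^sup>2)"
    using assms(2)
  proof (induction xs)
    case (Cons x xs)
    thus ?case using sq[of x] by simp
  qed simp
  hence "complex_of_real (\<Sum>x\<leftarrow>xs. (Re x)\<^sup>2) = 0" using assms(1) by metis
  hence "(\<Sum>x\<leftarrow>xs. (Re x)\<^sup>2) = 0" by (simp only: of_real_eq_0_iff)
  hence "(Re x)\<^sup>2 = 0" using assms(3) by (subst (asm) sum_list_nonneg_eq_0_iff) auto
  thus ?thesis using assms(2,3) by (auto simp: complex_is_Real_iff complex_eq_iff)
qed

lemma Gal_ring_hom_on:
  assumes "\<sigma> \<in> Gal_Qbar"
  shows "ring_hom_on Qbar \<sigma>" "\<sigma> (of_rat q) = of_rat q"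
proof -
  have bij: "bij_betw \<sigma> Qbar Qbar"
    and hom: "\<And>x y. x \<in> Qbar \<Longrightarrow> y \<in> Qbar \<Longrightarrow> \<sigma> (x + y) = \<sigma> x + \<sigma> y \<and> \<sigma> (x * y) = \<sigma> x * \<sigma> y"
    using assms by (auto simp: Gal_Qbar_def)
  have 01: "0 \<in> Qbar" "1 \<in> Qbar" by (simp_all add: Qbar_def)
  have "\<sigma> 0 = 0" using hom[OF 01(1) 01(1)] by simp
  hence "\<sigma> 1 \<noteq> 0" using bij 01 by (metis bij_betw_imp_inj_on inj_onD zero_neq_one)
  hence one: "\<sigma> 1 = 1" using hom[OF 01(2) 01(2)] by simp
  show "ring_hom_on Qbar \<sigma>" using one hom by (simp add: ring_hom_on_def)
  have Q: "of_rat r \<in> Qbar" for r by (simp add: Qbar_def rat_imp_algebraic)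
  have "field_embedding (\<sigma> \<circ> of_rat)"
    using one hom Q by (simp add: field_embedding_def of_rat_add of_rat_mult)
  from field_embedding_of_rat_apply[OF this, of q] show "\<sigma> (of_rat q) = of_rat q" by simp
qed

lemma cnj_comp_in_Embs:
  assumes "number_field TYPE('k::field_char_0)" "\<phi> \<in> Embs"
  shows "cnj \<circ> \<phi> \<in> (Embs :: ('k \<Rightarrow> complex) set)"
  using assms(2) by (simp add: Embs_eq[OF assms(1)] field_embedding_comp)

lemma cnj_comp_neq_of_totally_imaginary:
  fixes \<phi> :: "'k::field_char_0 \<Rightarrow> complex"
  assumes "totally_imaginary TYPE('k)" "\<phi> \<in> Embs"
  shows "cnj \<circ> \<phi> \<noteq> \<phi>"
proof
  assume eq: "cnj \<circ> \<phi> = \<phi>"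
  have "\<phi> x \<in> \<real>" for x using fun_cong[OF eq, of x] by (simp add: Reals_cnj_iff)
  thus False using assms unfolding totally_imaginary_def Embs_def by blast
qed

context
  fixes n d :: nat and l :: "'k::field_char_0 mpoly"
  assumes n: "n \<ge> 2" and nf: "number_field TYPE('k)" and degree: "field_degree TYPE('k) = d"
    and imag: "totally_imaginary TYPE('k)" and trans: "galois_two_transitive TYPE('k)"
    and form: "is_form n 1 l" and gp: "conjugates_in_general_position n l"
begin

abbreviation (input) conj_val :: "('k \<Rightarrow> complex) \<Rightarrow> (nat \<Rightarrow> complex) \<Rightarrow> complex" where
  "conj_val \<phi> v \<equiv> eval_mpoly (conjugate_poly \<phi> l) v"

definition conj_cone :: "('k \<Rightarrow> complex) set \<Rightarrow> (nat \<Rightarrow> complex) set" where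
  "conj_cone T = cone_of n ((\<lambda>\<phi>. conjugate_poly \<phi> l) ` T)"

abbreviation (input) conj_coeff :: "('k \<Rightarrow> complex) \<Rightarrow> nat \<Rightarrow> complex" where
  "conj_coeff \<phi> i \<equiv> \<phi> (lookup l (single i 1))"

lemma Embs_embedding: "\<phi> \<in> Embs \<Longrightarrow> field_embedding \<phi>"
  by (simp add: Embs_def)

lemma conj_val_eq:
  assumes "\<phi> \<in> Embs"
  shows "conj_val \<phi> v = (\<Sum>i\<le>n. conj_coeff \<phi> i * v i)"
  using eval_linear_form[OF is_form_conjugate[OF form], of \<phi> v]
    lookup_conjugate_poly[of \<phi>, OF field_embedding_0[OF Embs_embedding[OF assms]], of l] by simp

lemma conj_val_linear: "conj_val \<phi> (\<lambda>i. x i + c * y i) = conj_val \<phi> x + c * conj_val \<phi> y"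
  unfolding eval_linear_form[OF is_form_conjugate[OF form]]
  by (simp add: algebra_simps sum.distrib sum_distrib_left)

lemma conj_cone_iff: "v \<in> conj_cone T \<longleftrightarrow> (\<forall>i>n. v i = 0) \<and> (\<forall>\<phi>\<in>T. conj_val \<phi> v = 0)"
  by (auto simp: conj_cone_def cone_of_def)

lemma conj_cone_linear: "x \<in> conj_cone T \<Longrightarrow> y \<in> conj_cone T \<Longrightarrow> (\<lambda>i. x i + c * y i) \<in> conj_cone T"
  unfolding conj_cone_iff by (simp add: conj_val_linear)

text \<open>
  Otherwise the hyperplane of \<open>\<phi>\<close> would contain the intersection of the others, whereas general
  position says that intersecting with it raises the codimension.
\<close>

lemma conj_val_nonzero_on_conj_cone:
  assumes T: "T \<subseteq> Embs" "card T \<le> 2" "\<phi> \<in> Embs" "\<phi> \<notin> T"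
  shows "\<exists>w\<in>conj_cone T. conj_val \<phi> w \<noteq> 0"
proof (rule ccontr)
  assume "\<not> ?thesis"
  hence eq: "conj_cone (insert \<phi> T) = conj_cone T" by (auto simp: conj_cone_iff)
  have fin: "finite T" using T(1) finite_Embs[OF nf] finite_subset by blast
  have codim: "proj_codim n (conj_cone S) = card S" if "S \<subseteq> Embs" "finite S" "card S \<le> n + 1" for S
    using gp that by (simp add: conjugates_in_general_position_def conj_cone_def)
  have "proj_codim n (conj_cone T) = card T" using T fin n by (intro codim) auto
  moreover have "proj_codim n (conj_cone (insert \<phi> T)) = card (insert \<phi> T)"
    using T fin n by (intro codim) auto
  ultimately show False using eq T fin by simp
qed

text \<open>
  Proportional functionals have the same kernel, but \<open>\<psi>\<close> does not vanish on all of the kernel of \<open>\<phi>\<close>.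
\<close>

lemma conj_cone_not_proportional:
  assumes "T \<subseteq> Embs" "card T \<le> 1" "\<phi> \<in> Embs - T" "\<psi> \<in> Embs - T" "\<phi> \<noteq> \<psi>" and p: "conj_val \<phi> p \<noteq> 0"
  shows "\<exists>w\<in>conj_cone T. conj_val \<phi> p * conj_val \<psi> w \<noteq> conj_val \<psi> p * conj_val \<phi> w"
proof -
  have "finite T" using assms(1) finite_Embs[OF nf] finite_subset by blast
  hence "card (insert \<phi> T) \<le> 2" using assms(2,3) by auto
  then obtain w where w: "w \<in> conj_cone (insert \<phi> T)" "conj_val \<psi> w \<noteq> 0"
    using conj_val_nonzero_on_conj_cone[of "insert \<phi> T" \<psi>] assms by auto
  hence "w \<in> conj_cone T" "conj_val \<phi> w = 0" by (auto simp: conj_cone_iff)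
  with w(2) p show ?thesis by (intro bexI[of _ w]) auto
qed

text \<open>
  First a hyperplane is filled from the codimension-two spaces in it, then the whole space is filled
  from the hyperplanes.
\<close>

lemma low_degree_form_vanishes:
  assumes g: "is_form n e g" "e + 1 < d"
    and vanish: "\<And>\<phi> \<psi> x. \<phi> \<in> Embs \<Longrightarrow> \<psi> \<in> Embs \<Longrightarrow> \<phi> \<noteq> \<psi> \<Longrightarrow> x \<in> conj_cone {\<phi>, \<psi>} \<Longrightarrow> eval_mpoly g x = 0"
    and r: "\<forall>i>n. r i = 0" "\<And>\<phi>. \<phi> \<in> Embs \<Longrightarrow> conj_val \<phi> r \<noteq> 0"
  shows "eval_mpoly g r = 0"
proof -
  let ?E = "Embs :: ('k \<Rightarrow> complex) set"
  note fin = finite_Embs[OF nf]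
  have card: "card ?E = d" using card_Embs[OF nf] degree by simp
  have hyperplane: "eval_mpoly g x = 0"
    if \<phi>: "\<phi> \<in> ?E" and x: "x \<in> conj_cone {\<phi>}" "\<And>\<psi>. \<psi> \<in> ?E - {\<phi>} \<Longrightarrow> conj_val \<psi> x \<noteq> 0" for \<phi> x
  proof (rule form_zero_off_kernels[where A = "?E - {\<phi>}" and W = "conj_cone {\<phi>}" and L = conj_val])
    show "e < card (?E - {\<phi>})" using g(2) fin \<phi> card by simp
    show "\<exists>w\<in>conj_cone {\<phi>}. conj_val \<psi> w \<noteq> 0" if "\<psi> \<in> ?E - {\<phi>}" for \<psi>
      using conj_val_nonzero_on_conj_cone[of "{\<phi>}" \<psi>] \<phi> that by auto
    show "\<exists>w\<in>conj_cone {\<phi>}. conj_val \<psi> p * conj_val \<chi> w \<noteq> conj_val \<chi> p * conj_val \<psi> w"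
      if "\<psi> \<in> ?E - {\<phi>}" "\<chi> \<in> ?E - {\<phi>}" "\<psi> \<noteq> \<chi>" "conj_val \<psi> p \<noteq> 0" for \<psi> \<chi> p
      using conj_cone_not_proportional[of "{\<phi>}" \<psi> \<chi> p] \<phi> that by auto
    show "eval_mpoly g y = 0" if "\<psi> \<in> ?E - {\<phi>}" "y \<in> conj_cone {\<phi>}" "conj_val \<psi> y = 0" for \<psi> y
      using vanish[of \<phi> \<psi> y] that \<phi> by (auto simp: conj_cone_iff)
  qed (use g fin x in \<open>auto intro: conj_cone_linear conj_val_linear\<close>)
  show ?thesis
  proof (rule form_zero_off_kernels[where A = ?E and W = "conj_cone {}" and L = conj_val])
    show "e < card ?E" using g(2) card by simp
    show "\<exists>w\<in>conj_cone {}. conj_val \<psi> w \<noteq> 0" if "\<psi> \<in> ?E" for \<psi>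
      using conj_val_nonzero_on_conj_cone[of "{}" \<psi>] that by auto
    show "\<exists>w\<in>conj_cone {}. conj_val \<psi> p * conj_val \<chi> w \<noteq> conj_val \<chi> p * conj_val \<psi> w"
      if "\<psi> \<in> ?E" "\<chi> \<in> ?E" "\<psi> \<noteq> \<chi>" "conj_val \<psi> p \<noteq> 0" for \<psi> \<chi> p
      using conj_cone_not_proportional[of "{}" \<psi> \<chi> p] that by auto
    show "eval_mpoly g y = 0"
      if "\<psi> \<in> ?E" "y \<in> conj_cone {}" "conj_val \<psi> y = 0" "\<forall>b\<in>?E - {\<psi>}. conj_val b y \<noteq> 0" for \<psi> y
      using hyperplane[of \<psi> y] that by (auto simp: conj_cone_iff)
  qed (use g fin r in \<open>auto simp: conj_cone_iff intro: conj_cone_linear conj_val_linear\<close>)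
qed


subsection \<open>Moving zeros by the Galois group\<close>

text \<open>
  By Cramer's rule, \<open>cramer i j \<phi> \<psi>\<close> maps the whole space to the intersection of the two conjugate
  hyperplanes, and it is multiplication by a minor on this intersection. Its coefficients depend
  on \<open>\<phi>\<close> and \<open>\<psi>\<close> in a uniform way.
\<close>

definition minor :: "nat \<Rightarrow> nat \<Rightarrow> ('k \<Rightarrow> complex) \<Rightarrow> ('k \<Rightarrow> complex) \<Rightarrow> complex" where
  "minor i j \<phi> \<psi> = conj_coeff \<phi> i * conj_coeff \<psi> j - conj_coeff \<phi> j * conj_coeff \<psi> i"

definition cramer :: "nat \<Rightarrow> nat \<Rightarrow> ('k \<Rightarrow> complex) \<Rightarrow> ('k \<Rightarrow> complex) \<Rightarrow> (nat \<Rightarrow> complex) \<Rightarrow> nat \<Rightarrow> complex" where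
  "cramer i j \<phi> \<psi> v k = minor i j \<phi> \<psi> * v k
     - (if k = i then conj_val \<phi> v * conj_coeff \<psi> j - conj_val \<psi> v * conj_coeff \<phi> j else 0)
     - (if k = j then conj_val \<psi> v * conj_coeff \<phi> i - conj_val \<phi> v * conj_coeff \<psi> i else 0)"

lemma cramer_linear: "cramer i j \<phi> \<psi> (\<lambda>i. x i + c * y i) k = cramer i j \<phi> \<psi> x k + c * cramer i j \<phi> \<psi> y k"
  by (simp add: cramer_def conj_val_linear algebra_simps)

lemma cramer_swap: "cramer i j \<psi> \<phi> v k = - cramer i j \<phi> \<psi> v k"
  by (simp add: cramer_def minor_def algebra_simps)

lemma cramer_in_kernel:
  assumes "\<phi> \<in> Embs" "\<psi> \<in> Embs" "i \<le> n" "j \<le> n"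
  shows "conj_val \<phi> (cramer i j \<phi> \<psi> v) = 0"
proof -
  have "conj_val \<phi> (cramer i j \<phi> \<psi> v) = minor i j \<phi> \<psi> * conj_val \<phi> v
     - conj_coeff \<phi> i * (conj_val \<phi> v * conj_coeff \<psi> j - conj_val \<psi> v * conj_coeff \<phi> j)
     - conj_coeff \<phi> j * (conj_val \<psi> v * conj_coeff \<phi> i - conj_val \<phi> v * conj_coeff \<psi> i)"
    unfolding conj_val_eq[OF assms(1), of "cramer i j \<phi> \<psi> v"] cramer_def right_diff_distrib
      sum_subtractf if_distrib[of "(*) _"] mult_zero_right
    using assms by (simp add: sum.delta conj_val_eq[OF assms(1), of v] sum_distrib_left algebra_simps)
  thus ?thesis by (simp add: minor_def algebra_simps)
qed

lemma cramer_on_kernel: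
  assumes "conj_val \<phi> v = 0" "conj_val \<psi> v = 0"
  shows "cramer i j \<phi> \<psi> v k = minor i j \<phi> \<psi> * v k"
  using assms by (simp add: cramer_def)

text \<open>
  If all minors are zero, then a point in the kernel of \<open>\<psi>\<close> but not of \<open>\<phi>\<close> shows that the
  coefficients at \<open>\<psi>\<close> are zero.
\<close>

lemma minor_exists:
  assumes "\<phi> \<in> Embs" "\<psi> \<in> Embs" "\<phi> \<noteq> \<psi>"
  shows "\<exists>i\<le>n. \<exists>j\<le>n. minor i j \<phi> \<psi> \<noteq> 0"
proof (rule ccontr)
  assume "\<not> ?thesis"
  hence zero: "minor i j \<phi> \<psi> = 0" if "i \<le> n" "j \<le> n" for i j using that by blast
  obtain w where w: "conj_val \<phi> w \<noteq> 0" "conj_val \<psi> w = 0"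
    using conj_val_nonzero_on_conj_cone[of "{\<psi>}" \<phi>] assms by (auto simp: conj_cone_iff)
  have "conj_coeff \<psi> j = 0" if j: "j \<le> n" for j
  proof -
    have "conj_val \<phi> w * conj_coeff \<psi> j = (\<Sum>i\<le>n. conj_coeff \<phi> i * conj_coeff \<psi> j * w i)"
      unfolding conj_val_eq[OF assms(1)] sum_distrib_right by (simp add: mult_ac)
    also have "\<dots> = (\<Sum>i\<le>n. conj_coeff \<phi> j * conj_coeff \<psi> i * w i)"
      using zero j by (intro sum.cong) (auto simp: minor_def)
    also have "\<dots> = conj_coeff \<phi> j * conj_val \<psi> w"
      unfolding conj_val_eq[OF assms(2)] sum_distrib_left by (simp add: mult_ac)
    finally show ?thesis using w by simp
  qed
  hence "conj_val \<psi> v = 0" for v unfolding conj_val_eq[OF assms(2)] by simp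
  thus False using conj_val_nonzero_on_conj_cone[of "{}" \<psi>] assms by auto
qed

lemma cramer_hom:
  assumes \<sigma>: "ring_hom_on F \<sigma>" "subring_of F" and F: "range \<phi> \<subseteq> F" "range \<psi> \<subseteq> F" "\<And>k. v k \<in> F" "\<And>k. \<sigma> (v k) = v k"
    and emb: "\<phi> \<in> Embs" "\<psi> \<in> Embs" "\<sigma> \<circ> \<phi> \<in> Embs" "\<sigma> \<circ> \<psi> \<in> Embs"
  shows "cramer i j \<phi> \<psi> v k \<in> F" and "\<sigma> (cramer i j \<phi> \<psi> v k) = cramer i j (\<sigma> \<circ> \<phi>) (\<sigma> \<circ> \<psi>) v k"
proof -
  have cF: "\<phi> x \<in> F" "\<psi> x \<in> F" for x using F by auto
  note [simp] = subring_of_add[OF \<sigma>(2)] subring_of_mult[OF \<sigma>(2)] subring_of_diff[OF \<sigma>(2)]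
    subring_of_0[OF \<sigma>(2)] subring_of_sum[OF \<sigma>(2)] cF F(3,4)
    ring_hom_on_add[OF \<sigma>(2,1)] ring_hom_on_mult[OF \<sigma>(2,1)] ring_hom_on_diff[OF \<sigma>(2,1)]
    ring_hom_on_0[OF \<sigma>(2,1)] ring_hom_on_sum[OF \<sigma>(2,1)]
  have val: "conj_val \<phi> v \<in> F" "conj_val \<psi> v \<in> F"
    "\<sigma> (conj_val \<phi> v) = conj_val (\<sigma> \<circ> \<phi>) v" "\<sigma> (conj_val \<psi> v) = conj_val (\<sigma> \<circ> \<psi>) v"
    using emb by (simp_all add: conj_val_eq)
  show "cramer i j \<phi> \<psi> v k \<in> F" "\<sigma> (cramer i j \<phi> \<psi> v k) = cramer i j (\<sigma> \<circ> \<phi>) (\<sigma> \<circ> \<psi>) v k"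
    using val by (auto simp: cramer_def minor_def)
qed

context
  fixes h :: "rat mpoly" and gs :: "rat mpoly list"
  assumes gs: "\<And>g. g \<in> set gs \<Longrightarrow> \<exists>e. is_form n e g" and eq: "norm_poly l * h = (\<Sum>g\<leftarrow>gs. g\<^sup>2)"
begin

text \<open>
  The intersection of a hyperplane with its complex conjugate is defined over the reals, so that a
  sum of squares can only vanish there if all the squares do.
\<close>

lemma squares_vanish_at_conjugate_pair:
  assumes g: "g \<in> set gs" and \<phi>: "\<phi> \<in> Embs" and v: "\<And>k. v k \<in> \<rat>" and ij: "i \<le> n" "j \<le> n"
  shows "eval_mpoly (complexify g) (cramer i j \<phi> (cnj \<circ> \<phi>) v) = 0"
proof -
  define x where "x = cramer i j \<phi> (cnj \<circ> \<phi>) v"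
  define y where "y k = \<i> * x k" for k
  have cnj_v: "cnj (v k) = v k" for k
    using v[of k] field_embedding_of_rat_apply[OF field_embedding_cnj] by (auto simp: Rats_def)
  have cc: "cnj \<circ> (cnj \<circ> \<phi>) = \<phi>" by auto
  have hom: "ring_hom_on UNIV cnj" by (simp flip: field_embedding_iff_ring_hom_on)
  have "cnj (x k) = cramer i j (cnj \<circ> \<phi>) (cnj \<circ> (cnj \<circ> \<phi>)) v k" for k
    unfolding x_def
    by (rule cramer_hom(2)[OF hom subring_of_UNIV subset_UNIV subset_UNIV UNIV_I cnj_v \<phi>
          cnj_comp_in_Embs[OF nf \<phi>] cnj_comp_in_Embs[OF nf \<phi>] cnj_comp_in_Embs[OF nf cnj_comp_in_Embs[OF nf \<phi>]]])
  \<comment> \<open>Conjugation swaps the two embeddings, so \<open>x\<close> is purely imaginary.\<close>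
  hence cnj_x: "cnj (x k) = - x k" for k unfolding cc x_def by (simp only: cramer_swap[of i j "cnj \<circ> \<phi>" \<phi>])
  have real: "cnj (y k) = y k" for k by (simp add: y_def cnj_x)
  have "conj_val \<phi> y = \<i> * conj_val \<phi> x"
    unfolding y_def using conj_val_linear[of \<phi> "\<lambda>_. 0" \<i> x] eval_form_scale[OF is_form_conjugate[OF form], of \<phi> 0 "\<lambda>_. 0"]
    by simp
  also have "conj_val \<phi> x = 0"
    unfolding x_def using \<phi> ij by (intro cramer_in_kernel cnj_comp_in_Embs nf)
  finally have \<phi>y: "conj_val \<phi> y = 0" by simp
  have "eval_mpoly (complexify (norm_poly l)) y = 0"
    unfolding norm_poly_conjugate[OF nf] eval_mpoly_prod
    using \<phi>y \<phi> finite_Embs[OF nf] by (intro prod_zero) auto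
  hence "eval_mpoly (complexify (norm_poly l * h)) y = 0"
    by (simp add: conjugate_poly_mult' eval_mpoly_mult)
  hence "(\<Sum>g\<leftarrow>gs. (eval_mpoly (complexify g) y)\<^sup>2) = 0"
    unfolding eq by (simp add: conjugate_poly_sum_list eval_mpoly_sum_list conjugate_poly_power
      eval_mpoly_power comp_def)
  hence "(\<Sum>z\<leftarrow>map (\<lambda>g. eval_mpoly (complexify g) y) gs. z\<^sup>2) = 0"
    by (simp add: comp_def)
  moreover have val_real: "eval_mpoly (complexify g) y \<in> \<real>" for g
    using cnj_eval_rational[of g y] by (simp add: real Reals_cnj_iff)
  have "z \<in> \<real>" if "z \<in> set (map (\<lambda>g. eval_mpoly (complexify g) y) gs)" for z
    using that unfolding set_map by (elim imageE) (simp only: val_real)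
  moreover have "eval_mpoly (complexify g) y \<in> set (map (\<lambda>g. eval_mpoly (complexify g) y) gs)"
    using g unfolding set_map by (rule imageI)
  ultimately have "eval_mpoly (complexify g) y = 0" by (rule real_squares_sum_0)
  moreover obtain e where "is_form n e g" using gs g by blast
  hence "eval_mpoly (complexify g) y = \<i> ^ e * eval_mpoly (complexify g) x"
    unfolding y_def by (intro eval_form_scale is_form_conjugate)
  ultimately show ?thesis by (simp add: x_def)
qed

text \<open>
  An automorphism that fixes \<open>\<phi>\<close> and sends its complex conjugate to \<open>\<psi>\<close> carries the points produced by
  Cramer's rule from rational vectors for the one pair to those for the other. These points are dense
  enough to conclude for all points of the intersection.
\<close>

lemma squares_vanish_on_pairs:
  assumes g: "g \<in> set gs" and \<phi>: "\<phi> \<in> Embs" and \<psi>: "\<psi> \<in> Embs" and neq: "\<phi> \<noteq> \<psi>"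
    and x: "x \<in> conj_cone {\<phi>, \<psi>}"
  shows "eval_mpoly (complexify g) x = 0"
proof -
  let ?g = "complexify g :: complex mpoly"
  obtain i j where ij: "i \<le> n" "j \<le> n" "minor i j \<phi> \<psi> \<noteq> 0"
    using minor_exists[OF \<phi> \<psi> neq] by blast
  obtain e where "is_form n e g" using gs g by blast
  hence form: "is_form n e ?g" by (rule is_form_conjugate)
  have "\<exists>\<sigma>\<in>Gal_Qbar. \<sigma> \<circ> \<phi> = \<phi> \<and> \<sigma> \<circ> (cnj \<circ> \<phi>) = \<psi>"
    using trans[unfolded galois_two_transitive_def, THEN bspec, OF \<phi>, THEN bspec, OF cnj_comp_in_Embs[OF nf \<phi>],
      THEN bspec, OF \<phi>, THEN bspec, OF \<psi>] neq cnj_comp_neq_of_totally_imaginary[OF imag \<phi>]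
    by (auto simp del: o_apply)
  then obtain \<sigma> where \<sigma>: "\<sigma> \<in> Gal_Qbar" "\<sigma> \<circ> \<phi> = \<phi>" "\<sigma> \<circ> (cnj \<circ> \<phi>) = \<psi>" by blast
  note hom = Gal_ring_hom_on(1)[OF \<sigma>(1)]
  have rational: "eval_mpoly ?g (cramer i j \<phi> \<psi> v) = 0" if v: "\<forall>k. v k \<in> \<rat>" for v
  proof -
    let ?X = "cramer i j \<phi> (cnj \<circ> \<phi>) v"
    have Q: "of_rat r \<in> Qbar" for r by (simp add: Qbar_def rat_imp_algebraic)
    have vk: "v k \<in> Qbar" "\<sigma> (v k) = v k" for k
      using v Q Gal_ring_hom_on(2)[OF \<sigma>(1)] by (auto simp: Rats_def dest!: spec[of _ k])
    have range: "range \<phi> \<subseteq> Qbar" "range (cnj \<circ> \<phi>) \<subseteq> Qbar"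
      using \<phi> cnj_comp_in_Embs[OF nf \<phi>] by (auto simp: Embs_def)
    have emb: "\<sigma> \<circ> \<phi> \<in> Embs" "\<sigma> \<circ> (cnj \<circ> \<phi>) \<in> Embs" unfolding \<sigma> by (fact \<phi> \<psi>)+
    note X' = cramer_hom[OF hom subring_of_Qbar range vk \<phi> cnj_comp_in_Embs[OF nf \<phi>] emb, where i = i and j = j]
    have X: "?X k \<in> Qbar" "\<sigma> (?X k) = cramer i j \<phi> \<psi> v k" for k
      by (fact X'(1)) (fact X'(2)[unfolded \<sigma>])
    have "\<sigma> \<circ> of_rat = of_rat" using Gal_ring_hom_on(2)[OF \<sigma>(1)] by auto
    hence "eval_mpoly ?g (cramer i j \<phi> \<psi> v) = eval_mpoly (conjugate_poly \<sigma> ?g) (\<lambda>k. \<sigma> (?X k))"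
      using ring_hom_on_0[OF subring_of_Qbar hom] by (simp add: X conjugate_poly_compose)
    also have "\<dots> = \<sigma> (eval_mpoly ?g ?X)"
      by (rule eval_conjugate_poly_on[OF subring_of_Qbar hom]) (simp_all add: X lookup_conjugate_poly Q)
    also have "\<dots> = 0"
      using squares_vanish_at_conjugate_pair[OF g \<phi> _ ij(1,2)] v ring_hom_on_0[OF subring_of_Qbar hom] by simp
    finally show ?thesis .
  qed
  have all: "eval_mpoly ?g (cramer i j \<phi> \<psi> v) = 0" if v: "\<forall>k>n. v k = 0" for v
  proof (rule zero_on_rationals_imp_zero[of "\<lambda>v. eval_mpoly ?g (cramer i j \<phi> \<psi> v)", OF _ _ v])
    fix v :: "nat \<Rightarrow> complex" and k :: nat
    define b where "b m = (if m = k then 1 else 0 :: complex)" for m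
    have upd: "v(k := t) = (\<lambda>m. (v(k := 0)) m + t * b m)" for t by (auto simp: b_def)
    obtain u where "\<And>t. poly u t = eval_mpoly ?g (\<lambda>m. cramer i j \<phi> \<psi> (v(k := 0)) m + t * cramer i j \<phi> \<psi> b m)"
      using eval_form_on_line[OF form] by metis
    moreover have "cramer i j \<phi> \<psi> (v(k := t)) = (\<lambda>m. cramer i j \<phi> \<psi> (v(k := 0)) m + t * cramer i j \<phi> \<psi> b m)" for t
      unfolding upd[of t] by (intro ext) (rule cramer_linear)
    ultimately show "\<exists>u. \<forall>t. eval_mpoly ?g (cramer i j \<phi> \<psi> (v(k := t))) = poly u t" by metis
  qed (use rational in blast)
  define v where "v k = x k / minor i j \<phi> \<psi>" for k
  have x0: "\<forall>k>n. x k = 0" "conj_val \<phi> x = 0" "conj_val \<psi> x = 0" using x by (auto simp: conj_cone_iff)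
  have "cramer i j \<phi> \<psi> x = (\<lambda>k. minor i j \<phi> \<psi> * x k)"
    using cramer_on_kernel[OF x0(2,3)] by auto
  with all[OF x0(1)] have "minor i j \<phi> \<psi> ^ e * eval_mpoly ?g x = 0"
    by (simp add: eval_form_scale[OF form])
  thus ?thesis using ij(3) by simp
qed

end

lemma norm_poly_nonzero: "norm_poly l \<noteq> 0"
proof
  assume "norm_poly l = 0"
  with norm_poly_conjugate[OF nf, of l] obtain \<phi> where \<phi>: "\<phi> \<in> Embs" "conjugate_poly \<phi> l = 0"
    using finite_Embs[OF nf] by auto
  with conj_val_nonzero_on_conj_cone[of "{}" \<phi>] show False by simp
qed

lemma is_form_norm_poly: "is_form n d (norm_poly l)"
proof -
  have "is_form n (card (Embs :: ('k \<Rightarrow> complex) set)) (\<Prod>\<phi>\<in>Embs. conjugate_poly \<phi> l)"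
    by (intro is_form_prod is_form_conjugate form)
  thus ?thesis
    unfolding norm_poly_conjugate[OF nf, symmetric] is_form_conjugate_iff[OF field_embedding_of_rat]
    using card_Embs[OF nf] degree by simp
qed

text \<open>
  A monomial of the product occurs in the square of one of the forms. That form is nonzero and
  vanishes on all intersections of two conjugate hyperplanes, so its degree is at least \<open>d - 1\<close>.
\<close>

theorem multiplier_degree_ge:
  assumes h: "h \<noteq> 0" "is_form n e h" and sos: "sum_of_squares_of {g. \<exists>e. is_form n e g} (norm_poly l * h)"
  shows "d - 2 \<le> e"
proof -
  from sos obtain gs where gs: "\<And>g. g \<in> set gs \<Longrightarrow> \<exists>e. is_form n e g" and eq: "norm_poly l * h = (\<Sum>g\<leftarrow>gs. g\<^sup>2)"
    by (auto simp: sum_of_squares_of_def subset_iff)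
  have "norm_poly l * h \<noteq> 0" using h norm_poly_nonzero by simp
  then obtain m where m: "m \<in> keys (norm_poly l * h)" by (meson all_not_in_conv keys_eq_empty)
  have keys_sum: "\<exists>g\<in>set gs. m \<in> keys (g\<^sup>2)" if "m \<in> keys (\<Sum>g\<leftarrow>gs. g\<^sup>2)" for gs :: "rat mpoly list"
    using that
  proof (induction gs)
    case (Cons g gs)
    thus ?case using keys_add[of "g\<^sup>2" "\<Sum>g\<leftarrow>gs. g\<^sup>2"] by auto
  qed auto
  from keys_sum[of gs] m eq obtain g where g: "g \<in> set gs" "m \<in> keys (g\<^sup>2)" by auto
  then obtain e' where e': "is_form n e' g" using gs by blast
  have "is_form n (e' + e') (g\<^sup>2)" unfolding power2_eq_square by (intro is_form_mult e')
  hence deg: "d + e = e' + e'"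
    using g(2) m is_form_mult[OF is_form_norm_poly h(2)] unfolding is_form_iff by metis
  have "g \<noteq> 0" using g(2) by auto
  have "\<not> e' + 1 < d"
  proof
    assume small: "e' + 1 < d"
    have "g * norm_poly l \<noteq> 0" using \<open>g \<noteq> 0\<close> norm_poly_nonzero by simp
    hence nz: "complexify (g * norm_poly l) \<noteq> (0 :: complex mpoly)"
      by (simp add: conjugate_poly_eq_0_iff)
    have gl: "is_form n (e' + d) (complexify (g * norm_poly l) :: complex mpoly)"
      by (intro is_form_conjugate is_form_mult e' is_form_norm_poly)
    obtain v :: "nat \<Rightarrow> nat" where v: "eval_mpoly (complexify (g * norm_poly l)) (\<lambda>i. complex_of_nat (v i)) \<noteq> 0"
      using nonzero_mpoly_has_nonzero_value[OF nz, of n] gl by (auto simp: is_form_def)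
    define r where "r i = (if i \<le> n then complex_of_nat (v i) else 0)" for i
    have "eval_mpoly (complexify (g * norm_poly l)) r \<noteq> 0"
      using v eval_mpoly_cong[of "complexify (g * norm_poly l)" n r "\<lambda>i. complex_of_nat (v i)"] gl
      by (simp add: r_def is_form_def)
    hence r: "eval_mpoly (complexify g) r \<noteq> 0"
       "(\<Prod>\<phi>\<in>Embs. conj_val \<phi> r) \<noteq> 0"
      by (simp_all add: conjugate_poly_mult' eval_mpoly_mult norm_poly_conjugate[OF nf] eval_mpoly_prod)
    have "eval_mpoly (complexify g) r = 0"
    proof (rule low_degree_form_vanishes[OF is_form_conjugate[OF e'] small])
      show "\<forall>i>n. r i = 0" by (simp add: r_def)
      show "conj_val \<phi> r \<noteq> 0" if "\<phi> \<in> Embs" for \<phi>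
        using r(2) that finite_Embs[OF nf] by auto
    qed (rule squares_vanish_on_pairs[OF gs eq g(1)])
    with r(1) show False by simp
  qed
  with deg show ?thesis by linarith
qed


lemma generic_point_of_hyperplane:
  assumes "\<phi> \<in> Embs"
  shows "\<exists>p\<in>conj_cone {\<phi>}. \<forall>\<psi>\<in>Embs - {\<phi>}. conj_val \<psi> p \<noteq> 0"
proof (rule avoid_kernels)
  show "finite (Embs - {\<phi>})" using finite_Embs[OF nf] by simp
  show "0 \<in> conj_cone {\<phi>}"
    using eval_form_scale[OF is_form_conjugate[OF form], of \<phi> 0 "\<lambda>_. 0"]
    by (simp add: conj_cone_iff zero_fun_def)
  show "x + y \<in> conj_cone {\<phi>}" if "x \<in> conj_cone {\<phi>}" "y \<in> conj_cone {\<phi>}" for x y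
    using conj_cone_linear[OF that, of 1] by (simp add: plus_fun_def)
  show "conj_val \<psi> (x + y) = conj_val \<psi> x + conj_val \<psi> y" for \<psi> x y
    using conj_val_linear[of \<psi> x 1 y] by (simp add: plus_fun_def)
  show "\<exists>w\<in>conj_cone {\<phi>}. conj_val \<psi> w \<noteq> 0" if "\<psi> \<in> Embs - {\<phi>}" for \<psi>
    using conj_val_nonzero_on_conj_cone[of "{\<phi>}" \<psi>] assms that by auto
qed


subsection \<open>A multiplier\<close>

text \<open>
  The forms to be squared are the traces \<open>G a\<close> of \<open>a\<close> times the cofactor of \<open>l\<close>, for elements \<open>a\<close> whose squares
  have sum zero. Expanding the squares, the terms \<open>(P \<phi>)\<^sup>2\<close> have coefficient \<open>B \<phi> \<phi> = 0\<close>, and in the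
  other terms \<open>P \<phi> * P \<psi>\<close> is a multiple of the norm.
\<close>

theorem multiplier_exists:
  obtains h where "h \<noteq> 0" "is_form n (d - 2) h"
    "sum_of_squares_of {g. \<exists>e. is_form n e g} (norm_poly l * h)"
proof -
  let ?E = "Embs :: ('k \<Rightarrow> complex) set"
  note fin = finite_Embs[OF nf]
  have card: "card ?E = d" using card_Embs[OF nf] degree by simp
  obtain as :: "'k list" where as: "1 \<in> set as" "(\<Sum>a\<leftarrow>as. a\<^sup>2) = 0"
    using totally_imaginary_sum_squares_eq_0[OF nf imag] by blast
  define L where "L \<phi> = conjugate_poly \<phi> l" for \<phi> :: "'k \<Rightarrow> complex"
  define P where "P \<phi> = prod L (?E - {\<phi>})" for \<phi>
  define R where "R \<phi> \<psi> = prod L (?E - {\<phi>, \<psi>})" for \<phi> \<psi>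
  define F where "F = prod L ?E"
  have norm: "complexify (norm_poly l) = F"
    unfolding F_def L_def by (rule norm_poly_conjugate[OF nf])
  have "\<exists>g. complexify g = (\<Sum>\<phi>\<in>?E. single 0 (\<phi> a) * P \<phi>)" for a
  proof -
    have "(\<Sum>\<phi>\<in>?E. single 0 (\<phi> a) * P \<phi>)
        = (\<Sum>\<phi>\<in>?E. conjugate_poly \<phi> (single 0 a) * P \<phi>)"
      by (intro sum.cong refl) (simp add: conjugate_poly_single field_embedding_0 Embs_embedding)
    also have "\<dots> \<in> rat_polys"
      unfolding P_def L_def by (rule cofactor_trace_rational[OF nf])
    finally show ?thesis by (elim rangeE) (rule exI, rule sym)
  qed
  hence "\<forall>a. \<exists>g. complexify g = (\<Sum>\<phi>\<in>?E. single 0 (\<phi> a) * P \<phi>)" ..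
  from choice[OF this] obtain G :: "'k \<Rightarrow> rat mpoly" where
    G: "\<And>a. complexify (G a) = (\<Sum>\<phi>\<in>?E. single 0 (\<phi> a) * P \<phi>)" by blast
  have formP: "is_form n (d - 1) (P \<phi>)" if "\<phi> \<in> ?E" for \<phi>
  proof -
    have "is_form n (card (?E - {\<phi>})) (P \<phi>)"
      unfolding P_def L_def by (intro is_form_prod is_form_conjugate form)
    thus ?thesis using that fin card by simp
  qed
  have formR: "is_form n (d - 2) (R \<phi> \<psi>)" if "\<phi> \<in> ?E" "\<psi> \<in> ?E" "\<phi> \<noteq> \<psi>" for \<phi> \<psi>
  proof -
    have "is_form n (card (?E - {\<phi>, \<psi>})) (R \<phi> \<psi>)"
      unfolding R_def L_def by (intro is_form_prod is_form_conjugate form)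
    thus ?thesis using that fin card by (simp add: card_Diff_subset numeral_2_eq_2)
  qed
  have formG: "is_form n (d - 1) (G a)" for a
  proof -
    have "is_form n (d - 1) (complexify (G a) :: complex mpoly)"
      unfolding G by (intro is_form_sum is_form_const_mult formP)
    thus ?thesis by (simp only: is_form_conjugate_iff[OF field_embedding_of_rat])
  qed
  have PP: "P \<phi> * P \<psi> = F * R \<phi> \<psi>" if "\<phi> \<in> ?E" "\<psi> \<in> ?E" "\<phi> \<noteq> \<psi>" for \<phi> \<psi>
  proof -
    have "F = L \<psi> * P \<psi>" unfolding F_def P_def using fin that by (intro prod.remove)
    moreover have "P \<phi> = L \<psi> * R \<phi> \<psi>"
    proof -
      have "?E - {\<phi>, \<psi>} = ?E - {\<phi>} - {\<psi>}" by auto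
      thus ?thesis unfolding P_def R_def using fin that by (simp add: prod.remove)
    qed
    ultimately show ?thesis by (simp add: mult_ac)
  qed
  define B where "B \<phi> \<psi> = (\<Sum>a\<leftarrow>as. \<phi> a * \<psi> a)" for \<phi> \<psi> :: "'k \<Rightarrow> complex"
  have diagonal: "B \<phi> \<phi> = 0" if "\<phi> \<in> ?E" for \<phi>
  proof -
    have "\<phi> (\<Sum>a\<leftarrow>bs. a\<^sup>2) = (\<Sum>a\<leftarrow>bs. \<phi> a * \<phi> a)" for bs
      by (induction bs) (simp_all add: field_embedding_0 field_embedding_add field_embedding_mult
        Embs_embedding[OF that] power2_eq_square)
    from this[of as] show ?thesis by (simp add: B_def as field_embedding_0 Embs_embedding[OF that])
  qed
  define H where "H = (\<Sum>\<phi>\<in>?E. \<Sum>\<psi>\<in>?E. if \<phi> = \<psi> then 0 else single 0 (B \<phi> \<psi>) * R \<phi> \<psi>)"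
  have formH: "is_form n (d - 2) H"
    unfolding H_def by (intro is_form_sum) (auto intro!: is_form_const_mult formR)
  define S where "S = (\<Sum>a\<leftarrow>as. (G a)\<^sup>2)"
  have "complexify S = (\<Sum>a\<leftarrow>as. (complexify (G a))\<^sup>2)"
    by (simp add: S_def conjugate_poly_sum_list conjugate_poly_power comp_def)
  also have "\<dots> = (\<Sum>\<phi>\<in>?E. \<Sum>\<psi>\<in>?E. single 0 (B \<phi> \<psi>) * (P \<phi> * P \<psi>))"
    unfolding B_def
  proof (induction as)
    case (Cons a as)
    have "(complexify (G a))\<^sup>2
       = (\<Sum>\<phi>\<in>?E. \<Sum>\<psi>\<in>?E. single 0 (\<phi> a * \<psi> a) * (P \<phi> * P \<psi>))"
      unfolding G power2_eq_square sum_product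
    proof (intro sum.cong refl)
      fix \<phi> \<psi> :: "'k \<Rightarrow> complex"
      have "single 0 (\<phi> a) * P \<phi> * (single 0 (\<psi> a) * P \<psi>)
        = (single 0 (\<phi> a) * single 0 (\<psi> a)) * (P \<phi> * P \<psi>)" by (simp only: mult_ac)
      thus "single 0 (\<phi> a) * P \<phi> * (single 0 (\<psi> a) * P \<psi>)
        = single 0 (\<phi> a * \<psi> a) * (P \<phi> * P \<psi>)" by (simp only: mult_single add_0_left)
    qed
    thus ?case using Cons.IH by (simp add: single_add distrib_right sum.distrib)
  qed simp
  also have "\<dots> = F * H"
    unfolding H_def sum_distrib_left
  proof (intro sum.cong refl)
    fix \<phi> \<psi> assume "\<phi> \<in> ?E" "\<psi> \<in> ?E"
    thus "single 0 (B \<phi> \<psi>) * (P \<phi> * P \<psi>)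
       = F * (if \<phi> = \<psi> then 0 else single 0 (B \<phi> \<psi>) * R \<phi> \<psi>)"
      using PP[of \<phi> \<psi>] by (auto simp: diagonal mult_ac)
  qed
  finally have SFH: "complexify S = complexify (norm_poly l) * H"
    unfolding norm .
  \<comment> \<open>The quotient \<open>H\<close> is given with complex coefficients. A linear retraction of the complex numbers
     onto the rationals turns it into a rational quotient.\<close>
  define basis :: "complex set" where "basis = rat_vs.extend_basis {1}"
  have 1: "\<not> rat_vs.dependent {1 :: complex}" by (simp add: rat_vs.dependent_single)
  have basis: "\<not> rat_vs.dependent basis" "rat_vs.span basis = UNIV" "1 \<in> basis"
    unfolding basis_def
    using rat_vs.independent_extend_basis[OF 1] rat_vs.span_extend_basis[OF 1] rat_vs.extend_basis_superset[OF 1]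
    by auto
  define \<rho> where "\<rho> x = rat_vs.representation basis x 1" for x
  have \<rho>: "\<rho> 0 = 0" "\<rho> (x + y) = \<rho> x + \<rho> y" "\<rho> (of_rat q * x) = q * \<rho> x" "\<rho> 1 = 1" for x y q
  proof -
    show "\<rho> 0 = 0" by (simp add: \<rho>_def rat_vs.representation_zero)
    show "\<rho> (x + y) = \<rho> x + \<rho> y" using basis by (simp add: \<rho>_def rat_vs.representation_add)
    show "\<rho> (of_rat q * x) = q * \<rho> x"
      using rat_vs.representation_scale[OF basis(1), of x q] basis by (simp add: \<rho>_def rat_scale_def)
    show "\<rho> 1 = 1" using basis by (simp add: \<rho>_def rat_vs.representation_basis)
  qed
  have retract: "conjugate_poly \<rho> (complexify p * q) = p * conjugate_poly \<rho> q" for p q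
    by (rule conjugate_poly_retract_mult) (simp_all add: \<rho> of_rat_add)
  define h where "h = conjugate_poly \<rho> H"
  have "conjugate_poly \<rho> (complexify S * 1) = S * conjugate_poly \<rho> 1" by (rule retract)
  also have "conjugate_poly \<rho> 1 = 1" using \<rho> by (simp add: conjugate_poly_single flip: single_one)
  finally have Sh: "S = norm_poly l * h" by (simp add: SFH retract h_def)
  have "card ?E > 0"
  proof -
    obtain B :: "'k set" where B: "finite B" "rat_vs.span B = UNIV" "card B = field_degree TYPE('k)"
      using nf by (rule number_field_basis)
    have "B \<noteq> {}"
    proof
      assume "B = {}"
      with B(2) have "(1 :: 'k) \<in> {0}" by (metis UNIV_I rat_vs.span_empty)
      thus False by simp
    qed
    hence "card B > 0" using B(1) by (simp add: card_gt_0_iff)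
    thus ?thesis using B(3) card_Embs[OF nf] by simp
  qed
  then obtain \<phi> where \<phi>: "\<phi> \<in> ?E" by (auto simp: card_gt_0_iff)
  have "G 1 \<noteq> 0"
  proof
    assume "G 1 = 0"
    obtain p where p: "p \<in> conj_cone {\<phi>}" "\<And>\<psi>. \<psi> \<in> ?E - {\<phi>} \<Longrightarrow> conj_val \<psi> p \<noteq> 0"
      using generic_point_of_hyperplane[OF \<phi>] by blast
    have Pval: "eval_mpoly (P \<psi>) p = (\<Prod>\<chi>\<in>?E - {\<psi>}. conj_val \<chi> p)" for \<psi>
      by (simp add: P_def L_def eval_mpoly_prod)
    have others: "eval_mpoly (P \<psi>) p = 0" if "\<psi> \<in> ?E - {\<phi>}" for \<psi>
      unfolding Pval using that \<phi> p(1) fin by (intro prod_zero) (auto simp: conj_cone_iff)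
    have "0 = eval_mpoly (complexify (G 1)) p" using \<open>G 1 = 0\<close> by simp
    also have "\<dots> = (\<Sum>\<psi>\<in>?E. eval_mpoly (P \<psi>) p)"
      unfolding G eval_mpoly_sum
      by (intro sum.cong refl) (simp add: eval_mpoly_mult field_embedding_1 Embs_embedding)
    also have "\<dots> = eval_mpoly (P \<phi>) p"
      using others by (subst sum.remove[OF fin \<phi>]) simp
    also have "\<dots> \<noteq> 0" unfolding Pval using p(2) fin by auto
    finally show False by simp
  qed
  then obtain v :: "nat \<Rightarrow> nat" where v: "eval_mpoly (G 1) (\<lambda>i. of_nat (v i)) \<noteq> 0"
    using nonzero_mpoly_has_nonzero_value[of "G 1" n] formG[of 1] by (auto simp: is_form_def)
  have "S \<noteq> 0"
  proof
    assume "S = 0"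
    hence "0 = eval_mpoly S (\<lambda>i. of_nat (v i))" by simp
    also have "\<dots> = (\<Sum>a\<leftarrow>as. (eval_mpoly (G a) (\<lambda>i. of_nat (v i)))\<^sup>2)"
      by (simp add: S_def eval_mpoly_sum_list eval_mpoly_power comp_def)
    finally have "(\<Sum>a\<leftarrow>as. (eval_mpoly (G a) (\<lambda>i. of_nat (v i)))\<^sup>2) = 0" by simp
    hence "(eval_mpoly (G 1) (\<lambda>i. of_nat (v i)))\<^sup>2 = 0"
      by (subst (asm) sum_list_nonneg_eq_0_iff) (use as in auto)
    with v show False by simp
  qed
  show ?thesis
  proof (rule that[of h])
    show "h \<noteq> 0" using \<open>S \<noteq> 0\<close> Sh by auto
    show "is_form n (d - 2) h" unfolding h_def by (rule is_form_conjugate[OF formH])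
    show "sum_of_squares_of {g. \<exists>e. is_form n e g} (norm_poly l * h)"
      unfolding sum_of_squares_of_def Sh[symmetric] S_def
      by (intro exI[of _ "map G as"]) (use formG in \<open>auto simp: comp_def\<close>)
  qed
qed

end


section \<open>Positive semidefinite rational quadratic forms\<close>

text \<open>
  With \<open>a = p / r\<close>, take \<open>p * r\<close> copies of \<open>1 / r\<close>.
\<close>

lemma nonneg_rat_sum_of_squares:
  fixes a :: rat
  assumes "a \<ge> 0"
  obtains bs :: "rat list" where "a = (\<Sum>b\<leftarrow>bs. b\<^sup>2)"
proof -
  obtain p r where a: "a = Rat.Fract p r" "r > 0" by (cases a) auto
  with assms have "p \<ge> 0" by (simp add: Rat.zero_le_Fract_iff)
  have "(\<Sum>b\<leftarrow>replicate (nat p * nat r) (1 / of_int r :: rat). b\<^sup>2) = of_int (p * r) * (1 / of_int r)\<^sup>2"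
    using \<open>p \<ge> 0\<close> a by (simp add: sum_list_replicate)
  also have "\<dots> = a" using a by (simp add: Fract_of_int_quotient power2_eq_square)
  finally show ?thesis by (rule that[OF sym])
qed

text \<open>
  Induction on the number of variables, completing the square in the last one: if its diagonal entry
  is zero, then so is its whole row, and otherwise a multiple of the square of the linear form
  given by this row is split off.
\<close>

lemma psd_matrix_sum_of_squares:
  fixes q :: "nat \<Rightarrow> nat \<Rightarrow> rat"
  assumes "\<And>i j. q i j = q j i" "\<And>x. (\<Sum>i<m. \<Sum>j<m. q i j * x i * x j) \<ge> 0"
  shows "\<exists>cs. \<forall>i<m. \<forall>j<m. q i j = (\<Sum>c\<leftarrow>cs. c i * c j)"
  using assms
proof (induction m arbitrary: q)
  case (Suc m)
  define a where "a = q m m"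
  define b where "b x = (\<Sum>i<m. q i m * x i)" for x
  have split: "(\<Sum>i<Suc m. \<Sum>j<Suc m. q i j * x i * x j)
     = (\<Sum>i<m. \<Sum>j<m. q i j * x i * x j) + 2 * x m * b x + a * (x m)\<^sup>2" for x
  proof -
    have "(\<Sum>j<m. q m j * x m * x j) = x m * b x"
      unfolding b_def sum_distrib_left using Suc.prems(1) by (intro sum.cong) (simp_all add: mult_ac)
    moreover have "(\<Sum>i<m. q i m * x i * x m) = x m * b x"
      unfolding b_def sum_distrib_left by (intro sum.cong) (simp_all add: mult_ac)
    ultimately show ?thesis by (simp add: sum.distrib a_def power2_eq_square algebra_simps)
  qed
  have upd: "(\<Sum>i<m. \<Sum>j<m. r i j * (x(m := t)) i * (x(m := t)) j) = (\<Sum>i<m. \<Sum>j<m. r i j * x i * x j)"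
    "b (x(m := t)) = b x" for x t and r :: "nat \<Rightarrow> nat \<Rightarrow> rat"
    by (auto simp: b_def intro!: sum.cong)
  have psd: "(\<Sum>i<m. \<Sum>j<m. q i j * x i * x j) + 2 * t * b x + a * t\<^sup>2 \<ge> 0" for x t
    using Suc.prems(2)[of "x(m := t)"] unfolding split upd by simp
  have "a \<ge> 0" using psd[of "\<lambda>_. 0" 1] by (simp add: b_def)
  show ?case
  proof (cases "a = 0")
    case True
    have b0: "b x = 0" for x
    proof (rule ccontr)
      assume "b x \<noteq> 0"
      \<comment> \<open>The form is affine in the last coordinate, and takes the value \<open>- 1\<close> at the following one.\<close>
      define s where "s = (\<Sum>i<m. \<Sum>j<m. q i j * x i * x j)"
      have "s + 2 * (- (s + 1) / (2 * b x)) * b x \<ge> 0" using psd[of x "- (s + 1) / (2 * b x)"] True by (simp add: s_def)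
      thus False using \<open>b x \<noteq> 0\<close> by (simp add: field_simps)
    qed
    have zero: "q i m = 0" if "i < m" for i
      using b0[of "\<lambda>j. if j = i then 1 else 0"] that by (simp add: b_def sum.delta if_distrib[of "(*) _"] cong: if_cong)
    obtain cs where cs: "\<forall>i<m. \<forall>j<m. q i j = (\<Sum>c\<leftarrow>cs. c i * c j)"
      using Suc.IH[of q] Suc.prems(1) psd[of _ 0] by auto
    have "q i j = (\<Sum>c\<leftarrow>map (\<lambda>c. c(m := 0)) cs. c i * c j)" if "i < Suc m" "j < Suc m" for i j
      using that cs zero Suc.prems(1)[of m j] True
      by (cases "i = m"; cases "j = m") (auto simp: comp_def a_def less_Suc_eq)
    thus ?thesis by blast
  next
    case False
    with \<open>a \<ge> 0\<close> have a: "a > 0" by simp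
    define q' where "q' i j = q i j - q i m * q j m / a" for i j
    \<comment> \<open>The remaining form is the minimum over the last coordinate, attained at \<open>- b x / a\<close>.\<close>
    have "(\<Sum>i<m. \<Sum>j<m. q' i j * x i * x j) \<ge> 0" for x
    proof -
      have "(\<Sum>i<m. \<Sum>j<m. (q i m * x i) * (q j m * x j)) = b x * b x"
        by (simp add: b_def sum_product)
      hence "(\<Sum>i<m. \<Sum>j<m. q' i j * x i * x j) = (\<Sum>i<m. \<Sum>j<m. q i j * x i * x j) - b x * b x / a"
        by (simp add: q'_def algebra_simps sum_subtractf sum_divide_distrib[symmetric])
      also have "\<dots> = (\<Sum>i<m. \<Sum>j<m. q i j * x i * x j) + 2 * (- b x / a) * b x + a * (- b x / a)\<^sup>2"
        using a by (simp add: power2_eq_square field_simps)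
      also have "\<dots> \<ge> 0" by (rule psd)
      finally show ?thesis .
    qed
    then obtain cs where cs: "\<forall>i<m. \<forall>j<m. q' i j = (\<Sum>c\<leftarrow>cs. c i * c j)"
      using Suc.IH[of q'] Suc.prems(1) by (auto simp: q'_def mult.commute)
    obtain bs :: "rat list" where bs: "a = (\<Sum>b\<leftarrow>bs. b\<^sup>2)"
      using nonneg_rat_sum_of_squares[OF \<open>a \<ge> 0\<close>] .
    let ?cs = "map (\<lambda>b i. b * (q i m / a)) bs @ map (\<lambda>c. c(m := 0)) cs"
    have first: "(\<Sum>b\<leftarrow>bs. (b * x) * (b * y)) = a * x * y" for x y
      unfolding bs by (induction bs) (simp_all add: algebra_simps power2_eq_square)
    have "q i j = (\<Sum>c\<leftarrow>?cs. c i * c j)" if ij: "i < Suc m" "j < Suc m" for i j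
    proof -
      have "(\<Sum>c\<leftarrow>?cs. c i * c j) = a * (q i m / a) * (q j m / a)
          + (\<Sum>c\<leftarrow>cs. (c(m := 0)) i * (c(m := 0)) j)"
        by (simp only: map_append sum_list.append map_map comp_def first)
      also have "(\<Sum>c\<leftarrow>cs. (c(m := 0)) i * (c(m := 0)) j) = (if i < m \<and> j < m then q' i j else 0)"
        using cs ij by (cases "i = m"; cases "j = m") auto
      also have "a * (q i m / a) * (q j m / a) + (if i < m \<and> j < m then q' i j else 0) = q i j"
        using a ij Suc.prems(1)[of m j] by (cases "i = m"; cases "j = m") (auto simp: q'_def a_def)
      finally show ?thesis by (rule sym)
    qed
    thus ?thesis by blast
  qed
qed simp

lemma monom_deg_Suc:
  assumes "monom_deg m = Suc k"
  obtains i m' where "m = single i 1 + m'" "monom_deg m' = k" "i \<in> keys m"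
    "keys m' \<subseteq> keys m"
proof -
  obtain i where i: "i \<in> keys m"
    using assms by (metis monom_deg_def nat.distinct(1) all_not_in_conv sum.empty)
  define m' where "m' = m - single i 1"
  have m: "m = single i 1 + m'"
    using i by (intro poly_mapping_eqI)
      (auto simp: m'_def lookup_add lookup_minus lookup_single when_def in_keys_iff)
  moreover have "monom_deg m' = k"
    using assms monom_deg_add[of "single i 1" m'] m by (simp add: monom_deg_def)
  moreover have "keys m' \<subseteq> keys m"
    by (auto simp: m'_def in_keys_iff lookup_minus)
  ultimately show ?thesis using i that by blast
qed

lemma quadratic_form_matrix:
  fixes h :: "rat mpoly"
  assumes "is_form n 2 h"
  shows "\<exists>q. (\<forall>i j. q i j = q j i) \<and>
    (\<forall>v. eval_mpoly h v = (\<Sum>i<Suc n. \<Sum>j<Suc n. q i j * v i * v j))"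
proof -
  have monomial: "\<exists>q. (\<forall>i j. q i j = q j i) \<and>
    (\<forall>v. c * monom_val m v = (\<Sum>i<Suc n. \<Sum>j<Suc n. q i j * v i * v j))"
    if m: "m \<in> keys h" for m and c :: rat
  proof -
    have deg: "monom_deg m = Suc (Suc 0)" and keys: "keys m \<subseteq> {..n}"
      using assms m by (auto simp: is_form_iff)
    obtain a m' where a: "m = single a 1 + m'" "monom_deg m' = Suc 0" "a \<in> keys m"
      "keys m' \<subseteq> keys m" by (rule monom_deg_Suc[OF deg])
    obtain b m'' where b: "m' = single b 1 + m''" "monom_deg m'' = 0" "b \<in> keys m'"
      by (rule monom_deg_Suc[OF a(2)])
    have "m'' = 0" using b(2) by (auto simp: monom_deg_def in_keys_iff intro!: poly_mapping_eqI)
    have val: "monom_val m v = v a * v b" for v :: "nat \<Rightarrow> rat"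
      unfolding a(1) b(1) \<open>m'' = 0\<close> monom_val_add by (simp add: monom_val_def)
    have ab: "a < Suc n" "b < Suc n" using keys a b by auto
    define q where "q i j = c / 2 * ((if i = a then 1 else 0) * (if j = b then 1 else 0)
      + (if j = a then 1 else 0) * (if i = b then 1 else 0))" for i j
    have delta: "(\<Sum>i<Suc n. (if i = k then 1 else 0) * v i) = v k" if "k < Suc n" for k and v :: "nat \<Rightarrow> rat"
    proof -
      have "(\<Sum>i<Suc n. (if i = k then 1 else 0) * v i) = (\<Sum>i<Suc n. if i = k then v i else 0)"
        by (intro sum.cong) auto
      thus ?thesis using that by (simp del: sum.lessThan_Suc)
    qed
    have "(\<Sum>i<Suc n. \<Sum>j<Suc n. q i j * v i * v j) = c * (v a * v b)" for v
    proof -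
      have "(\<Sum>i<Suc n. \<Sum>j<Suc n. q i j * v i * v j)
        = c / 2 * ((\<Sum>i<Suc n. (if i = a then 1 else 0) * v i) * (\<Sum>j<Suc n. (if j = b then 1 else 0) * v j)
        + (\<Sum>i<Suc n. (if i = b then 1 else 0) * v i) * (\<Sum>j<Suc n. (if j = a then 1 else 0) * v j))"
        unfolding sum_product unfolding sum.distrib[symmetric] unfolding sum_distrib_left
        by (intro sum.cong refl) (simp add: q_def algebra_simps)
      also have "\<dots> = c * (v a * v b)" unfolding delta[OF ab(1)] delta[OF ab(2)] by (simp add: mult_ac)
      finally show ?thesis .
    qed
    thus ?thesis using val by (intro exI[of _ q]) (auto simp: q_def)
  qed
  have "\<forall>m. \<exists>q. m \<in> keys h \<longrightarrow> (\<forall>i j. q i j = q j i) \<and>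
    (\<forall>v. lookup h m * monom_val m v = (\<Sum>i<Suc n. \<Sum>j<Suc n. q i j * v i * v j))"
    using monomial by blast
  from choice[OF this] obtain Q where Q: "\<And>m i j. m \<in> keys h \<Longrightarrow> Q m i j = Q m j i"
    "\<And>m v. m \<in> keys h \<Longrightarrow>
      lookup h m * monom_val m v = (\<Sum>i<Suc n. \<Sum>j<Suc n. Q m i j * v i * v j)" by blast
  define q where "q i j = (\<Sum>m\<in>keys h. Q m i j)" for i j
  have "eval_mpoly h v = (\<Sum>i<Suc n. \<Sum>j<Suc n. q i j * v i * v j)" for v
  proof -
    have "eval_mpoly h v = (\<Sum>m\<in>keys h. \<Sum>i<Suc n. \<Sum>j<Suc n. Q m i j * v i * v j)"
      unfolding eval_mpoly_eq by (intro sum.cong refl Q(2))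
    also have "\<dots> = (\<Sum>i<Suc n. \<Sum>m\<in>keys h. \<Sum>j<Suc n. Q m i j * v i * v j)"
      by (rule sum.swap)
    also have "\<dots> = (\<Sum>i<Suc n. \<Sum>j<Suc n. \<Sum>m\<in>keys h. Q m i j * v i * v j)"
      by (intro sum.cong refl sum.swap)
    finally show ?thesis by (simp only: q_def sum_distrib_right)
  qed
  moreover have "q i j = q j i" for i j unfolding q_def by (intro sum.cong refl Q(1))
  ultimately show ?thesis by (intro exI[of _ q]) simp
qed

lemma eval_mpoly_diff:
  fixes p q :: "'a::comm_ring_1 mpoly"
  shows "eval_mpoly (p - q) v = eval_mpoly p v - eval_mpoly q v"
  using eval_mpoly_add[of "p - q" q v] by simp

text \<open>
  The decomposition of the matrix gives a polynomial with the same values, hence the same polynomial.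
\<close>

lemma psd_quadratic_form_sum_of_squares:
  fixes h :: "rat mpoly"
  assumes h: "is_form n 2 h" and psd: "\<And>v. eval_mpoly h v \<ge> 0"
  shows "sum_of_squares_of {g. is_form n 1 g} h"
proof -
  obtain q where sym: "\<And>i j. q i j = q j i"
    and q: "\<And>v. eval_mpoly h v = (\<Sum>i<Suc n. \<Sum>j<Suc n. q i j * v i * v j)"
    using quadratic_form_matrix[OF h] by blast
  obtain cs where cs: "\<forall>i<Suc n. \<forall>j<Suc n. q i j = (\<Sum>c\<leftarrow>cs. c i * c j)"
    using psd_matrix_sum_of_squares[where m = "Suc n", OF sym psd[unfolded q]] by blast
  define lin :: "(nat \<Rightarrow> rat) \<Rightarrow> rat mpoly" where
    "lin c = (\<Sum>i<Suc n. single (single i 1) (c i))" for c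
  have lin_form: "is_form n 1 (lin c)" for c
    unfolding lin_def by (intro is_form_sum) (auto simp: is_form_iff monom_deg_def)
  have lin_val: "eval_mpoly (lin c) v = (\<Sum>i<Suc n. c i * v i)" for c v
    unfolding lin_def eval_mpoly_sum by (intro sum.cong refl) (simp add: monom_val_def)
  define S where "S = (\<Sum>g\<leftarrow>map lin cs. g\<^sup>2)"
  have S_val: "eval_mpoly S v = eval_mpoly h v" for v
  proof -
    have "eval_mpoly S v = (\<Sum>c\<leftarrow>cs. (\<Sum>i<Suc n. c i * v i)\<^sup>2)"
      by (simp add: S_def eval_mpoly_sum_list eval_mpoly_power lin_val comp_def del: sum.lessThan_Suc)
    also have "\<dots> = (\<Sum>i<Suc n. \<Sum>j<Suc n. (\<Sum>c\<leftarrow>cs. c i * c j) * v i * v j)"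
    proof (induction cs)
      case (Cons c cs)
      have "(\<Sum>i<Suc n. c i * v i)\<^sup>2 = (\<Sum>i<Suc n. \<Sum>j<Suc n. c i * c j * v i * v j)"
        unfolding power2_eq_square sum_product by (intro sum.cong refl) (simp add: mult_ac)
      with Cons.IH show ?case
        by (simp add: distrib_right sum.distrib del: sum.lessThan_Suc)
    qed simp
    also have "\<dots> = eval_mpoly h v" unfolding q using cs by (intro sum.cong refl) auto
    finally show ?thesis .
  qed
  have "h - S \<in> polys_in n"
  proof -
    have "is_form n 2 S"
      unfolding S_def
    proof (induction cs)
      case (Cons c cs)
      have "is_form n 2 ((lin c)\<^sup>2)"
        using is_form_mult[OF lin_form lin_form, of c c] by (simp add: power2_eq_square numeral_2_eq_2)
      thus ?case using Cons.IH by (simp add: is_form_add)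
    qed simp
    thus ?thesis using h keys_diff[of h S] unfolding is_form_def polys_in_def by (simp, blast)
  qed
  have "h = S"
  proof (rule ccontr)
    assume "h \<noteq> S"
    hence "h - S \<noteq> 0" by simp
    then obtain v :: "nat \<Rightarrow> nat" where "eval_mpoly (h - S) (\<lambda>i. of_nat (v i)) \<noteq> 0"
      using nonzero_mpoly_has_nonzero_value[OF _ \<open>h - S \<in> polys_in n\<close>] by blast
    thus False by (simp add: eval_mpoly_diff S_val)
  qed
  thus ?thesis unfolding sum_of_squares_of_def S_def
    by (intro exI[of _ "map lin cs"]) (use lin_form in auto)
qed


section \<open>Positivity of the norm\<close>

lemma prod_conjugate_pairs_nonneg:
  fixes z :: "'i \<Rightarrow> complex"
  assumes "finite E" "\<And>a. a \<in> E \<Longrightarrow> s a \<in> E \<and> s a \<noteq> a \<and> s (s a) = a \<and> z (s a) = cnj (z a)"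
  shows "\<exists>r\<ge>0. prod z E = of_real r"
  using assms
proof (induction "card E" arbitrary: E rule: less_induct)
  case less
  show ?case
  proof (cases "E = {}")
    case True
    thus ?thesis by (intro exI[of _ 1]) simp
  next
    case False
    then obtain a where a: "a \<in> E" by blast
    note sa = less.prems(2)[OF a]
    let ?E = "E - {a} - {s a}"
    have "card ?E < card E" using a less.prems(1) by (intro psubset_card_mono) auto
    moreover have "s b \<in> ?E \<and> s b \<noteq> b \<and> s (s b) = b \<and> z (s b) = cnj (z b)" if "b \<in> ?E" for b
      using less.prems(2)[of b] that sa by auto
    ultimately obtain r where r: "r \<ge> 0" "prod z ?E = of_real r"
      using less.hyps[of ?E] less.prems(1) by auto
    have "prod z E = z a * prod z (E - {a})" using less.prems(1) a by (rule prod.remove)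
    also have "prod z (E - {a}) = z (s a) * prod z ?E" using less.prems(1) sa by (intro prod.remove) auto
    also have "z a * (z (s a) * prod z ?E) = of_real ((cmod (z a))\<^sup>2 * r)"
      unfolding r(2) using sa complex_norm_square[of "z a"] by (simp flip: mult.assoc)
    finally show ?thesis using r(1) by (intro exI[of _ "(cmod (z a))\<^sup>2 * r"]) auto
  qed
qed

text \<open>
  Complex conjugation acts on the embeddings without fixed points.
\<close>

lemma norm_poly_nonneg:
  fixes l :: "'k::field_char_0 mpoly"
  assumes nf: "number_field TYPE('k)" and imag: "totally_imaginary TYPE('k)"
  shows "eval_mpoly (norm_poly l) v \<ge> 0"
proof -
  let ?E = "Embs :: ('k \<Rightarrow> complex) set"
  let ?v = "\<lambda>i. complex_of_rat (v i)"
  define z where "z \<phi> = eval_mpoly (conjugate_poly \<phi> l) ?v" for \<phi> :: "'k \<Rightarrow> complex"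
  have emb: "field_embedding \<phi>" if "\<phi> \<in> ?E" for \<phi> using that by (simp add: Embs_def)
  have "\<exists>r\<ge>0. prod z ?E = of_real r"
  proof (rule prod_conjugate_pairs_nonneg[OF finite_Embs[OF nf], where s = "\<lambda>\<phi>. cnj \<circ> \<phi>"])
    fix \<phi> assume \<phi>: "\<phi> \<in> ?E"
    have "cnj (z \<phi>) = eval_mpoly (conjugate_poly cnj (conjugate_poly \<phi> l)) (\<lambda>i. cnj (?v i))"
      unfolding z_def by (rule eval_conjugate_poly[symmetric]) simp
    also have "\<dots> = z (cnj \<circ> \<phi>)"
      unfolding z_def field_embedding_of_rat_apply[OF field_embedding_cnj]
      by (simp add: conjugate_poly_compose field_embedding_0[OF emb[OF \<phi>]])
    finally have "z (cnj \<circ> \<phi>) = cnj (z \<phi>)" ..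
    moreover have "cnj \<circ> (cnj \<circ> \<phi>) = \<phi>" by auto
    ultimately show "cnj \<circ> \<phi> \<in> ?E \<and> cnj \<circ> \<phi> \<noteq> \<phi> \<and> cnj \<circ> (cnj \<circ> \<phi>) = \<phi> \<and> z (cnj \<circ> \<phi>) = cnj (z \<phi>)"
      using cnj_comp_in_Embs[OF nf \<phi>] cnj_comp_neq_of_totally_imaginary[OF imag \<phi>] by blast
  qed
  then obtain r where r: "r \<ge> 0" "prod z ?E = of_real r" by blast
  have "of_rat (eval_mpoly (norm_poly l) v) = eval_mpoly (complexify (norm_poly l)) ?v"
    by (rule eval_conjugate_poly[symmetric]) simp
  also have "\<dots> = of_real r"
    unfolding norm_poly_conjugate[OF nf] eval_mpoly_prod r(2)[symmetric] z_def ..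
  finally have "of_rat (eval_mpoly (norm_poly l) v) = complex_of_real r" .
  moreover have "complex_of_real (of_rat x) = of_rat x" for x
    by (rule field_embedding_of_rat_apply) (simp add: field_embedding_def)
  ultimately have "complex_of_real (of_rat (eval_mpoly (norm_poly l) v)) = of_real r" by metis
  hence "real_of_rat (eval_mpoly (norm_poly l) v) = r" by (simp only: of_real_eq_iff)
  thus ?thesis using r(1) by (metis zero_le_of_rat_iff)
qed

lemma poly_negative_near_0:
  fixes w :: "rat poly"
  assumes "poly w 0 < 0"
  obtains K :: nat where "\<And>k. k \<ge> K \<Longrightarrow> poly w (1 / of_nat (Suc k)) < 0"
proof -
  obtain c q where w: "w = pCons c q" by (cases w)
  have "\<exists>M\<ge>0. \<forall>t. 0 \<le> t \<and> t \<le> 1 \<longrightarrow> \<bar>poly q t\<bar> \<le> M"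
  proof (induction q)
    case (pCons a q)
    then obtain M where M: "M \<ge> 0" "\<And>t. 0 \<le> t \<Longrightarrow> t \<le> 1 \<Longrightarrow> \<bar>poly q t\<bar> \<le> M" by blast
    have "\<bar>poly (pCons a q) t\<bar> \<le> \<bar>a\<bar> + M" if t: "0 \<le> t" "t \<le> 1" for t
    proof -
      have "\<bar>t * poly q t\<bar> \<le> 1 * M" unfolding abs_mult using t M by (intro mult_mono) auto
      thus ?thesis using abs_triangle_ineq[of a "t * poly q t"] by simp
    qed
    thus ?case using M by (intro exI[of _ "\<bar>a\<bar> + M"]) auto
  qed (auto intro!: exI[of _ 0])
  then obtain M where M: "\<And>t. 0 \<le> t \<Longrightarrow> t \<le> 1 \<Longrightarrow> \<bar>poly q t\<bar> \<le> M" by blast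
  have c: "c < 0" using assms w by simp
  obtain K :: nat where K: "of_nat K > M / (- c)" using reals_Archimedean2 by blast
  have "poly w (1 / of_nat (Suc k)) < 0" if k: "k \<ge> K" for k
  proof -
    define t :: rat where "t = 1 / of_nat (Suc k)"
    have t: "0 < t" "t \<le> 1" by (auto simp: t_def)
    have "t * poly q t \<le> t * M"
      using t M[of t] by (intro mult_left_mono) (auto intro: order.trans[OF abs_ge_self])
    also have "\<dots> < - c"
    proof -
      have "M < of_nat K * (- c)" using K c by (simp add: field_simps)
      also have "\<dots> \<le> of_nat (Suc k) * (- c)" using k c by (intro mult_right_mono) auto
      finally show ?thesis by (simp add: t_def field_simps)
    qed
    finally have "poly w t < 0" by (simp add: w)
    thus ?thesis by (simp only: t_def)
  qed
  thus ?thesis by (rule that)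
qed

text \<open>
  Where the first factor does not vanish, the sign of the product decides the sign of the second
  factor; on a line through a point where it does not vanish this covers almost all points.
\<close>

lemma nonneg_of_nonneg_multiple:
  fixes f h :: "rat mpoly"
  assumes f: "is_form n d f" "f \<noteq> 0" "\<And>v. eval_mpoly f v \<ge> 0"
    and h: "is_form n e h" and fh: "\<And>v. eval_mpoly (f * h) v \<ge> 0"
  shows "eval_mpoly h x \<ge> 0"
proof (rule ccontr)
  assume neg: "\<not> eval_mpoly h x \<ge> 0"
  obtain y0 :: "nat \<Rightarrow> nat" where y0: "eval_mpoly f (\<lambda>i. of_nat (y0 i)) \<noteq> 0"
    using nonzero_mpoly_has_nonzero_value[OF f(2), of n] f(1) by (auto simp: is_form_def)
  define b where "b i = of_nat (y0 i) - x i" for i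
  obtain u where u: "\<And>t. poly u t = eval_mpoly f (\<lambda>i. x i + t * b i)"
    using eval_form_on_line[OF f(1)] by metis
  obtain w where w: "\<And>t. poly w t = eval_mpoly h (\<lambda>i. x i + t * b i)"
    using eval_form_on_line[OF h] by metis
  have "poly u 1 \<noteq> 0" using y0 by (simp add: u b_def)
  hence "u \<noteq> 0" by auto
  have "poly w 0 < 0" using neg by (simp add: w)
  then obtain K :: nat where K: "\<And>k. k \<ge> K \<Longrightarrow> poly w (1 / of_nat (Suc k)) < 0"
    using poly_negative_near_0 by blast
  have "poly u (1 / of_nat (Suc k)) = 0" if "k \<ge> K" for k
  proof (rule ccontr)
    let ?t = "1 / of_nat (Suc k) :: rat"
    assume "poly u ?t \<noteq> 0"
    hence "poly u ?t > 0" using f(3) by (simp add: u order_less_le)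
    hence "poly u ?t * poly w ?t < 0" using K[OF that] by (rule mult_pos_neg)
    thus False using fh by (simp add: u w eval_mpoly_mult not_le[symmetric])
  qed
  hence "(\<lambda>k. 1 / of_nat (Suc k)) ` {K..} \<subseteq> {t. poly u t = 0}" by auto
  moreover have "infinite ((\<lambda>k. 1 / of_nat (Suc k) :: rat) ` {K..})"
    by (subst finite_image_iff) (auto simp: inj_on_def infinite_Ici)
  ultimately show False using poly_roots_finite[OF \<open>u \<noteq> 0\<close>] finite_subset by blast
qed


section \<open>Multipliers of the norm form\<close>

theorem theorem3p3:
  fixes n d :: nat and l :: "('k::field_char_0) mpoly" and f :: "rat mpoly"
  assumes "n \<ge> 2"
    and "number_field TYPE('k)"
    and "field_degree TYPE('k) = d"
    and "d \<ge> 4"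
    and "totally_imaginary TYPE('k)"
    and "galois_two_transitive TYPE('k)"
    and "is_form n 1 l"
    and "conjugates_in_general_position n l"
    and "f = norm_poly l"
  shows
    "((\<exists>h. h \<noteq> 0 \<and> is_form n (d - 2) h \<and>
           sum_of_squares_of {g. \<exists>e. is_form n e g} (f * h)) \<and>
      \<not> (\<exists>e h. e < d - 2 \<and> h \<noteq> 0 \<and> is_form n e h \<and>
           sum_of_squares_of {g. \<exists>e. is_form n e g} (f * h))) \<and>
     (d = 4 \<longrightarrow>
       (\<forall>h. h \<noteq> 0 \<and> is_form n (d - 2) h \<and>
            sum_of_squares_of {g. \<exists>e. is_form n e g} (f * h) \<longrightarrow>
          sum_of_squares_of {g. is_form n 1 g} h))"
proof (intro conjI impI allI notI)
  note ctx = assms(1-3,5-8)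
  show "\<exists>h. h \<noteq> 0 \<and> is_form n (d - 2) h \<and> sum_of_squares_of {g. \<exists>e. is_form n e g} (f * h)"
    unfolding assms(9) using multiplier_exists[OF ctx] by blast
  show False if "\<exists>e h. e < d - 2 \<and> h \<noteq> 0 \<and> is_form n e h \<and>
           sum_of_squares_of {g. \<exists>e. is_form n e g} (f * h)"
    using that multiplier_degree_ge[OF ctx] unfolding assms(9) by (metis not_le)
  fix h assume "d = 4" and h: "h \<noteq> 0 \<and> is_form n (d - 2) h \<and>
            sum_of_squares_of {g. \<exists>e. is_form n e g} (f * h)"
  have form: "is_form n 2 h" using h \<open>d = 4\<close> by simp
  from h obtain gs where gs: "f * h = (\<Sum>g\<leftarrow>gs. g\<^sup>2)" by (auto simp: sum_of_squares_of_def)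
  show "sum_of_squares_of {g. is_form n 1 g} h"
  proof (rule psd_quadratic_form_sum_of_squares[OF form])
    fix v
    show "eval_mpoly h v \<ge> 0"
    proof (rule nonneg_of_nonneg_multiple[OF _ _ _ form])
      show "is_form n d f" unfolding assms(9) by (rule is_form_norm_poly[OF ctx])
      show "f \<noteq> 0" unfolding assms(9) by (rule norm_poly_nonzero[OF ctx])
      show "eval_mpoly f v \<ge> 0" for v
        unfolding assms(9) by (rule norm_poly_nonneg[OF assms(2,5)])
      show "eval_mpoly (f * h) v \<ge> 0" for v
        unfolding gs by (auto simp: eval_mpoly_sum_list eval_mpoly_power intro!: sum_list_nonneg)
    qed
  qed
qed

end
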